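(* Let $B:=\frac{\sqrt{3}}{\pi}$. (1) Let $(k_n)$ be a sequence of positive integers with $k_n=o(n^{1/4})$, and for each $n$ let $\{v_k^{[j]}\}_{1 \leq k \leq k_n,\, j \in \{L,R\}} \subset [0,\infty)$. Then $$ \lim_{n \to \infty} \left(\mathbf{P}_{n}\left(\frac{kX_{k}^{[j]}}{B\sqrt{n}} \leq v_{k}^{[j]} \ \text{ for } 1 \leq k \leq k_n \text{ and } j \in \{L,R\} \right) - \prod_{\substack{1 \leq k \leq k_n \\ j \in \{L,R\}}} \int_{0}^{v_{k}^{[j]}} e^{-u}\,du \right)=0. $$ (2) Let $(k)=(k_n)$ be a sequence of positive integers with $k=o(n^{1/2})$ and let $v^{[L]}, v^{[R]} \in [0,\infty)$. Then $$ \lim_{n \to \infty} \mathbf{P}_n\left(\frac{kX_k^{[L]}}{B\sqrt{n}} \leq v^{[L]},\ \frac{kX_k^{[R]}}{B\sqrt{n}} \leq v^{[R]} \right) = \left(1-e^{-v^{[L]}}\right)\left(1-e^{-v^{[R]}}\right). $$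
   Context: A unimodal sequence $\lambda$ of size $n$ is a finite sequence of positive integers $\lambda_{1}^{[L]} \leq \dots \leq \lambda_{r}^{[L]} \leq \lambda_{\mathrm{PK}} \geq \lambda_{s}^{[R]} \geq \dots \geq \lambda_{1}^{[R]}$ ($r,s\ge 0$) with a distinguished entry $\lambda_{\mathrm{PK}}$ (the peak), such that $\lambda_{\mathrm{PK}}+\sum_{k=1}^r\lambda_k^{[L]}+\sum_{k=1}^s\lambda_k^{[R]}=n$. Let $\mathcal{U}_n$ be the set of unimodal sequences of size $n$ and $\mathbf{P}_n$ the uniform probability measure on $\mathcal{U}_n$. $X_k^{[L]}(\lambda)$ (resp. $X_k^{[R]}(\lambda)$) is the number of parts equal to $k$ among the parts to the left (resp. right) of the peak, i.e. among the $\lambda_i^{[L]}$ (resp. $\lambda_i^{[R]}$); the peak itself is not counted. *)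

theory Defs
  imports "HOL-Probability.Probability" "HOL-Library.Landau_Symbols"
begin

datatype side = Lft | Rgt

text \<open>Both lists are in the order in which the parts are read in the sequence, i.e. the sequence is
  \<open>left_parts l @ [peak l] @ right_parts l\<close>. Since the peak is recorded, different choices of the
  distinguished entry in the same sequence of numbers count as different unimodal sequences.\<close>

datatype unimodal_seq =
  Unimodal_Seq (left_parts: "nat list") (peak: nat) (right_parts: "nat list")

definition is_unimodal :: "unimodal_seq \<Rightarrow> bool" where
  "is_unimodal l \<longleftrightarrow>
     (\<forall>x \<in> set (left_parts l @ [peak l] @ right_parts l). 0 < x) \<and>
     sorted_wrt (\<le>) (left_parts l @ [peak l]) \<and>
     sorted_wrt (\<ge>) ([peak l] @ right_parts l)"

definition unimodal_size :: "unimodal_seq \<Rightarrow> nat" where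
  "unimodal_size l = peak l + sum_list (left_parts l) + sum_list (right_parts l)"

definition unimodal_seqs :: "nat \<Rightarrow> unimodal_seq set" where
  "unimodal_seqs n = {l. is_unimodal l \<and> unimodal_size l = n}"

text \<open>There is no unimodal sequence of size \<open>0\<close>, so this is a probability measure only for \<open>n > 0\<close>.\<close>

definition unimodal_measure :: "nat \<Rightarrow> unimodal_seq measure" where
  "unimodal_measure n = uniform_count_measure (unimodal_seqs n)"

fun side_parts :: "side \<Rightarrow> unimodal_seq \<Rightarrow> nat list" where
  "side_parts Lft l = left_parts l"
| "side_parts Rgt l = right_parts l"

definition part_mult :: "side \<Rightarrow> nat \<Rightarrow> unimodal_seq \<Rightarrow> nat" where
  "part_mult j k l = count_list (side_parts j l) k"

definition scale_B :: real where
  "scale_B = sqrt 3 / pi"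

end

theory Submission
  imports Defs "HOL-Real_Asymp.Real_Asymp"
begin

text \<open>
  Put \<open>t = 1 / (B \<surd>n) = \<pi> / \<surd>(3 n)\<close>. Fix the peak \<open>m\<close> and let all the multiplicities of the parts
  \<open>k \<le> m\<close> on both sides be independent geometric variables with parameters \<open>1 - e\<^sup>-\<^sup>t\<^sup>k\<close>. Conditioned on total
  size \<open>n\<close>, this law is uniform on the unimodal sequences of size \<open>n\<close> with peak \<open>m\<close>. Split the size as
  \<open>Y + W\<close>, where \<open>Y\<close> is contributed by the small parts whose law is sought. The characteristic function
  of \<open>W\<close> decays so fast that \<open>w \<mapsto> P(W = w)\<close> is Lipschitz with constant \<open>O(t\<^sup>3)\<close>; hence conditioning on the
  size changes the probability of an event about \<open>K\<close> small parts by at most \<open>O(t\<^sup>3) E Y = O(K t\<^sup>2)\<close>,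
  in absolute terms. The probability of the size being \<open>n\<close> is at least of order \<open>t\<^sup>3\<^sup>/\<^sup>2\<close>, so the relative
  error is \<open>O(K t\<^sup>1\<^sup>/\<^sup>2)\<close>, which tends to \<open>0\<close> for \<open>K = o(n\<^sup>1\<^sup>/\<^sup>4)\<close>. For the lower bound it suffices to consider
  typical peaks, of order \<open>ln (1 / t) / t\<close>; no limit theorem is needed, since \<open>E cos (\<theta> (W - E W))\<close> is at least
  \<open>1 - \<theta>\<^sup>2 Var W / 2\<close> near \<open>0\<close> and this contribution already dominates the tails of the Fourier integral.
\<close>


section \<open>Fourier inversion and moments for probability mass functions\<close>

text \<open>For large peaks the mean size is close to pi^2 / (3 t^2), and \<open>t\<close> is chosen
  to make this equal to n. The weights of the peaks are never normalised to a probability law: only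
  ratios of weighted counts occur, so everything is compared, up to constant factors, with the
  single quantity \<open>peak_vol t n\<close>. Both the error K t^2 and the lower bound of order
  t^(3/2) come multiplied by it.

  The bound on E Y depends on the number of small parts and not on their sizes, since a slot of part
  size k has mean k / (exp (t k) - 1) <= 1 / t. This is why a single part may be as large as
  o(n^(1/2)), while a whole range of parts has to stay below o(n^(1/4)). Replacing geometric laws by
  exponential ones costs a further t k per slot, so O(t K^2) for the range 1..K, which is negligible
  under the same condition. All bounds are uniform in the thresholds, so these may vary freely with
  n and k.

  The Fourier decay uses all parts up to 1 / t and hence needs a peak of at least 1 / t. Lower peaks
  are discarded: their total weight is smaller than \<open>peak_vol t n\<close> by a factor exp (- 1
  / (9 t)).\<close>

lemma expectation_nat_pmf_sums:
  fixes f :: "nat \<Rightarrow> 'a::{banach, second_countable_topology}"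
  assumes "integrable (measure_pmf p) f"
  shows "(\<lambda>n. pmf p n *\<^sub>R f n) sums measure_pmf.expectation p f"
proof -
  have i: "integrable (count_space UNIV) (\<lambda>n. pmf p n *\<^sub>R f n)"
    using assms unfolding measure_pmf_eq_density by (subst (asm) integrable_density) auto
  have "measure_pmf.expectation p f = (\<integral>n. pmf p n *\<^sub>R f n \<partial>count_space UNIV)"
    unfolding measure_pmf_eq_density by (subst integral_density) auto
  with sums_integral_count_space_nat[OF i] show ?thesis by simp
qed

lemma integrable_nat_pmf_iff:
  fixes f :: "nat \<Rightarrow> real"
  shows "integrable (measure_pmf p) f \<longleftrightarrow> summable (\<lambda>n. pmf p n * \<bar>f n\<bar>)"
  unfolding measure_pmf_eq_density
  by (subst integrable_density) (auto simp: integrable_count_space_nat_iff abs_mult)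

lemma integrable_cos_pmf: "integrable (measure_pmf p) (\<lambda>x. cos (h x) :: real)"
  by (rule measure_pmf.integrable_const_bound[where B = 1]) auto

lemma integral_cos_int:
  "((\<lambda>\<theta>. cos (\<theta> * real_of_int j)) has_integral (if j = 0 then pi else 0)) {0..pi}"
proof (cases "j = 0")
  case True
  then show ?thesis using has_integral_const_real[of "1::real" 0 pi] by simp
next
  case False
  have "((\<lambda>\<theta>. cos (\<theta> * real_of_int j)) has_integral
     (sin (pi * of_int j) / of_int j - sin (0 * of_int j) / of_int j)) {0..pi}"
    using False
    by (intro fundamental_theorem_of_calculus)
       (auto simp flip: has_real_derivative_iff_has_vector_derivative intro!: derivative_eq_intros)
  moreover have "sin (pi * real_of_int j) = 0" using sin_integer_2pi
    by (metis mult.commute sin_zero_iff_int2)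
  ultimately show ?thesis using False by simp
qed

text \<open>Half a period suffices because only cosines occur, and these are orthogonal to constants
  on [0, pi]. The target \<open>w\<close> is an integer so that the formula also covers negative
  values, where both sides vanish.\<close>

lemma pmf_fourier:
  fixes p :: "nat pmf" and w :: int
  shows "((\<lambda>\<theta>. measure_pmf.expectation p (\<lambda>x. cos (\<theta> * (real x - real_of_int w))))
     has_integral (pi * measure_pmf.prob p {x. int x = w})) {0..pi}"
proof -
  let ?g = "\<lambda>\<theta>. measure_pmf.expectation p (\<lambda>x. cos (\<theta> * (real x - real_of_int w)))"
  let ?f = "\<lambda>n \<theta>. pmf p n * cos (\<theta> * (real n - real_of_int w))"
  have sp: "summable (pmf p)"
    using expectation_nat_pmf_sums[of p "\<lambda>_. 1 :: real"] by (auto simp: sums_iff)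
  \<comment> \<open>The summable majorant \<open>pmf p\<close> makes the series uniformly
    convergent, so it may be integrated term by term.\<close>
  have u: "uniform_limit {0..pi} (\<lambda>N \<theta>. \<Sum>n<N. ?f n \<theta>) (\<lambda>\<theta>. \<Sum>n. ?f n \<theta>) sequentially"
    by (rule Weierstrass_m_test[OF _ sp]) (auto simp: abs_mult mult_left_le)
  have g: "(\<lambda>\<theta>. \<Sum>n. ?f n \<theta>) = ?g"
  proof
    fix \<theta>
    show "(\<Sum>n. ?f n \<theta>) = ?g \<theta>"
      using expectation_nat_pmf_sums[of p "\<lambda>x. cos (\<theta> * (real x - real_of_int w))"]
        integrable_cos_pmf[of p "\<lambda>x. \<theta> * (real x - real_of_int w)"] by (simp add: sums_iff)
  qed
  obtain I J where I: "\<And>N. ((\<lambda>\<theta>. \<Sum>n<N. ?f n \<theta>) has_integral I N) {0..pi}"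
    and J: "(?g has_integral J) {0..pi}" and IJ: "I \<longlonglongrightarrow> J"
    by (rule uniform_limit_integral[OF u[unfolded g]]) (auto intro!: continuous_intros)
  have "((\<lambda>\<theta>. \<Sum>n<N. ?f n \<theta>) has_integral (\<Sum>n<N. pmf p n * (if int n - w = 0 then pi else 0))) {0..pi}" for N
    using integral_cos_int[of "int n - w" for n]
    by (intro has_integral_sum has_integral_mult_right) simp_all
  then have IN: "I N = (\<Sum>n<N. pmf p n * (if int n - w = 0 then pi else 0))" for N
    using I has_integral_unique by blast
  have "I \<longlonglongrightarrow> pi * measure_pmf.prob p {x. int x = w}"
  proof (cases "w \<ge> 0")
    case True
    then obtain m where m: "w = int m" using nonneg_int_cases by blast
    have "{x. int x = w} = {m}" using m by auto
    moreover have "I N = pi * pmf p m" if "N > m" for N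
      using that unfolding IN m by (subst sum.remove[of _ m]) (auto intro!: sum.neutral)
    ultimately show ?thesis
      by (intro tendsto_eventually) (auto simp: eventually_at_top_dense measure_pmf_single intro!: exI[of _ m])
  next
    case False
    then have "{x. int x = w} = {}" by auto
    moreover have "I = (\<lambda>_. 0)" using False unfolding IN by (auto intro!: sum.neutral)
    ultimately show ?thesis by simp
  qed
  with IJ have "J = pi * measure_pmf.prob p {x. int x = w}" using LIMSEQ_unique by blast
  with J show ?thesis by simp
qed

lemma expectation_Pi_pmf_component:
  fixes g :: "'b \<Rightarrow> 'c::{banach, second_countable_topology}"
  assumes "finite I" "i \<in> I"
  shows "measure_pmf.expectation (Pi_pmf I d p) (\<lambda>x. g (x i)) = measure_pmf.expectation (p i) g"
    and "integrable (measure_pmf (Pi_pmf I d p)) (\<lambda>x. g (x i)) \<longleftrightarrow> integrable (measure_pmf (p i)) g"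
proof -
  have p: "p i = map_pmf (\<lambda>f. f i) (Pi_pmf I d p)"
    using Pi_pmf_component[OF assms(1), of i d p] assms(2) by simp
  show "measure_pmf.expectation (Pi_pmf I d p) (\<lambda>x. g (x i)) = measure_pmf.expectation (p i) g"
    by (simp only: p integral_map_pmf)
  show "integrable (measure_pmf (Pi_pmf I d p)) (\<lambda>x. g (x i)) \<longleftrightarrow> integrable (measure_pmf (p i)) g"
    by (simp only: p integrable_map_pmf_eq)
qed

text \<open>The product may run over a proper subset of the index set, as the cross terms of a
  second moment require.\<close>

lemma expectation_prod_Pi_pmf':
  fixes f :: "'a \<Rightarrow> 'b \<Rightarrow> 'c :: {real_normed_field, second_countable_topology, banach}"
  assumes "finite I" "J \<subseteq> I" "\<And>i. i \<in> J \<Longrightarrow> integrable (measure_pmf (p i)) (f i)"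
  shows "measure_pmf.expectation (Pi_pmf I d p) (\<lambda>x. \<Prod>i\<in>J. f i (x i)) =
    (\<Prod>i\<in>J. measure_pmf.expectation (p i) (f i))"
proof -
  have fJ: "finite J" using assms finite_subset by blast
  have "prob_space.indep_vars (measure_pmf (Pi_pmf I d p)) (\<lambda>_. borel) (\<lambda>i x. f i (x i)) I"
    using prob_space.indep_vars_compose[OF measure_pmf.prob_space_axioms indep_vars_Pi_pmf[OF assms(1)],
        of f "\<lambda>_. borel" d p]
    by (simp add: comp_def)
  then have iv: "prob_space.indep_vars (measure_pmf (Pi_pmf I d p)) (\<lambda>_. borel) (\<lambda>i x. f i (x i)) J"
    by (rule prob_space.indep_vars_subset[OF measure_pmf.prob_space_axioms]) (use assms in auto)
  have ii: "integrable (measure_pmf (Pi_pmf I d p)) (\<lambda>x. f i (x i))" if "i \<in> J" for i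
    using assms that expectation_Pi_pmf_component(2)[of I i d p "f i"] by blast
  have "measure_pmf.expectation (Pi_pmf I d p) (\<lambda>x. \<Prod>i\<in>J. f i (x i)) =
    (\<Prod>i\<in>J. measure_pmf.expectation (Pi_pmf I d p) (\<lambda>x. f i (x i)))"
    by (rule prob_space.indep_vars_lebesgue_integral[OF measure_pmf.prob_space_axioms fJ iv ii])
  also have "\<dots> = (\<Prod>i\<in>J. measure_pmf.expectation (p i) (f i))"
    using assms by (intro prod.cong refl expectation_Pi_pmf_component) auto
  finally show ?thesis .
qed

text \<open>Expanding the square, independence and the vanishing means kill all cross terms.\<close>

lemma second_moment_sum_Pi_pmf:
  fixes f :: "'a \<Rightarrow> 'b \<Rightarrow> real"
  assumes fin: "finite I"
    and int: "\<And>i. i \<in> I \<Longrightarrow> integrable (measure_pmf (p i)) (f i)"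
    and int2: "\<And>i. i \<in> I \<Longrightarrow> integrable (measure_pmf (p i)) (\<lambda>x. (f i x)\<^sup>2)"
    and mean: "\<And>i. i \<in> I \<Longrightarrow> measure_pmf.expectation (p i) (f i) = 0"
  shows "integrable (measure_pmf (Pi_pmf I d p)) (\<lambda>x. (\<Sum>i\<in>I. f i (x i))\<^sup>2)" (is ?A)
    and "measure_pmf.expectation (Pi_pmf I d p) (\<lambda>x. (\<Sum>i\<in>I. f i (x i))\<^sup>2) =
      (\<Sum>i\<in>I. measure_pmf.expectation (p i) (\<lambda>x. (f i x)\<^sup>2))" (is ?B)
proof -
  let ?P = "Pi_pmf I d p"
  have sq: "(\<Sum>i\<in>I. f i (x i))\<^sup>2 = (\<Sum>i\<in>I. \<Sum>j\<in>I. f i (x i) * f j (x j))" for x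
    by (simp add: power2_eq_square sum_product)
  have cross: "integrable ?P (\<lambda>x. f i (x i) * f j (x j)) \<and>
     measure_pmf.expectation ?P (\<lambda>x. f i (x i) * f j (x j)) =
     (if i = j then measure_pmf.expectation (p i) (\<lambda>x. (f i x)\<^sup>2) else 0)" if ij: "i \<in> I" "j \<in> I" for i j
  proof (cases "i = j")
    case True
    then show ?thesis
      using expectation_Pi_pmf_component[OF fin ij(1), of d p "\<lambda>x. (f i x)\<^sup>2"] int2[OF ij(1)]
      by (simp add: power2_eq_square)
  next
    case False
    \<comment> \<open>Padding with factors 1 turns the product of two coordinates into a product
      over the full index set, for which integrability is known.\<close>
    have "integrable ?P (\<lambda>x. \<Prod>k\<in>I. (if k = i \<or> k = j then f k (x k) else 1))"
    proof -
      have "integrable (p k) (\<lambda>y. if k = i \<or> k = j then f k y else 1)" if "k \<in> I" for k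
        using int[OF that] by (cases "k = i \<or> k = j") simp_all
      then show ?thesis
        by (rule integrable_prod_Pi_pmf[OF fin, of p "\<lambda>k y. if k = i \<or> k = j then f k y else 1"])
    qed
    also have "(\<lambda>x. \<Prod>k\<in>I. (if k = i \<or> k = j then f k (x k) else 1)) = (\<lambda>x. \<Prod>k\<in>{i,j}. f k (x k))"
    proof
      fix x
      have "(\<Prod>k\<in>I. (if k = i \<or> k = j then f k (x k) else 1)) =
         (\<Prod>k\<in>{i,j}. (if k = i \<or> k = j then f k (x k) else 1))"
        using ij fin by (intro prod.mono_neutral_right) auto
      then show "(\<Prod>k\<in>I. (if k = i \<or> k = j then f k (x k) else 1)) = (\<Prod>k\<in>{i,j}. f k (x k))"
        by (simp add: False)
    qed
    finally have "integrable ?P (\<lambda>x. f i (x i) * f j (x j))" using False by simp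
    moreover have "measure_pmf.expectation ?P (\<lambda>x. \<Prod>k\<in>{i,j}. f k (x k)) =
        (\<Prod>k\<in>{i,j}. measure_pmf.expectation (p k) (f k))"
      by (rule expectation_prod_Pi_pmf'[OF fin]) (use ij int in auto)
    ultimately show ?thesis using False mean ij by simp
  qed
  show ?A unfolding sq using cross by (intro Bochner_Integration.integrable_sum) auto
  have "measure_pmf.expectation ?P (\<lambda>x. (\<Sum>i\<in>I. f i (x i))\<^sup>2) =
    (\<Sum>i\<in>I. \<Sum>j\<in>I. measure_pmf.expectation ?P (\<lambda>x. f i (x i) * f j (x j)))"
    unfolding sq using cross by (simp add: Bochner_Integration.integral_sum Bochner_Integration.integrable_sum)
  also have "\<dots> = (\<Sum>i\<in>I. \<Sum>j\<in>I. (if i = j then measure_pmf.expectation (p i) (\<lambda>x. (f i x)\<^sup>2) else 0))"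
    using cross by (intro sum.cong) auto
  also have "\<dots> = (\<Sum>i\<in>I. measure_pmf.expectation (p i) (\<lambda>x. (f i x)\<^sup>2))"
    using fin by (intro sum.cong) auto
  finally show ?B .
qed

section \<open>Independent geometric multiplicities\<close>

definition wsum :: "(nat \<times> 'j) set \<Rightarrow> (nat \<times> 'j \<Rightarrow> nat) \<Rightarrow> nat" where
  "wsum I x = (\<Sum>i\<in>I. fst i * x i)"

text \<open>A slot (k, j) has ratio q = exp (- t k), so x copies of the part k have probability
  proportional to exp (- t k x). Slots outside \<open>I\<close> are set to 0.\<close>

definition boltz :: "real \<Rightarrow> (nat \<times> 'j) set \<Rightarrow> (nat \<times> 'j \<Rightarrow> nat) pmf" where
  "boltz t I = Pi_pmf I 0 (\<lambda>i. geometric_pmf (1 - exp (- (t * real (fst i)))))"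

text \<open>Characteristic function at \<open>\<theta>\<close> of k times a geometric variable of
  ratio exp (- t k), the contribution of one slot to the size.\<close>

definition boltz_factor :: "real \<Rightarrow> real \<Rightarrow> nat \<Rightarrow> complex" where
  "boltz_factor t \<theta> k =
     of_real (1 - exp (- (t * real k))) / (1 - of_real (exp (- (t * real k))) * cis (\<theta> * k))"

definition boltz_char :: "real \<Rightarrow> (nat \<times> 'j) set \<Rightarrow> real \<Rightarrow> complex" where
  "boltz_char t I \<theta> = (\<Prod>i\<in>I. boltz_factor t \<theta> (fst i))"

definition boltz_mean :: "real \<Rightarrow> (nat \<times> 'j) set \<Rightarrow> real" where
  "boltz_mean t I = (\<Sum>i\<in>I. real (fst i) * (exp (- (t * real (fst i))) / (1 - exp (- (t * real (fst i))))))"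

definition boltz_var :: "real \<Rightarrow> (nat \<times> 'j) set \<Rightarrow> real" where
  "boltz_var t I = (\<Sum>i\<in>I. (real (fst i))\<^sup>2 * (exp (- (t * real (fst i))) / (1 - exp (- (t * real (fst i))))\<^sup>2))"

text \<open>The point mass depends on \<open>x\<close> only through \<open>wsum I x\<close>; this is
  the source of uniformity after conditioning on the size.\<close>

lemma pmf_boltz:
  assumes "finite I" "0 < t" "\<And>i. i \<in> I \<Longrightarrow> 0 < fst i" "\<And>i. i \<notin> I \<Longrightarrow> x i = 0"
  shows "pmf (boltz t I) x = exp (- (t * wsum I x)) * (\<Prod>i\<in>I. 1 - exp (- (t * real (fst i))))"
proof -
  have "pmf (boltz t I) x = (\<Prod>i\<in>I. exp (- (t * real (fst i))) ^ x i * (1 - exp (- (t * real (fst i)))))"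
    unfolding boltz_def using assms
    by (subst pmf_Pi') (auto intro!: prod.cong)
  also have "\<dots> = (\<Prod>i\<in>I. exp (- (t * (fst i * x i)))) * (\<Prod>i\<in>I. 1 - exp (- (t * real (fst i))))"
    by (simp only: prod.distrib exp_of_nat2_mult[symmetric]) (simp add: mult_ac)
  also have "(\<Prod>i\<in>I. exp (- (t * (fst i * x i)))) = exp (- (t * wsum I x))"
    using assms(1) by (simp add: exp_sum[symmetric] wsum_def sum_negf sum_distrib_left)
  finally show ?thesis .
qed

lemma wsum_Un:
  "finite I \<Longrightarrow> finite J \<Longrightarrow> I \<inter> J = {} \<Longrightarrow> wsum (I \<union> J) x = wsum I x + wsum J x"
  unfolding wsum_def by (rule sum.union_disjoint)

lemma expectation_cis_geometric:
  assumes "0 < p" "p \<le> 1"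
  shows "measure_pmf.expectation (geometric_pmf p) (\<lambda>x. cis (a * real x)) = of_real p / (1 - of_real (1 - p) * cis a)"
proof -
  have "integrable (measure_pmf (geometric_pmf p)) (\<lambda>x. cis (a * real x))"
    by (rule measure_pmf.integrable_const_bound[where B = 1]) auto
  from expectation_nat_pmf_sums[OF this]
  have "(\<lambda>n. ((1 - p) ^ n * p) *\<^sub>R cis (a * real n)) sums measure_pmf.expectation (geometric_pmf p) (\<lambda>x. cis (a * real x))"
    using assms by simp
  moreover have "(\<lambda>n. of_real p * (of_real (1 - p) * cis a) ^ n) sums (of_real p * (1 / (1 - of_real (1 - p) * cis a)))"
    using assms by (intro sums_mult geometric_sums) (simp add: norm_mult del: of_real_diff of_real_1)
  moreover have eq: "(\<lambda>n. ((1 - p) ^ n * p) *\<^sub>R cis (a * real n)) = (\<lambda>n. of_real p * (of_real (1 - p) * cis a) ^ n)"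
  proof
    fix n
    have mult3: "x * y * z = y * (x * z)" for x y z :: complex by simp
    have c: "cis a ^ n = cis (a * real n)" by (simp only: Complex.DeMoivre mult.commute[of a])
    show "((1 - p) ^ n * p) *\<^sub>R cis (a * real n) = of_real p * (of_real (1 - p) * cis a) ^ n"
      
      unfolding power_mult_distrib c scaleR_conv_of_real of_real_mult of_real_power
      by (rule mult3)
  qed
  ultimately show ?thesis unfolding eq by (metis sums_unique2 mult.right_neutral times_divide_eq_right)
qed

lemma expectation_cis_boltz:
  assumes "finite I" "0 < t" "\<And>i. i \<in> I \<Longrightarrow> 0 < fst i"
  shows "measure_pmf.expectation (boltz t I) (\<lambda>x. cis (\<theta> * real (wsum I x))) = boltz_char t I \<theta>"
proof -
  have "cis (\<theta> * real (wsum I x)) = (\<Prod>i\<in>I. cis (\<theta> * fst i * x i))" for x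
    using assms(1) by (simp add: wsum_def cis_conv_exp exp_sum[symmetric] sum_distrib_left mult_ac)
  then have "measure_pmf.expectation (boltz t I) (\<lambda>x. cis (\<theta> * real (wsum I x))) =
      measure_pmf.expectation (boltz t I) (\<lambda>x. \<Prod>i\<in>I. cis (\<theta> * fst i * x i))"
    by simp
  also have "\<dots> = (\<Prod>i\<in>I. measure_pmf.expectation (geometric_pmf (1 - exp (- (t * real (fst i))))) (\<lambda>y. cis (\<theta> * fst i * real y)))"
    unfolding boltz_def
    by (rule expectation_prod_Pi_pmf'[OF assms(1) order.refl]) (auto intro!: measure_pmf.integrable_const_bound[where B = 1])
  also have "\<dots> = boltz_char t I \<theta>"
    unfolding boltz_char_def boltz_factor_def
    by (intro prod.cong refl, subst expectation_cis_geometric) (use assms in auto)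
  finally show ?thesis .
qed

lemma expectation_cos_boltz:
  assumes "finite I" "0 < t" "\<And>i. i \<in> I \<Longrightarrow> 0 < fst i"
  shows "measure_pmf.expectation (boltz t I) (\<lambda>x. cos (\<theta> * (real (wsum I x) - \<mu>))) =
    Re (boltz_char t I \<theta> * cis (- (\<theta> * \<mu>)))"
proof -
  have i: "integrable (measure_pmf (boltz t I)) (\<lambda>x. cis (\<theta> * real (wsum I x)))"
    by (rule measure_pmf.integrable_const_bound[where B = 1]) auto
  have "cos (\<theta> * (real (wsum I x) - \<mu>)) = Re (cis (\<theta> * real (wsum I x)) * cis (- (\<theta> * \<mu>)))" for x
    by (simp add: cis_mult algebra_simps)
  then have "measure_pmf.expectation (boltz t I) (\<lambda>x. cos (\<theta> * (real (wsum I x) - \<mu>))) =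
     Re (measure_pmf.expectation (boltz t I) (\<lambda>x. cis (\<theta> * real (wsum I x)) * cis (- (\<theta> * \<mu>))))"
    using i by (simp add: integral_Re del: times_complex.sel)
  then show ?thesis using i expectation_cis_boltz[OF assms] by simp
qed

text \<open>With q = exp (- t k), |1 - q cis a|^2 = (1 - q)^2 + 4 q sin^2 (a / 2). All decay
  estimates start from this form, in which q / (1 - q)^2 is the variance of the geometric
  variable.\<close>

lemma norm_boltz_factor:
  assumes "0 < t" "0 < k"
  shows "(norm (boltz_factor t \<theta> k))\<^sup>2 =
    1 / (1 + 4 * exp (- (t * real k)) * (sin (\<theta> * k / 2))\<^sup>2 / (1 - exp (- (t * real k)))\<^sup>2)"
proof -
  define q where "q = exp (- (t * real k))"
  have q: "0 < q" "q < 1" using assms by (auto simp: q_def)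
  have "(norm (1 - of_real q * cis (\<theta> * k)))\<^sup>2 = (1 - q * cos (\<theta> * k))\<^sup>2 + (q * sin (\<theta> * k))\<^sup>2"
    by (simp add: cmod_def)
  also have "\<dots> = 1 - 2 * q * cos (\<theta> * k) + q\<^sup>2 * ((cos (\<theta> * k))\<^sup>2 + (sin (\<theta> * k))\<^sup>2)"
    by (simp only: power2_diff power_mult_distrib distrib_left) simp
  also have "(cos (\<theta> * k))\<^sup>2 + (sin (\<theta> * k))\<^sup>2 = 1" by (rule sin_cos_squared_add2)
  also have "cos (\<theta> * k) = 1 - 2 * (sin (\<theta> * k / 2))\<^sup>2"
    using cos_double_sin[of "\<theta> * k / 2"] by simp
  finally have n: "(norm (1 - of_real q * cis (\<theta> * k)))\<^sup>2 = (1 - q)\<^sup>2 + 4 * q * (sin (\<theta> * k / 2))\<^sup>2"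
    by (simp add: power2_eq_square algebra_simps)
  have "(norm (boltz_factor t \<theta> k))\<^sup>2 = (1 - q)\<^sup>2 / ((1 - q)\<^sup>2 + 4 * q * (sin (\<theta> * k / 2))\<^sup>2)"
    unfolding boltz_factor_def q_def[symmetric] norm_divide power_divide n
    using q by (simp add: norm_of_real del: of_real_diff of_real_1)
  also have "\<dots> = 1 / (1 + 4 * q * (sin (\<theta> * k / 2))\<^sup>2 / (1 - q)\<^sup>2)"
  proof -
    have *: "y / (y + x) = 1 / (1 + x / y)" if "0 < y" "0 \<le> x" for x y :: real
    proof -
      have "1 + x / y = (y + x) / y" using that by (simp add: add_divide_distrib)
      then show ?thesis by simp
    qed
    then show ?thesis using q by (intro *) auto
  qed
  finally show ?thesis unfolding q_def .
qed

text \<open>Once summability is known, shifting the index by one and expanding (n + 1)^2 gives a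
  linear equation for the sum.\<close>

lemma geometric_sums_times_n2:
  fixes c :: real
  assumes "0 \<le> c" "c < 1"
  shows "(\<lambda>n. c ^ n * (real n)\<^sup>2) sums (c * (1 + c) / (1 - c) ^ 3)"
proof -
  have G: "(\<lambda>n. c ^ n) sums (1 / (1 - c))" using assms by (intro geometric_sums) auto
  have T: "(\<lambda>n. c ^ n * real n) sums (c / (1 - c)\<^sup>2)" using geometric_sums_times_n[of c] assms by simp
  have "summable (\<lambda>n. c ^ n * (real n)\<^sup>2)"
  proof (cases "c = 0")
    case True
    then show ?thesis by (intro summable_finite[of "{0}"]) auto
  next
    case False
    have lim: "(\<lambda>n. c * (real (Suc n) / real n)\<^sup>2) \<longlonglongrightarrow> c * 1\<^sup>2"
      by (intro tendsto_intros LIMSEQ_Suc_n_over_n)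
    then have ev: "\<forall>\<^sub>F n in sequentially. c * (real (Suc n) / real n)\<^sup>2 < (1 + c) / 2"
      using assms by (intro order_tendstoD(2)[of _ "c * 1\<^sup>2"]) auto
    then obtain N where N: "\<And>n. n \<ge> N \<Longrightarrow> c * (real (Suc n) / real n)\<^sup>2 < (1 + c) / 2"
      unfolding eventually_sequentially by auto
    show ?thesis
    proof (rule summable_ratio_test[where c = "(1 + c) / 2" and N = "max N 1"])
      fix n assume n: "max N 1 \<le> n"
      have "c ^ Suc n * (real (Suc n))\<^sup>2 = (c * (real (Suc n) / real n)\<^sup>2) * (c ^ n * (real n)\<^sup>2)"
        using n by (simp add: power_divide)
      also have "\<dots> \<le> ((1 + c) / 2) * (c ^ n * (real n)\<^sup>2)"
        using N[of n] n assms by (intro mult_right_mono) auto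
      finally show "norm (c ^ Suc n * (real (Suc n))\<^sup>2) \<le> (1 + c) / 2 * norm (c ^ n * (real n)\<^sup>2)"
        using assms by (simp add: abs_mult)
    qed (use assms in auto)
  qed
  then obtain s where S: "(\<lambda>n. c ^ n * (real n)\<^sup>2) sums s" by (auto simp: summable_def)
  have "(\<lambda>n. c ^ Suc n * (real (Suc n))\<^sup>2) sums s"
    using S by (subst sums_Suc_iff) simp
  moreover have "(\<lambda>n. c * (c ^ n * (real n)\<^sup>2 + 2 * (c ^ n * real n) + c ^ n)) sums (c * (s + 2 * (c / (1 - c)\<^sup>2) + 1 / (1 - c)))"
    by (intro sums_mult sums_add S T G)
  moreover have eq: "(\<lambda>n. c * (c ^ n * (real n)\<^sup>2 + 2 * (c ^ n * real n) + c ^ n)) = (\<lambda>n. c ^ Suc n * (real (Suc n))\<^sup>2)"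
    by (auto simp: algebra_simps power2_eq_square)
  ultimately have "s = c * (s + 2 * (c / (1 - c)\<^sup>2) + 1 / (1 - c))"
    unfolding eq by (metis sums_unique2)
  moreover have "s * (1 - c) = c * (2 * A + B)" if "s = c * (s + 2 * A + B)" for A B
    using that by (simp add: algebra_simps)
  ultimately have "s * (1 - c) = c * (2 * (c / (1 - c)\<^sup>2) + 1 / (1 - c))" by blast
  also have "\<dots> = c * (1 + c) / (1 - c)\<^sup>2"
    using assms by (simp add: divide_simps) (simp add: power2_eq_square algebra_simps)
  finally have "s = c * (1 + c) / (1 - c)\<^sup>2 / (1 - c)" using assms by (simp add: field_simps)
  then have "s = c * (1 + c) / (1 - c) ^ 3" by (simp add: power3_eq_cube power2_eq_square mult.assoc)
  with S show ?thesis by simp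
qed

lemma geometric_pmf_moments:
  assumes "0 < p" "p \<le> 1"
  shows "integrable (measure_pmf (geometric_pmf p)) (\<lambda>x. (real x)\<^sup>2)"
    and "measure_pmf.expectation (geometric_pmf p) (\<lambda>x. (real x - (1 - p) / p)\<^sup>2) = (1 - p) / p\<^sup>2"
proof -
  have S: "(\<lambda>n. p * ((1 - p) ^ n * (real n)\<^sup>2)) sums (p * ((1 - p) * (1 + (1 - p)) / (1 - (1 - p)) ^ 3))"
    using assms by (intro sums_mult geometric_sums_times_n2) auto
  show i2: "integrable (measure_pmf (geometric_pmf p)) (\<lambda>x. (real x)\<^sup>2)"
    using S assms unfolding integrable_nat_pmf_iff by (auto simp: sums_iff mult_ac)
  have e2: "measure_pmf.expectation (geometric_pmf p) (\<lambda>x. (real x)\<^sup>2) = p * ((1 - p) * (2 - p) / p ^ 3)"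
    using expectation_nat_pmf_sums[OF i2] S assms by (simp add: sums_iff mult_ac)
  have i1: "integrable (measure_pmf (geometric_pmf p)) real"
    using assms by (intro integrable_real_geometric_pmf) auto
  have "measure_pmf.expectation (geometric_pmf p) (\<lambda>x. (real x - (1 - p) / p)\<^sup>2) =
    measure_pmf.variance (geometric_pmf p) real"
    using assms by (simp add: expectation_geometric_pmf)
  also have "\<dots> = p * ((1 - p) * (2 - p) / p ^ 3) - ((1 - p) / p)\<^sup>2"
    using assms by (subst measure_pmf.variance_eq[OF i1 i2]) (simp add: expectation_geometric_pmf e2)
  also have "\<dots> = (1 - p) / p\<^sup>2"
    using assms by (simp add: field_simps power2_eq_square power3_eq_cube)
  finally show "measure_pmf.expectation (geometric_pmf p) (\<lambda>x. (real x - (1 - p) / p)\<^sup>2) = (1 - p) / p\<^sup>2" .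
qed

lemma boltz_moments:
  assumes "finite I" "0 < t" "\<And>i. i \<in> I \<Longrightarrow> 0 < fst i"
  shows "integrable (measure_pmf (boltz t I)) (\<lambda>x. real (wsum I x))"
    and "measure_pmf.expectation (boltz t I) (\<lambda>x. real (wsum I x)) = boltz_mean t I"
    and "integrable (measure_pmf (boltz t I)) (\<lambda>x. (real (wsum I x) - boltz_mean t I)\<^sup>2)"
    and "measure_pmf.expectation (boltz t I) (\<lambda>x. (real (wsum I x) - boltz_mean t I)\<^sup>2) = boltz_var t I"
proof -
  define p where "p i = 1 - exp (- (t * real (fst i)))" for i :: "nat \<times> 'a"
  have p: "0 < p i" "p i \<le> 1" if "i \<in> I" for i using assms that by (auto simp: p_def)
  have b: "boltz t I = Pi_pmf I 0 (\<lambda>i. geometric_pmf (p i))" unfolding boltz_def p_def by simp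
  have i1: "integrable (measure_pmf (geometric_pmf (p i))) real" if "i \<in> I" for i
    using p[OF that] by (intro integrable_real_geometric_pmf) auto
  have e1: "measure_pmf.expectation (geometric_pmf (p i)) real = (1 - p i) / p i" if "i \<in> I" for i
    using p[OF that] by (intro expectation_geometric_pmf) auto
  have w: "real (wsum I x) = (\<Sum>i\<in>I. real (fst i) * real (x i))" for x by (simp add: wsum_def)
  have c: "integrable (measure_pmf (boltz t I)) (\<lambda>x. real (x i))"
     "measure_pmf.expectation (boltz t I) (\<lambda>x. real (x i)) = (1 - p i) / p i" if "i \<in> I" for i
    using expectation_Pi_pmf_component[OF assms(1) that, of 0 "\<lambda>i. geometric_pmf (p i)" real] i1[OF that] e1[OF that]
    unfolding b by auto
  show "integrable (measure_pmf (boltz t I)) (\<lambda>x. real (wsum I x))"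
    unfolding w using c by (intro Bochner_Integration.integrable_sum) auto
  show "measure_pmf.expectation (boltz t I) (\<lambda>x. real (wsum I x)) = boltz_mean t I"
    unfolding w using c by (simp add: Bochner_Integration.integral_sum boltz_mean_def) (simp add: p_def)
  define f where "f i y = real (fst i) * (real y - (1 - p i) / p i)" for i :: "nat \<times> 'a" and y
  have f: "real (wsum I x) - boltz_mean t I = (\<Sum>i\<in>I. f i (x i))" for x
    unfolding w f_def boltz_mean_def right_diff_distrib sum_subtractf by (simp add: p_def)
  have fi: "integrable (measure_pmf (geometric_pmf (p i))) (f i)" if "i \<in> I" for i
    unfolding f_def using i1[OF that] by auto
  have fi2: "integrable (measure_pmf (geometric_pmf (p i))) (\<lambda>y. (f i y)\<^sup>2)" if "i \<in> I" for i
    unfolding f_def power_mult_distrib power2_diff using i1[OF that] geometric_pmf_moments(1)[OF p[OF that]] by auto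
  have fe: "measure_pmf.expectation (geometric_pmf (p i)) (f i) = 0" if "i \<in> I" for i
    unfolding f_def using i1[OF that] e1[OF that] by simp
  have fe2: "measure_pmf.expectation (geometric_pmf (p i)) (\<lambda>y. (f i y)\<^sup>2) = (real (fst i))\<^sup>2 * ((1 - p i) / (p i)\<^sup>2)" if "i \<in> I" for i
    unfolding f_def power_mult_distrib using geometric_pmf_moments(2)[OF p[OF that]] by simp
  note sm = second_moment_sum_Pi_pmf[OF assms(1), of "\<lambda>i. geometric_pmf (p i)" f, OF fi fi2 fe]
  show "integrable (measure_pmf (boltz t I)) (\<lambda>x. (real (wsum I x) - boltz_mean t I)\<^sup>2)"
    unfolding f b by (rule sm)
  show "measure_pmf.expectation (boltz t I) (\<lambda>x. (real (wsum I x) - boltz_mean t I)\<^sup>2) = boltz_var t I"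
    unfolding f b
  proof (subst sm(2), assumption+)
    show "(\<Sum>i\<in>I. measure_pmf.expectation (geometric_pmf (p i)) (\<lambda>y. (f i y)\<^sup>2)) = boltz_var t I"
      unfolding boltz_var_def by (intro sum.cong refl, subst fe2) (simp_all add: p_def)
  qed
qed

section \<open>Decay of the characteristic function\<close>

text \<open>This is x / 2 <= sinh (x / 2), multiplied by 2 exp (- x / 2).\<close>

lemma one_minus_exp_ge: "x * exp (- x / 2) \<le> 1 - exp (- x)" if "0 \<le> x" for x :: real
proof -
  have "x / 2 \<le> (exp (x / 2) - inverse (exp (x / 2))) / 2"
    using that by (intro real_le_x_sinh) auto
  then have "x \<le> exp (x / 2) - exp (- x / 2)" by (simp add: exp_minus)
  then have "x * exp (- x / 2) \<le> (exp (x / 2) - exp (- x / 2)) * exp (- x / 2)"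
    by (intro mult_right_mono) auto
  also have "\<dots> = 1 - exp (- x)" by (simp add: left_diff_distrib mult_exp_exp)
  finally show ?thesis .
qed

lemma exp_over_square_le1:
  fixes x :: real assumes "0 < x"
  shows "exp (- x) / (1 - exp (- x))\<^sup>2 \<le> 1 / x\<^sup>2"
proof -
  have "(x * exp (- x / 2))\<^sup>2 \<le> (1 - exp (- x))\<^sup>2"
    using one_minus_exp_ge[of x] assms by (intro power_mono) auto
  moreover have "(x * exp (- x / 2))\<^sup>2 = x\<^sup>2 * exp (- x)"
    by (simp add: power_mult_distrib exp_double[symmetric])
  ultimately show ?thesis using assms by (simp add: field_simps)
qed

text \<open>Half of the exponential decay is kept, so that sums over all parts converge. The
  denominator is bounded by applying \<open>one_minus_exp_ge\<close> at x / 2.\<close>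

lemma exp_over_square_le2:
  fixes x :: real assumes "0 < x"
  shows "exp (- x) / (1 - exp (- x))\<^sup>2 \<le> 4 * exp (- x / 2) / x\<^sup>2"
proof -
  have "(x / 2) * exp (- x / 4) \<le> 1 - exp (- x / 2)"
    using one_minus_exp_ge[of "x / 2"] assms by simp
  also have "\<dots> \<le> 1 - exp (- x)" using assms by simp
  finally have "((x / 2) * exp (- x / 4))\<^sup>2 \<le> (1 - exp (- x))\<^sup>2"
    using assms by (intro power_mono) auto
  moreover have "((x / 2) * exp (- x / 4))\<^sup>2 = x\<^sup>2 / 4 * exp (- x / 2)"
    by (simp add: power_mult_distrib exp_double[symmetric] power_divide)
  ultimately have "x\<^sup>2 / 4 * exp (- x / 2) \<le> (1 - exp (- x))\<^sup>2" by simp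
  then have "x\<^sup>2 * (exp (- x / 2) * exp (- x / 2)) \<le> 4 * exp (- x / 2) * (1 - exp (- x))\<^sup>2"
    by (simp add: mult.commute mult.left_commute mult_left_mono)
  then have "exp (- x) * x\<^sup>2 \<le> 4 * exp (- x / 2) * (1 - exp (- x))\<^sup>2"
    by (simp add: mult_exp_exp mult.commute)
  then show ?thesis using assms by (simp add: divide_simps)
qed

lemma exp_over_square_ge:
  fixes x :: real assumes "0 < x" "x \<le> 1"
  shows "1 / (3 * x\<^sup>2) \<le> exp (- x) / (1 - exp (- x))\<^sup>2"
proof -
  have "1 - exp (- x) \<le> x" using exp_ge_add_one_self[of "- x"] by simp
  then have "(1 - exp (- x))\<^sup>2 \<le> x\<^sup>2" using assms by (intro power_mono) auto
  moreover have "1 / 3 \<le> exp (- x)"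
  proof -
    have "exp x \<le> 3" using exp_le assms by (meson exp_le_cancel_iff order_trans)
    then show ?thesis by (simp add: exp_minus field_simps)
  qed
  ultimately have "(1 / 3) / x\<^sup>2 \<le> exp (- x) / (1 - exp (- x))\<^sup>2"
    using assms by (intro frac_le) auto
  then show ?thesis by simp
qed

lemma sum_exp_neg_le:
  fixes a :: real assumes "0 < a"
  shows "(\<Sum>k = 1..m. exp (- (a * real k))) \<le> 1 / a"
proof -
  have s: "(\<lambda>n. exp (- a) ^ Suc n) sums (exp (- a) * (1 / (1 - exp (- a))))"
    unfolding power_Suc using assms by (intro sums_mult geometric_sums) auto
  have "(\<Sum>k = 1..m. exp (- (a * real k))) = (\<Sum>n<m. exp (- a) ^ Suc n)"
    by (rule sum.reindex_bij_witness[of _ Suc "\<lambda>k. k - 1"])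
       (auto simp: exp_of_nat_mult[symmetric] algebra_simps exp_add[symmetric])
  also have "\<dots> \<le> exp (- a) * (1 / (1 - exp (- a)))"
    using s sum_le_suminf[of "\<lambda>n. exp (- a) ^ Suc n" "{..<m}"] by (auto simp: sums_iff)
  also have "\<dots> \<le> 1 / a"
  proof -
    have "a \<le> exp a - 1" using exp_ge_add_one_self[of a] by linarith
    then show ?thesis using assms by (simp add: divide_simps exp_minus)
  qed
  finally show ?thesis .
qed

lemma sin_lower: "x - x ^ 3 / 6 \<le> sin x" if "0 \<le> x" for x :: real
proof -
  have "\<bar>sin x - (\<Sum>m<3. sin_coeff m * x ^ m)\<bar> \<le> inverse (fact 3) * \<bar>x\<bar> ^ 3"
    by (rule Maclaurin_sin_bound)
  moreover have "(\<Sum>m<3. sin_coeff m * x ^ m) = x"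
    by (simp add: numeral_eq_Suc sin_coeff_def)
  moreover have "(fact 3 :: real) = 6" by (simp add: numeral_eq_Suc)
  ultimately have "\<bar>sin x - x\<bar> \<le> x ^ 3 / 6" using that by simp
  then show ?thesis by linarith
qed

lemma sin_sq_lower: "x\<^sup>2 - x ^ 4 / 3 \<le> (sin x)\<^sup>2" if "0 \<le> x" for x :: real
\<comment> \<open>Beyond the threshold 3 the left-hand side is negative; below it the cubic lower
  bound for the sine is nonnegative and may be squared.\<close>
proof (cases "x\<^sup>2 \<le> 3")
  case True
  have e: "x - x ^ 3 / 6 = x * (1 - x\<^sup>2 / 6)" by (simp add: power3_eq_cube power2_eq_square algebra_simps)
  have "(x - x ^ 3 / 6)\<^sup>2 \<le> (sin x)\<^sup>2"
    using sin_lower[OF that] True that by (intro power_mono) (auto simp: e)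
  moreover have "(x - x ^ 3 / 6)\<^sup>2 = x\<^sup>2 - x ^ 4 / 3 + (x ^ 3 / 6)\<^sup>2"
    by (simp add: power2_diff power_divide eval_nat_numeral algebra_simps)
  ultimately show ?thesis by (smt (verit) zero_le_power2)
next
  case False
  have "x ^ 4 = x\<^sup>2 * x\<^sup>2" by (simp add: eval_nat_numeral)
  then have "x\<^sup>2 - x ^ 4 / 3 = x\<^sup>2 * (1 - x\<^sup>2 / 3)" by (simp add: algebra_simps)
  also have "\<dots> \<le> 0" using False by (intro mult_nonneg_nonpos) auto
  finally show ?thesis by (smt (verit) zero_le_power2)
qed

section \<open>Modulus of the characteristic function\<close>

lemma norm_boltz_factor_le:
  assumes "0 < t" "0 < k"
  shows "(norm (boltz_factor t \<theta> k))\<^sup>2 \<le> 1" "norm (boltz_factor t \<theta> k) \<le> 1"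
proof -
  show *: "(norm (boltz_factor t \<theta> k))\<^sup>2 \<le> 1"
    unfolding norm_boltz_factor[OF assms] by (simp add: divide_le_eq_1 add_pos_nonneg)
  show "norm (boltz_factor t \<theta> k) \<le> 1" using * by (simp add: abs_square_le_1)
qed

text \<open>For t k <= 1 the ratio q is at least 1/3, so 4 q / (1 - q)^2 >= 1 and the squared
  modulus is at most 1 / (1 + s) with s the squared sine; finally exp (s / 2) <= 1 + s on
  [0, 1].\<close>

lemma norm_boltz_factor_le_exp:
  assumes "0 < t" "0 < k" "t * real k \<le> 1"
  shows "(norm (boltz_factor t \<theta> k))\<^sup>2 \<le> exp (- ((sin (\<theta> * real k / 2))\<^sup>2 / 2))"
proof -
  define q where "q = exp (- (t * real k))"
  define s where "s = (sin (\<theta> * real k / 2))\<^sup>2"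
  have s: "0 \<le> s" "s \<le> 1" by (auto simp: s_def abs_square_le_1)
  have q: "0 < q" "q < 1" using assms by (auto simp: q_def)
  have q3: "1 / 3 \<le> q"
  proof -
    have "exp (t * real k) \<le> 3" using exp_le assms by (meson exp_le_cancel_iff order_trans)
    then show ?thesis by (simp add: q_def exp_minus field_simps)
  qed
  have "(1 - q)\<^sup>2 \<le> 1" using q by (simp add: abs_square_le_1)
  then have "(1 - q)\<^sup>2 \<le> 4 * q" using q3 by simp
  then have "s * (1 - q)\<^sup>2 \<le> s * (4 * q)" using s by (intro mult_left_mono)
  then have y: "s \<le> 4 * q * s / (1 - q)\<^sup>2" using q by (simp add: field_simps)
  have "(norm (boltz_factor t \<theta> k))\<^sup>2 = 1 / (1 + 4 * q * s / (1 - q)\<^sup>2)"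
    unfolding norm_boltz_factor[OF assms(1,2)] q_def s_def ..
  also have "\<dots> \<le> 1 / (1 + s)" using y s by (intro divide_left_mono) auto
  also have "\<dots> \<le> 1 / exp (s / 2)"
  proof -
    have "exp (s / 2) \<le> 1 + s / 2 + (s / 2)\<^sup>2" using s by (intro exp_bound) auto
    also have "\<dots> \<le> 1 + s" using s mult_left_le[of s s] by (simp add: power2_eq_square)
    finally show ?thesis using s by (intro divide_left_mono) auto
  qed
  finally show ?thesis by (simp add: s_def exp_minus inverse_eq_divide)
qed

text \<open>Slots outside D x {L, R} have factors of modulus at most 1 and are discarded. The two
  sides contribute equal factors, which supplies the square in the bound for a single
  factor.\<close>

lemma norm_boltz_char_le_exp:
  assumes "finite I" "0 < t" "\<And>i. i \<in> I \<Longrightarrow> 0 < fst i" "finite D" "D \<times> {Lft, Rgt} \<subseteq> I"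
    "\<And>k. k \<in> D \<Longrightarrow> t * real k \<le> 1"
  shows "norm (boltz_char t I \<theta>) \<le> exp (- ((\<Sum>k\<in>D. (sin (\<theta> * real k / 2))\<^sup>2) / 2))"
proof -
  have pos: "0 < k" if "k \<in> D" for k using assms(3,5) that by fastforce
  have "norm (boltz_char t I \<theta>) = (\<Prod>i\<in>I. norm (boltz_factor t \<theta> (fst i)))"
    unfolding boltz_char_def by (rule prod_norm[symmetric])
  also have "\<dots> = (\<Prod>i\<in>I - D \<times> {Lft, Rgt}. norm (boltz_factor t \<theta> (fst i))) *
      (\<Prod>i\<in>D \<times> {Lft, Rgt}. norm (boltz_factor t \<theta> (fst i)))"
    using assms by (intro prod.subset_diff) auto
  also have "\<dots> \<le> 1 * (\<Prod>i\<in>D \<times> {Lft, Rgt}. norm (boltz_factor t \<theta> (fst i)))"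
    using assms norm_boltz_factor_le by (intro mult_right_mono prod_le_1 prod_nonneg) auto
  also have "\<dots> = (\<Prod>k\<in>D. (norm (boltz_factor t \<theta> k))\<^sup>2)"
    using prod.cartesian_product[of "\<lambda>k (j::side). norm (boltz_factor t \<theta> k)" "{Lft, Rgt}" D]
    by (simp add: case_prod_unfold power2_eq_square)
  also have "\<dots> \<le> (\<Prod>k\<in>D. exp (- ((sin (\<theta> * real k / 2))\<^sup>2 / 2)))"
    using assms pos norm_boltz_factor_le_exp by (intro prod_mono) auto
  also have "\<dots> = exp (- ((\<Sum>k\<in>D. (sin (\<theta> * real k / 2))\<^sup>2) / 2))"
    using assms(4) by (simp add: exp_sum[symmetric] sum_negf sum_divide_distrib)
  finally show ?thesis .
qed

lemma sum_cos_telescope: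
  "2 * sin (\<theta> / 2) * (\<Sum>k\<in>{a<..b}. cos (\<theta> * real k)) =
     sin (\<theta> * (real b + 1 / 2)) - sin (\<theta> * (real a + 1 / 2))" if "a \<le> b"
  using that
proof (induction b rule: dec_induct)
  case (step n)
  have "{a<..Suc n} = insert (Suc n) {a<..n}" using step by auto
  then have "2 * sin (\<theta> / 2) * (\<Sum>k\<in>{a<..Suc n}. cos (\<theta> * real k)) =
     2 * sin (\<theta> / 2) * cos (\<theta> * real (Suc n)) + (sin (\<theta> * (real n + 1 / 2)) - sin (\<theta> * (real a + 1 / 2)))"
    using step by (simp add: distrib_left)
  also have "2 * sin (\<theta> / 2) * cos (\<theta> * real (Suc n)) = sin (\<theta> * (real (Suc n) + 1 / 2)) - sin (\<theta> * (real n + 1 / 2))"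
  proof -
    have 1: "\<theta> * (real (Suc n) + 1 / 2) = \<theta> * real (Suc n) + \<theta> / 2"
      and 2: "\<theta> * (real n + 1 / 2) = \<theta> * real (Suc n) - \<theta> / 2" by (simp_all add: algebra_simps)
    show ?thesis unfolding 1 2 sin_add sin_diff by simp
  qed
  finally show ?case by simp
qed simp

lemma sin_ge_half: "x / 2 \<le> sin x" if "0 \<le> x" "x \<le> pi / 2" for x :: real
proof -
  \<comment> \<open>Since 1.7^2 = 2.89 < 3, the cubic term x^3 / 6 is at most x / 2.\<close>
  have "x \<le> 1.7" using that pi_less_4 pi_approx by simp
  then have "x\<^sup>2 \<le> 1.7\<^sup>2" using that by (intro power_mono) auto
  then have "x * x\<^sup>2 \<le> x * 3" using that by (intro mult_left_mono) (auto simp: power2_eq_square)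
  then have "x / 2 \<le> x - x ^ 3 / 6" by (simp add: power3_eq_cube power2_eq_square)
  with sin_lower[OF that(1)] show ?thesis by simp
qed

text \<open>With sin^2 (a / 2) = (1 - cos a) / 2 only the cosine sum matters. It telescopes after
  multiplication by 2 sin (\<theta> / 2), which is at least \<theta> / 2, so it is at most 4 /
  \<theta>.\<close>

lemma sum_sin_sq_ge:
  assumes "0 < \<theta>" "\<theta> \<le> pi" "a \<le> b"
  shows "real (b - a) / 2 - 2 / \<theta> \<le> (\<Sum>k\<in>{a<..b}. (sin (\<theta> * real k / 2))\<^sup>2)"
proof -
  let ?S = "\<Sum>k\<in>{a<..b}. cos (\<theta> * real k)"
  have s: "\<theta> / 4 \<le> sin (\<theta> / 2)" using sin_ge_half[of "\<theta> / 2"] assms by simp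
  have "2 * sin (\<theta> / 2) * ?S \<le> 2"
    unfolding sum_cos_telescope[OF assms(3)]
    using sin_le_one[of "\<theta> * (real b + 1 / 2)"] sin_ge_minus_one[of "\<theta> * (real a + 1 / 2)"] by linarith
  then have "?S \<le> 4 / \<theta>"
  proof (cases "?S \<le> 0")
    case False
    have "\<theta> / 4 * ?S \<le> sin (\<theta> / 2) * ?S" using False s by (intro mult_right_mono) auto
    with \<open>2 * sin (\<theta> / 2) * ?S \<le> 2\<close> have "\<theta> / 4 * ?S \<le> 1" by simp
    then show ?thesis using assms by (simp add: field_simps)
  qed (use assms in \<open>simp add: order_trans\<close>)
  moreover have "(\<Sum>k\<in>{a<..b}. (sin (\<theta> * real k / 2))\<^sup>2) = (\<Sum>k\<in>{a<..b}. (1 - cos (\<theta> * real k)) / 2)"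
  proof (intro sum.cong refl)
    fix k
    show "(sin (\<theta> * real k / 2))\<^sup>2 = (1 - cos (\<theta> * real k)) / 2"
      using cos_double_sin[of "\<theta> * real k / 2"] by simp
  qed
  moreover have "\<dots> = real (b - a) / 2 - ?S / 2"
    by (simp add: sum_divide_distrib[symmetric] sum_subtractf diff_divide_distrib)
  ultimately show ?thesis by (simp add: field_simps)
qed

text \<open>Only the parts \<open>k\<close> with \<open>1/16 < t k \<le> 1\<close> are used to bound the characteristic function, so that any
  set of smaller parts may be removed from the index set.\<close>

definition covers :: "real \<Rightarrow> (nat \<times> side) set \<Rightarrow> bool" where
  "covers t I \<longleftrightarrow> finite I \<and> (\<forall>i\<in>I. 0 < fst i) \<and>
     (\<forall>k. 1 / 16 < t * real k \<longrightarrow> t * real k \<le> 1 \<longrightarrow> (k, Lft) \<in> I \<and> (k, Rgt) \<in> I)"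

text \<open>For \<open>\<theta> \<le> 16 t\<close> the first term is obtained from the parts \<open>k \<le> 1/(8 t)\<close>, for which \<open>\<theta> k / 2 \<le> 1\<close> and the
  sine is comparable to its argument. For larger \<open>\<theta>\<close> the second term comes from cancellation in \<open>\<Sum>k. cos (\<theta> k)\<close>.\<close>

lemma boltz_char_decay:
  assumes I: "covers t I" and t: "0 < t" "t \<le> 1 / 32" and \<theta>: "0 < \<theta>" "\<theta> \<le> pi"
  shows "norm (boltz_char t I \<theta>) \<le> exp (- (\<theta>\<^sup>2 / (262144 * t ^ 3))) + exp (- (1 / (262144 * t)))"
proof -
  define a where "a = nat \<lfloor>1 / (16 * t)\<rfloor>"
  define b where "b = nat \<lfloor>1 / (8 * t)\<rfloor>"
  define c where "c = nat \<lfloor>1 / t\<rfloor>"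
  have a: "real a \<le> 1 / (16 * t)" "1 / (16 * t) < real a + 1"
    and b: "real b \<le> 1 / (8 * t)" "1 / (8 * t) < real b + 1"
    and c: "real c \<le> 1 / t" "1 / t < real c + 1"
    using t unfolding a_def b_def c_def by (auto simp: of_nat_nat)
  have T: "32 \<le> 1 / t" using t by (simp add: field_simps)
  have A: "1 / (16 * t) = 1 / t / 16" "1 / (8 * t) = 1 / t / 8" by simp_all
  have inI: "(k, Lft) \<in> I \<and> (k, Rgt) \<in> I" "t * real k \<le> 1" "1 / 16 < t * real k"
    if "k \<in> {a<..c}" for k
  proof -
    have "1 / (16 * t) < real k" using a that by auto
    then show 1: "1 / 16 < t * real k" using t by (simp add: field_simps)
    have "real k \<le> 1 / t" using c that by auto
    then show 2: "t * real k \<le> 1" using t by (simp add: field_simps)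
    show "(k, Lft) \<in> I \<and> (k, Rgt) \<in> I" using I 1 2 unfolding covers_def by blast
  qed
  have bc: "b \<le> c" using b c A T by linarith
  have fin: "finite I" "\<And>i. i \<in> I \<Longrightarrow> 0 < fst i" using I unfolding covers_def by auto
  show ?thesis
  \<comment> \<open>The constant 262144 = 2 * 32 * 4096 comes from the first case: at least 1 / (32
    t) parts, each contributing at least (\<theta> / (64 t))^2, and a factor 1/2 in the exponent.
    The second case yields 1 / (8 t) and merely reuses the constant.\<close>
  proof (cases "\<theta> \<le> 16 * t")
    case True
    have "norm (boltz_char t I \<theta>) \<le> exp (- ((\<Sum>k\<in>{a<..b}. (sin (\<theta> * real k / 2))\<^sup>2) / 2))"
      using inI bc by (intro norm_boltz_char_le_exp fin t) auto
    also have "\<dots> \<le> exp (- (\<theta>\<^sup>2 / (262144 * t ^ 3)))"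
    proof -
      have ge: "\<theta>\<^sup>2 / (4096 * t\<^sup>2) \<le> (sin (\<theta> * real k / 2))\<^sup>2" if k: "k \<in> {a<..b}" for k
      proof -
        have k1: "1 / 16 / t \<le> real k" using inI(3)[of k] k bc t by (simp add: field_simps)
        have k2: "real k \<le> 1 / (8 * t)" using b k by auto
        have "\<theta> * real k \<le> (16 * t) * (1 / (8 * t))" using True k2 \<theta> t by (intro mult_mono) auto
        then have "\<theta> * real k / 2 \<le> 1" using t by simp
        then have "\<theta> * real k / 2 / 2 \<le> sin (\<theta> * real k / 2)" using \<theta> pi_ge_two by (intro sin_ge_half) auto
        moreover have "\<theta> * (1 / 16 / t) / 4 \<le> \<theta> * real k / 2 / 2" using mult_left_mono[OF k1, of \<theta>] \<theta> by simp
        ultimately have "\<theta> / (64 * t) \<le> sin (\<theta> * real k / 2)" by (simp add: field_simps)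
        then have "(\<theta> / (64 * t))\<^sup>2 \<le> (sin (\<theta> * real k / 2))\<^sup>2" using \<theta> t by (intro power_mono) auto
        then show ?thesis by (simp add: power_divide power_mult_distrib)
      qed
      \<comment> \<open>The interval has length at least 1 / (16 t) - 1, and t <= 1/32 absorbs the
        rounding loss.\<close>
      have "1 / (32 * t) \<le> real (b - a)" using a b A T by auto
      then have "1 / (32 * t) * (\<theta>\<^sup>2 / (4096 * t\<^sup>2)) \<le> real (b - a) * (\<theta>\<^sup>2 / (4096 * t\<^sup>2))"
        by (intro mult_right_mono) auto
      also have "\<dots> \<le> (\<Sum>k\<in>{a<..b}. (sin (\<theta> * real k / 2))\<^sup>2)"
        using sum_mono[of "{a<..b}" "\<lambda>_. \<theta>\<^sup>2 / (4096 * t\<^sup>2)", OF ge] by simp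
      finally have "\<theta>\<^sup>2 / (131072 * t ^ 3) \<le> (\<Sum>k\<in>{a<..b}. (sin (\<theta> * real k / 2))\<^sup>2)"
        by (simp add: power3_eq_cube power2_eq_square mult_ac)
      then show ?thesis by simp
    qed
    finally show ?thesis by (simp add: add_increasing2)
  next
    case False
    have "norm (boltz_char t I \<theta>) \<le> exp (- ((\<Sum>k\<in>{a<..c}. (sin (\<theta> * real k / 2))\<^sup>2) / 2))"
      using inI by (intro norm_boltz_char_le_exp fin t) auto
    also have "\<dots> \<le> exp (- (1 / (262144 * t)))"
    proof -
      have ac: "a \<le> c" using a c A T by linarith
      have "2 / \<theta> \<le> 1 / t / 8" using False t \<theta> by (simp add: field_simps)
      moreover have "1 / t * (3 / 4) \<le> real (c - a)" using ac a c A T by (auto simp: of_nat_diff)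
      ultimately have "1 / t / 4 \<le> real (c - a) / 2 - 2 / \<theta>" by simp
      also have "\<dots> \<le> (\<Sum>k\<in>{a<..c}. (sin (\<theta> * real k / 2))\<^sup>2)"
        by (rule sum_sin_sq_ge[OF \<theta> ac])
      finally have "1 / t / 4 \<le> (\<Sum>k\<in>{a<..c}. (sin (\<theta> * real k / 2))\<^sup>2)" .
      moreover have "1 / (262144 * t) \<le> 1 / t / 4 / 2" using t by (simp add: field_simps)
      ultimately show ?thesis by simp
    qed
    finally show ?thesis by (simp add: add_increasing)
  qed
qed

section \<open>From decay to Lipschitz bounds\<close>

lemma has_integral_gauss_moment:
  fixes a :: real assumes "a \<noteq> 0" "u \<le> v"
  shows "((\<lambda>\<theta>. \<theta> * exp (- (a * \<theta>\<^sup>2))) has_integral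
     (exp (- (a * u\<^sup>2)) - exp (- (a * v\<^sup>2))) / (2 * a)) {u..v}"
proof -
  have "((\<lambda>\<theta>. \<theta> * exp (- (a * \<theta>\<^sup>2))) has_integral
     (- exp (- (a * v\<^sup>2)) / (2 * a) - (- exp (- (a * u\<^sup>2)) / (2 * a)))) {u..v}"
    using assms
    by (intro fundamental_theorem_of_calculus)
       (auto simp flip: has_real_derivative_iff_has_vector_derivative intro!: derivative_eq_intros)
  then show ?thesis by (simp add: diff_divide_distrib)
qed

lemma continuous_on_boltz_char:
  assumes "0 < t" "\<And>i. i \<in> I \<Longrightarrow> 0 < fst i"
  shows "continuous_on A (boltz_char t I)"
proof -
  have "1 - of_real (exp (- (t * real k))) * cis (\<theta> * real k) \<noteq> 0" if "0 < k" for k \<theta>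
  proof
    assume "1 - of_real (exp (- (t * real k))) * cis (\<theta> * real k) = 0"
    then have "norm (of_real (exp (- (t * real k))) * cis (\<theta> * real k)) = norm (1 :: complex)" by simp
    then have "exp (- (t * real k)) = 1" by (simp add: norm_mult)
    then show False using that assms(1) by simp
  qed
  then show ?thesis using assms(2)
    unfolding boltz_char_def boltz_factor_def
    by (intro continuous_intros) auto
qed

text \<open>The third power is what is needed to absorb terms exponentially small in 1 / t into
  O(t^3).\<close>

lemma exp_neg_le_cube: "exp (- x) \<le> 27 / x ^ 3" if "0 < x" for x :: real
proof -
  have "(x / 3) ^ 3 \<le> (1 + x / 3) ^ 3" using that by (intro power_mono) auto
  also have "\<dots> \<le> exp x" using exp_ge_one_plus_x_over_n_power_n[of 3 x] that by simp
  finally show ?thesis using that by (simp add: exp_minus field_simps)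
qed

text \<open>This first absolute moment is the Lipschitz constant of the Fourier integral in its
  target. The Gaussian part of the decay integrates to t^3 / (2 c) at most, and the other part is
  exponentially small.\<close>

lemma boltz_char_moment:
  obtains M where "0 < M" and
    "\<And>t I. covers t I \<Longrightarrow> 0 < t \<Longrightarrow> t \<le> 1 / 32 \<Longrightarrow>
       integral {0..pi} (\<lambda>\<theta>. \<theta> * norm (boltz_char t I \<theta>)) \<le> M * t ^ 3"
proof
  define c :: real where "c = 1 / 262144"
  \<comment> \<open>The second summand is the bound for pi^2 exp (- c / t), with pi^2 <= 16 and
    \<open>exp_neg_le_cube\<close>.\<close>
  define M where "M = 1 / (2 * c) + 16 * 27 / c ^ 3"
  have c: "0 < c" by (simp add: c_def)
  show "0 < M" unfolding M_def using c by (intro add_pos_pos divide_pos_pos) auto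
  fix t I assume I: "covers t I" and t: "0 < t" "t \<le> 1 / 32"
  let ?g = "\<lambda>\<theta>. \<theta> * exp (- (c / t ^ 3 * \<theta>\<^sup>2)) + pi * exp (- (c / t))"
  have g: "(?g has_integral (exp (- (c / t ^ 3 * 0\<^sup>2)) - exp (- (c / t ^ 3 * pi\<^sup>2))) / (2 * (c / t ^ 3)) + pi * (pi * exp (- (c / t)))) {0..pi}"
    using t c has_integral_const_real[of "pi * exp (- (c / t))" 0 pi]
    by (intro has_integral_add has_integral_gauss_moment) auto
  have "integral {0..pi} (\<lambda>\<theta>. \<theta> * norm (boltz_char t I \<theta>)) \<le> integral {0..pi} ?g"
  proof (rule integral_le)
    show "(\<lambda>\<theta>. \<theta> * norm (boltz_char t I \<theta>)) integrable_on {0..pi}"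
      using I t unfolding covers_def
      by (intro integrable_continuous_real continuous_intros continuous_on_boltz_char) auto
    show "?g integrable_on {0..pi}" using g by blast
    fix \<theta> assume \<theta>: "\<theta> \<in> {0..pi}"
    show "\<theta> * norm (boltz_char t I \<theta>) \<le> ?g \<theta>"
    proof (cases "\<theta> = 0")
      case False
      then have "norm (boltz_char t I \<theta>) \<le> exp (- (c / t ^ 3 * \<theta>\<^sup>2)) + exp (- (c / t))"
        using boltz_char_decay[OF I t, of \<theta>] \<theta> by (simp add: c_def)
      then have "\<theta> * norm (boltz_char t I \<theta>) \<le> \<theta> * (exp (- (c / t ^ 3 * \<theta>\<^sup>2)) + exp (- (c / t)))"
        using \<theta> by (intro mult_left_mono) auto
      also have "\<dots> \<le> ?g \<theta>" using \<theta> by (simp add: distrib_left)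
      finally show ?thesis .
    qed auto
  qed
  also have "integral {0..pi} ?g = (1 - exp (- (c / t ^ 3 * pi\<^sup>2))) / (2 * (c / t ^ 3)) + pi * (pi * exp (- (c / t)))"
    using integral_unique[OF g] by simp
  also have "\<dots> \<le> 1 / (2 * (c / t ^ 3)) + 16 * (27 / (c / t) ^ 3)"
  proof (intro add_mono divide_right_mono)
    have "pi * pi \<le> 4 * 4" using pi_less_4 pi_ge_zero by (intro mult_mono) auto
    then have "(pi * pi) * exp (- (c / t)) \<le> (4 * 4) * (27 / (c / t) ^ 3)"
      using exp_neg_le_cube[of "c / t"] t c by (intro mult_mono[of "pi * pi" "4 * 4"]) auto
    then show "pi * (pi * exp (- (c / t))) \<le> 16 * (27 / (c / t) ^ 3)" by (simp add: mult.assoc)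
  qed (use t c in auto)
  also have "\<dots> = M * t ^ 3" using t c by (simp add: M_def field_simps)
  finally show "integral {0..pi} (\<lambda>\<theta>. \<theta> * norm (boltz_char t I \<theta>)) \<le> M * t ^ 3" .
qed

text \<open>The inversion integral with a real target, so that it can also be evaluated at the mean,
  which need not be an integer.\<close>

definition boltz_fourier :: "real \<Rightarrow> (nat \<times> side) set \<Rightarrow> real \<Rightarrow> real" where
  "boltz_fourier t I \<mu> = integral {0..pi} (\<lambda>\<theta>. Re (boltz_char t I \<theta> * cis (- (\<theta> * \<mu>))))"

lemma boltz_fourier_integrable:
  assumes "covers t I" "0 < t"
  shows "(\<lambda>\<theta>. Re (boltz_char t I \<theta> * cis (- (\<theta> * \<mu>)))) integrable_on {u..v}"
  using assms unfolding covers_def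
  by (intro integrable_continuous_real continuous_intros continuous_on_boltz_char) auto

lemma norm_cis_diff_le: "norm (cis a - cis b) \<le> \<bar>a - b\<bar>"
proof -
  have "(norm (cis a - cis b))\<^sup>2 = (cos a - cos b)\<^sup>2 + (sin a - sin b)\<^sup>2" by (simp add: cmod_def)
  also have "\<dots> = 2 - 2 * cos (a - b)"
    using sin_cos_squared_add[of a] sin_cos_squared_add[of b]
    by (simp add: power2_diff cos_diff algebra_simps)
  also have "\<dots> = (2 * sin ((a - b) / 2))\<^sup>2"
  proof -
    have "2 * ((a - b) / 2) = a - b" by simp
    then have "cos (a - b) = 1 - 2 * (sin ((a - b) / 2))\<^sup>2" by (metis cos_double_sin)
    then show ?thesis by (simp add: power_mult_distrib)
  qed
  also have "\<dots> \<le> (a - b)\<^sup>2"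
  proof -
    have "\<bar>2 * sin ((a - b) / 2)\<bar> \<le> \<bar>a - b\<bar>" using abs_sin_x_le_abs_x[of "(a - b) / 2"] by simp
    then show ?thesis by (rule abs_le_square_iff[THEN iffD1])
  qed
  finally have "(norm (cis a - cis b))\<^sup>2 \<le> \<bar>a - b\<bar>\<^sup>2" by simp
  then show ?thesis by (rule power2_le_imp_le) simp
qed

text \<open>A chord is no longer than its arc, so changing the target from \<mu> to \<nu> changes
  the integrand by at most \<theta> |\<mu> - \<nu>| times the modulus of the characteristic
  function.\<close>

lemma boltz_fourier_lipschitz:
  obtains M where "0 < M" and
    "\<And>t I \<mu> \<nu>. covers t I \<Longrightarrow> 0 < t \<Longrightarrow> t \<le> 1 / 32 \<Longrightarrow>
       \<bar>boltz_fourier t I \<mu> - boltz_fourier t I \<nu>\<bar> \<le> M * t ^ 3 * \<bar>\<mu> - \<nu>\<bar>"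
proof -
  obtain M where M: "0 < M" and
    le: "\<And>t I. covers t I \<Longrightarrow> 0 < t \<Longrightarrow> t \<le> 1 / 32 \<Longrightarrow>
       integral {0..pi} (\<lambda>\<theta>. \<theta> * norm (boltz_char t I \<theta>)) \<le> M * t ^ 3"
    using boltz_char_moment by blast
  show ?thesis
  proof (rule that[OF M])
    fix t I \<mu> \<nu> assume I: "covers t I" and t: "0 < t" "t \<le> 1 / 32"
    note int = boltz_fourier_integrable[OF I t(1)]
    have bi: "(\<lambda>\<theta>. \<theta> * norm (boltz_char t I \<theta>)) integrable_on {0..pi}"
      using I t unfolding covers_def
      by (intro integrable_continuous_real continuous_intros continuous_on_boltz_char) auto
    have "\<bar>boltz_fourier t I \<mu> - boltz_fourier t I \<nu>\<bar> =
      norm (integral {0..pi} (\<lambda>\<theta>. Re (boltz_char t I \<theta> * cis (- (\<theta> * \<mu>))) - Re (boltz_char t I \<theta> * cis (- (\<theta> * \<nu>)))))"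
      unfolding boltz_fourier_def integral_diff[OF int int] by simp
    also have "\<dots> \<le> integral {0..pi} (\<lambda>\<theta>. \<bar>\<mu> - \<nu>\<bar> * (\<theta> * norm (boltz_char t I \<theta>)))"
    proof (rule integral_norm_bound_integral)
      show "(\<lambda>\<theta>. Re (boltz_char t I \<theta> * cis (- (\<theta> * \<mu>))) - Re (boltz_char t I \<theta> * cis (- (\<theta> * \<nu>)))) integrable_on {0..pi}"
        by (intro integrable_diff int)
      show "(\<lambda>\<theta>. \<bar>\<mu> - \<nu>\<bar> * (\<theta> * norm (boltz_char t I \<theta>))) integrable_on {0..pi}"
        by (intro integrable_on_mult_right bi)
      fix \<theta> assume \<theta>: "\<theta> \<in> {0..pi}"
      have "norm (Re (boltz_char t I \<theta> * cis (- (\<theta> * \<mu>))) - Re (boltz_char t I \<theta> * cis (- (\<theta> * \<nu>)))) =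
        \<bar>Re (boltz_char t I \<theta> * (cis (- (\<theta> * \<mu>)) - cis (- (\<theta> * \<nu>))))\<bar>"
        by (simp add: algebra_simps)
      also have "\<dots> \<le> norm (boltz_char t I \<theta>) * norm (cis (- (\<theta> * \<mu>)) - cis (- (\<theta> * \<nu>)))"
        unfolding norm_mult[symmetric] by (rule abs_Re_le_cmod)
      also have "\<dots> \<le> norm (boltz_char t I \<theta>) * \<bar>(- (\<theta> * \<mu>)) - (- (\<theta> * \<nu>))\<bar>"
        by (intro mult_left_mono norm_cis_diff_le) auto
      also have "\<bar>(- (\<theta> * \<mu>)) - (- (\<theta> * \<nu>))\<bar> = \<theta> * \<bar>\<mu> - \<nu>\<bar>"
      proof -
        have "(- (\<theta> * \<mu>)) - (- (\<theta> * \<nu>)) = - (\<theta> * (\<mu> - \<nu>))" by (simp add: algebra_simps)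
        then show ?thesis using \<theta> by (simp add: abs_mult)
      qed
      finally show "norm (Re (boltz_char t I \<theta> * cis (- (\<theta> * \<mu>))) - Re (boltz_char t I \<theta> * cis (- (\<theta> * \<nu>)))) \<le>
        \<bar>\<mu> - \<nu>\<bar> * (\<theta> * norm (boltz_char t I \<theta>))" by (simp only: mult_ac)
    qed
    also have "\<dots> = \<bar>\<mu> - \<nu>\<bar> * integral {0..pi} (\<lambda>\<theta>. \<theta> * norm (boltz_char t I \<theta>))" by simp
    also have "\<dots> \<le> \<bar>\<mu> - \<nu>\<bar> * (M * t ^ 3)" by (intro mult_left_mono le I t) auto
    finally show "\<bar>boltz_fourier t I \<mu> - boltz_fourier t I \<nu>\<bar> \<le> M * t ^ 3 * \<bar>\<mu> - \<nu>\<bar>"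
      by (simp add: mult.commute)
  qed
qed

text \<open>The target is an integer because it will be the size left over after removing the peak
  and random small parts, which may be negative.\<close>

definition boltz_prob :: "real \<Rightarrow> (nat \<times> side) set \<Rightarrow> int \<Rightarrow> real" where
  "boltz_prob t I w = measure_pmf.prob (boltz t I) {x. int (wsum I x) = w}"

lemma boltz_prob_fourier:
  assumes "covers t I" "0 < t"
  shows "pi * boltz_prob t I w = boltz_fourier t I (of_int w)"
proof -
  have "((\<lambda>\<theta>. measure_pmf.expectation (map_pmf (wsum I) (boltz t I)) (\<lambda>x. cos (\<theta> * (real x - real_of_int w))))
     has_integral (pi * measure_pmf.prob (map_pmf (wsum I) (boltz t I)) {x. int x = w})) {0..pi}"
    by (rule pmf_fourier)
  also have "(\<lambda>\<theta>. measure_pmf.expectation (map_pmf (wsum I) (boltz t I)) (\<lambda>x. cos (\<theta> * (real x - real_of_int w)))) =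
    (\<lambda>\<theta>. Re (boltz_char t I \<theta> * cis (- (\<theta> * of_int w))))"
    using assms unfolding covers_def by (intro ext) (subst integral_map_pmf, rule expectation_cos_boltz, auto)
  also have "measure_pmf.prob (map_pmf (wsum I) (boltz t I)) {x. int x = w} = boltz_prob t I w"
    by (simp add: boltz_prob_def)
  finally show ?thesis unfolding boltz_fourier_def by (simp add: integral_unique)
qed

lemma boltz_prob_lipschitz:
  obtains M where "0 < M" and
    "\<And>t I v w. covers t I \<Longrightarrow> 0 < t \<Longrightarrow> t \<le> 1 / 32 \<Longrightarrow>
       \<bar>boltz_prob t I v - boltz_prob t I w\<bar> \<le> M * t ^ 3 * of_int \<bar>v - w\<bar>"
proof -
  obtain M where M: "0 < M" and
    le: "\<And>t I \<mu> \<nu>. covers t I \<Longrightarrow> 0 < t \<Longrightarrow> t \<le> 1 / 32 \<Longrightarrow>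
       \<bar>boltz_fourier t I \<mu> - boltz_fourier t I \<nu>\<bar> \<le> M * t ^ 3 * \<bar>\<mu> - \<nu>\<bar>"
    using boltz_fourier_lipschitz by blast
  show ?thesis
  proof (rule that[OF M])
    fix t I and v w :: int assume I: "covers t I" and t: "0 < t" "t \<le> 1 / 32"
    have "\<bar>boltz_prob t I v - boltz_prob t I w\<bar> \<le> pi * \<bar>boltz_prob t I v - boltz_prob t I w\<bar>"
      using pi_ge_two by (simp add: mult_le_cancel_right1)
    also have "\<dots> = \<bar>pi * boltz_prob t I v - pi * boltz_prob t I w\<bar>"
      by (simp add: abs_mult flip: right_diff_distrib)
    also have "\<dots> \<le> M * t ^ 3 * \<bar>of_int v - of_int w\<bar>"
      unfolding boltz_prob_fourier[OF I t(1)] by (rule le[OF I t])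
    finally show "\<bar>boltz_prob t I v - boltz_prob t I w\<bar> \<le> M * t ^ 3 * of_int \<bar>v - w\<bar>" by simp
  qed
qed

section \<open>The local lower bound\<close>

text \<open>Parts equal to the peak may occur on either side of it, so the range includes
  \<open>m\<close> itself.\<close>

definition slots :: "nat \<Rightarrow> (nat \<times> side) set" where
  "slots m = {1..m} \<times> {Lft, Rgt}"

lemma finite_slots [simp]: "finite (slots m)" by (simp add: slots_def)

lemma slots_pos: "i \<in> slots m \<Longrightarrow> 0 < fst i" by (auto simp: slots_def)

lemma sum_slots: "(\<Sum>i\<in>slots m. g (fst i)) = 2 * (\<Sum>k = 1..m. g k)" for g :: "nat \<Rightarrow> real"
proof -
  have "(\<Sum>i\<in>slots m. g (fst i)) = (\<Sum>k = 1..m. \<Sum>j\<in>{Lft, Rgt}. g k)"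
    unfolding slots_def by (subst sum.cartesian_product) (simp add: case_prod_unfold)
  then show ?thesis by (simp add: sum_distrib_left)
qed

lemma prod_slots: "(\<Prod>i\<in>slots m. g (fst i)) = (\<Prod>k = 1..m. g k)\<^sup>2" for g :: "nat \<Rightarrow> real"
proof -
  have "(\<Prod>i\<in>slots m. g (fst i)) = (\<Prod>k = 1..m. \<Prod>j\<in>{Lft, Rgt}. g k)"
    unfolding slots_def by (subst prod.cartesian_product) (simp add: case_prod_unfold)
  then show ?thesis by (simp add: prod.distrib power2_eq_square)
qed

text \<open>The removed parts lie below the window 1/16 < t k <= 1 used by \<open>covers\<close>,
  and the peak lies above it.\<close>

lemma covers_slots_Diff:
  assumes "1 \<le> t * real m" "0 < t" "\<And>k. k \<in> S \<Longrightarrow> t * real k \<le> 1 / 16"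
  shows "covers t (slots m - S \<times> {Lft, Rgt})"
  unfolding covers_def
proof (intro conjI allI impI ballI)
  fix k assume k: "1 / 16 < t * real k" "t * real k \<le> 1"
  have "k \<notin> S" using assms(3)[of k] k by auto
  moreover have "0 < k" using k by (cases k) auto
  moreover have "k \<le> m"
  proof -
    have "t * real k \<le> t * real m" using k assms by linarith
    then show ?thesis using assms by simp
  qed
  ultimately show "(k, Lft) \<in> slots m - S \<times> {Lft, Rgt}" "(k, Rgt) \<in> slots m - S \<times> {Lft, Rgt}"
    by (auto simp: slots_def)
qed (auto simp: slots_def)

lemma covers_slots: "1 \<le> t * real m \<Longrightarrow> 0 < t \<Longrightarrow> covers t (slots m)"
  using covers_slots_Diff[of t m "{}"] by simp

section \<open>Variance and Gaussian decay near the origin\<close>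

lemma boltz_var_slots:
  "boltz_var t (slots m) =
     2 * (\<Sum>k = 1..m. (real k)\<^sup>2 * (exp (- (t * real k)) / (1 - exp (- (t * real k)))\<^sup>2))"
  unfolding boltz_var_def
  using sum_slots[of "\<lambda>k. (real k)\<^sup>2 * (exp (- (t * real k)) / (1 - exp (- (t * real k)))\<^sup>2)"] .

text \<open>On each side there are at least 1 / (2 t) parts with t k <= 1, and each contributes at
  least 1 / (3 t^2).\<close>

lemma boltz_var_slots_ge:
  assumes "0 < t" "t \<le> 1 / 2" "1 \<le> t * real m"
  shows "1 / (3 * t ^ 3) \<le> boltz_var t (slots m)"
proof -
  define N where "N = nat \<lfloor>1 / t\<rfloor>"
  have N: "real N \<le> 1 / t" "1 / t < real N + 1" using assms unfolding N_def by (auto simp: of_nat_nat)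
  have "1 / t \<le> real m" using assms by (simp add: field_simps)
  then have Nm: "N \<le> m" using N by linarith
  have "2 \<le> 1 / t" using assms by (simp add: field_simps)
  then have "1 / (2 * t) \<le> real N" using N by (simp add: field_simps)
  then have "1 / (2 * t) * (1 / (3 * t\<^sup>2)) \<le> real N * (1 / (3 * t\<^sup>2))" by (intro mult_right_mono) auto
  also have "\<dots> = (\<Sum>k = 1..N. 1 / (3 * t\<^sup>2))" by simp
  also have "\<dots> \<le> (\<Sum>k = 1..N. (real k)\<^sup>2 * (exp (- (t * real k)) / (1 - exp (- (t * real k)))\<^sup>2))"
  proof (rule sum_mono)
    fix k assume k: "k \<in> {1..N}"
    then have "real k \<le> 1 / t" using N by auto
    then have "t * real k \<le> 1" using assms by (simp add: field_simps)
    then have "1 / (3 * (t * real k)\<^sup>2) \<le> exp (- (t * real k)) / (1 - exp (- (t * real k)))\<^sup>2"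
      using assms k by (intro exp_over_square_ge) auto
    then have "(real k)\<^sup>2 * (1 / (3 * (t * real k)\<^sup>2)) \<le> (real k)\<^sup>2 * (exp (- (t * real k)) / (1 - exp (- (t * real k)))\<^sup>2)"
      by (intro mult_left_mono) auto
    then show "1 / (3 * t\<^sup>2) \<le> (real k)\<^sup>2 * (exp (- (t * real k)) / (1 - exp (- (t * real k)))\<^sup>2)"
      using k by (simp add: power_mult_distrib)
  qed
  also have "\<dots> \<le> (\<Sum>k = 1..m. (real k)\<^sup>2 * (exp (- (t * real k)) / (1 - exp (- (t * real k)))\<^sup>2))"
    using Nm by (intro sum_mono2) auto
  finally have "2 * (1 / (2 * t) * (1 / (3 * t\<^sup>2))) \<le> boltz_var t (slots m)"
    unfolding boltz_var_slots by linarith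
  then show ?thesis by (simp add: power3_eq_cube power2_eq_square)
qed

lemma boltz_var_slots_le:
  assumes "0 < t"
  shows "boltz_var t (slots m) \<le> 16 / t ^ 3"
proof -
  have "(\<Sum>k = 1..m. (real k)\<^sup>2 * (exp (- (t * real k)) / (1 - exp (- (t * real k)))\<^sup>2)) \<le>
    (\<Sum>k = 1..m. 4 / t\<^sup>2 * exp (- (t / 2 * real k)))"
  proof (rule sum_mono)
    fix k assume k: "k \<in> {1..m}"
    then have "exp (- (t * real k)) / (1 - exp (- (t * real k)))\<^sup>2 \<le> 4 * exp (- (t * real k) / 2) / (t * real k)\<^sup>2"
      using assms by (intro exp_over_square_le2) auto
    then have "(real k)\<^sup>2 * (exp (- (t * real k)) / (1 - exp (- (t * real k)))\<^sup>2) \<le> (real k)\<^sup>2 * (4 * exp (- (t * real k) / 2) / (t * real k)\<^sup>2)"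
      by (intro mult_left_mono) auto
    then show "(real k)\<^sup>2 * (exp (- (t * real k)) / (1 - exp (- (t * real k)))\<^sup>2) \<le> 4 / t\<^sup>2 * exp (- (t / 2 * real k))"
      using k by (simp add: power_mult_distrib)
  qed
  also have "\<dots> \<le> 4 / t\<^sup>2 * (1 / (t / 2))"
    unfolding sum_distrib_left[symmetric] using assms by (intro mult_left_mono sum_exp_neg_le) auto
  also have "\<dots> = 8 / t ^ 3" by (simp add: power3_eq_cube power2_eq_square)
  finally show ?thesis unfolding boltz_var_slots by simp
qed

text \<open>Controls the error of the expansion sin^2 x >= x^2 - x^4 / 3 when it is summed over all
  slots.\<close>

lemma boltz_fourth_slots_le:
  assumes "0 < t"
  shows "(\<Sum>i\<in>slots m. (real (fst i)) ^ 4 * (exp (- (t * real (fst i))) / (1 - exp (- (t * real (fst i))))\<^sup>2)) \<le> 1024 / t ^ 5"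
proof -
  have "(\<Sum>k = 1..m. (real k) ^ 4 * (exp (- (t * real k)) / (1 - exp (- (t * real k)))\<^sup>2)) \<le>
    (\<Sum>k = 1..m. 128 / t ^ 4 * exp (- (t / 4 * real k)))"
  proof (rule sum_mono)
    fix k assume k: "k \<in> {1..m}"
    define x where "x = t * real k"
    have x: "0 < x" using k assms by (simp add: x_def)
    have kx: "real k = x / t" using assms by (simp add: x_def)
    have "1 + x / 4 + (x / 4)\<^sup>2 / 2 \<le> exp (x / 4)"
      using x by (intro exp_lower_Taylor_quadratic) auto
    then have x2: "x\<^sup>2 \<le> 32 * exp (x / 4)" using x by (simp add: power_divide)
    have "exp (- x) / (1 - exp (- x))\<^sup>2 \<le> 4 * exp (- x / 2) / x\<^sup>2"
      using x by (intro exp_over_square_le2) auto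
    then have "x ^ 4 * (exp (- x) / (1 - exp (- x))\<^sup>2) \<le> x ^ 4 * (4 * exp (- x / 2) / x\<^sup>2)"
      by (intro mult_left_mono) auto
    also have "\<dots> = 4 * exp (- x / 2) * x\<^sup>2" using x by (simp add: eval_nat_numeral)
    also have "\<dots> \<le> 4 * exp (- x / 2) * (32 * exp (x / 4))" using x2 by (intro mult_left_mono) auto
    also have "\<dots> = 128 * exp (- (x / 4))" by (simp add: mult_exp_exp)
    finally have "x ^ 4 * (exp (- x) / (1 - exp (- x))\<^sup>2) \<le> 128 * exp (- (x / 4))" .
    then have "x ^ 4 * (exp (- x) / (1 - exp (- x))\<^sup>2) / t ^ 4 \<le> 128 * exp (- (x / 4)) / t ^ 4"
      using assms by (intro divide_right_mono) auto
    then show "(real k) ^ 4 * (exp (- (t * real k)) / (1 - exp (- (t * real k)))\<^sup>2) \<le> 128 / t ^ 4 * exp (- (t / 4 * real k))"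
      using assms by (simp add: x_def power_mult_distrib)
  qed
  also have "\<dots> \<le> 128 / t ^ 4 * (1 / (t / 4))"
    unfolding sum_distrib_left[symmetric] using assms by (intro mult_left_mono sum_exp_neg_le) auto
  finally have "2 * (\<Sum>k = 1..m. (real k) ^ 4 * (exp (- (t * real k)) / (1 - exp (- (t * real k)))\<^sup>2)) \<le> 1024 / t ^ 5"
    by (simp add: eval_nat_numeral)
  then show ?thesis
    using sum_slots[of "\<lambda>k. (real k) ^ 4 * (exp (- (t * real k)) / (1 - exp (- (t * real k)))\<^sup>2)"] by simp
qed

text \<open>Here the exponent is tied to the true variance. The universal constant in
  \<open>boltz_char_decay\<close> would give a tail much larger than the contribution of the central
  piece.\<close>

lemma norm_boltz_char_gauss:
  assumes t: "0 < t" "t \<le> 1 / 2" "1 \<le> t * real m" and \<theta>: "0 \<le> \<theta>" "\<theta> \<le> t / 64"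
  shows "norm (boltz_char t (slots m) \<theta>) \<le> exp (- (boltz_var t (slots m) / 3 * \<theta>\<^sup>2))"
proof -
  define V where "V = boltz_var t (slots m)"
  define w where "w k = exp (- (t * real k)) / (1 - exp (- (t * real k)))\<^sup>2" for k
  define y where "y k = 4 * (sin (\<theta> * real k / 2))\<^sup>2 * w k" for k
  have w0: "0 \<le> w k" for k by (simp add: w_def)
  have y0: "0 \<le> y k" for k by (simp add: y_def w0)
  have \<theta>2: "\<theta>\<^sup>2 \<le> t\<^sup>2 / 4096"
    using power_mono[OF \<theta>(2,1), of 2] by (simp add: power_divide)
  \<comment> \<open>By the range of \<theta>, y k <= (\<theta> / t)^2 <= 1 / 64^2 for every k, so
    passing from 1 / (1 + y) to an exponential loses only the factor 4096 / 4097 in the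
    exponent.\<close>
  have fac: "(norm (boltz_factor t \<theta> k))\<^sup>2 \<le> exp (- (y k * (4096 / 4097)))" if k: "0 < k" for k
  proof -
    have "w k \<le> 1 / (t * real k)\<^sup>2" unfolding w_def using t k by (intro exp_over_square_le1) auto
    moreover have "4 * (sin (\<theta> * real k / 2))\<^sup>2 \<le> (\<theta> * real k)\<^sup>2"
    proof -
      have "\<bar>2 * sin (\<theta> * real k / 2)\<bar> \<le> \<bar>\<theta> * real k\<bar>" using abs_sin_x_le_abs_x[of "\<theta> * real k / 2"] by simp
      then have "(2 * sin (\<theta> * real k / 2))\<^sup>2 \<le> (\<theta> * real k)\<^sup>2" by (rule abs_le_square_iff[THEN iffD1])
      then show ?thesis by (simp add: power_mult_distrib)
    qed
    ultimately have "y k \<le> (\<theta> * real k)\<^sup>2 * (1 / (t * real k)\<^sup>2)"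
      unfolding y_def using w0 by (intro mult_mono) auto
    also have "\<dots> = \<theta>\<^sup>2 / t\<^sup>2" using k by (simp add: power_mult_distrib)
    also have "\<dots> \<le> 1 / 4096" using \<theta>2 t by (simp add: field_simps)
    finally have y1: "y k \<le> 1 / 4096" .
    have "(norm (boltz_factor t \<theta> k))\<^sup>2 = 1 / (1 + y k)"
      using norm_boltz_factor[OF t(1) k, of \<theta>] by (simp add: y_def w_def mult_ac)
    also have "\<dots> = 1 + - (y k / (1 + y k))" using y0[of k] by (simp add: field_simps)
    also have "\<dots> \<le> exp (- (y k / (1 + y k)))" by (rule exp_ge_add_one_self)
    also have "\<dots> \<le> exp (- (y k * (4096 / 4097)))"
    proof -
      have "y k * (4096 / 4097) = y k / (4097 / 4096)" by simp
      also have "\<dots> \<le> y k / (1 + y k)" using y0[of k] y1 by (intro divide_left_mono) auto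
      finally show ?thesis by simp
    qed
    finally show ?thesis .
  qed
  have "(norm (boltz_char t (slots m) \<theta>))\<^sup>2 = (\<Prod>i\<in>slots m. (norm (boltz_factor t \<theta> (fst i)))\<^sup>2)"
    unfolding boltz_char_def prod_norm[symmetric] prod_power_distrib ..
  also have "\<dots> \<le> (\<Prod>i\<in>slots m. exp (- (y (fst i) * (4096 / 4097))))"
    using fac slots_pos by (intro prod_mono) auto
  also have "\<dots> = exp (- ((\<Sum>i\<in>slots m. y (fst i)) * (4096 / 4097)))"
    by (simp only: exp_sum[OF finite_slots, symmetric] sum_negf sum_distrib_right)
  also have "\<dots> \<le> exp (- (2 / 3 * V * \<theta>\<^sup>2))"
  proof -
    have V: "V = (\<Sum>i\<in>slots m. (real (fst i))\<^sup>2 * w (fst i))" unfolding V_def boltz_var_def w_def ..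
    define Q where "Q = (\<Sum>i\<in>slots m. (real (fst i)) ^ 4 * w (fst i))"
    have Q: "Q \<le> 1024 / t ^ 5" unfolding Q_def w_def by (rule boltz_fourth_slots_le[OF t(1)])
    have V1: "1 / (3 * t ^ 3) \<le> V" unfolding V_def by (rule boltz_var_slots_ge[OF t])
    have "\<theta>\<^sup>2 * V - \<theta> ^ 4 / 12 * Q = (\<Sum>i\<in>slots m. ((\<theta> * real (fst i))\<^sup>2 - (\<theta> * real (fst i)) ^ 4 / 12) * w (fst i))"
      unfolding V Q_def
      by (simp add: sum_distrib_left sum_subtractf[symmetric] left_diff_distrib right_diff_distrib power_mult_distrib mult_ac)
    also have "\<dots> \<le> (\<Sum>i\<in>slots m. y (fst i))"
    proof (rule sum_mono)
      fix i assume "i \<in> slots m"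
      have "(\<theta> * real (fst i) / 2)\<^sup>2 - (\<theta> * real (fst i) / 2) ^ 4 / 3 \<le> (sin (\<theta> * real (fst i) / 2))\<^sup>2"
        using \<theta> by (intro sin_sq_lower) auto
      then have "(\<theta> * real (fst i))\<^sup>2 - (\<theta> * real (fst i)) ^ 4 / 12 \<le> 4 * (sin (\<theta> * real (fst i) / 2))\<^sup>2"
        by (simp add: power_divide)
      then show "((\<theta> * real (fst i))\<^sup>2 - (\<theta> * real (fst i)) ^ 4 / 12) * w (fst i) \<le> y (fst i)"
        unfolding y_def using w0 by (intro mult_right_mono) auto
    qed
    finally have 1: "\<theta>\<^sup>2 * V - \<theta> ^ 4 / 12 * Q \<le> (\<Sum>i\<in>slots m. y (fst i))" .
    \<comment> \<open>The fourth-order correction is at most 1/16 of the main term V \<theta>^2.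
      Together with the loss 4096 / 4097 this leaves 15/16 * 4096/4097 > 2/3.\<close>
    have "\<theta> ^ 4 / 12 * Q \<le> \<theta> ^ 4 / 12 * (1024 / t ^ 5)" using Q by (intro mult_left_mono) auto
    also have "\<dots> = \<theta>\<^sup>2 * \<theta>\<^sup>2 * (1024 / (12 * t ^ 5))" by (simp add: eval_nat_numeral)
    also have "\<dots> \<le> \<theta>\<^sup>2 * (t\<^sup>2 / 4096) * (1024 / (12 * t ^ 5))"
      using \<theta>2 t by (intro mult_right_mono mult_left_mono) auto
    also have "\<dots> = \<theta>\<^sup>2 / 16 * (1 / (3 * t ^ 3))" using t by (simp add: eval_nat_numeral)
    also have "\<dots> \<le> \<theta>\<^sup>2 / 16 * V" using V1 by (intro mult_left_mono) auto
    finally have "15 / 16 * (V * \<theta>\<^sup>2) \<le> (\<Sum>i\<in>slots m. y (fst i))" using 1 by (simp add: mult.commute)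
    moreover have "0 \<le> V * \<theta>\<^sup>2" using V1 t by (intro mult_nonneg_nonneg) (auto intro: order_trans[rotated])
    ultimately show ?thesis by simp
  qed
  also have "\<dots> = (exp (- (V / 3 * \<theta>\<^sup>2)))\<^sup>2" by (simp add: exp_double[symmetric])
  finally show ?thesis unfolding V_def by (rule power2_le_imp_le) simp
qed

lemma cos_lower: "1 - x\<^sup>2 / 2 \<le> cos x" for x :: real
proof -
  have "(sin (x / 2))\<^sup>2 \<le> (x / 2)\<^sup>2"
    using abs_sin_x_le_abs_x[of "x / 2"] by (rule abs_le_square_iff[THEN iffD1])
  moreover have "cos x = 1 - 2 * (sin (x / 2))\<^sup>2" using cos_double_sin[of "x / 2"] by simp
  ultimately show ?thesis by (simp add: power_divide)
qed

text \<open>The integral is split at the zero \<open>r = sqrt (2 / V)\<close> of \<open>1 - \<theta>\<^sup>2 V / 2\<close>, where \<open>V\<close> is the variance, and at \<open>t / 64\<close>. The first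
  piece is at least \<open>2 r / 3\<close>, the second is bounded by a Gaussian tail of size at most \<open>27 r / 68\<close>, and the third is
  exponentially small in \<open>1 / t\<close>.\<close>

lemma boltz_fourier_mean_ge:
  obtains t0 where "0 < t0" "t0 \<le> 1 / 32" and
    "\<And>t m. 0 < t \<Longrightarrow> t \<le> t0 \<Longrightarrow> 1 \<le> t * real m \<Longrightarrow>
       t * sqrt t / 32 \<le> boltz_fourier t (slots m) (boltz_mean t (slots m))"
proof -
  \<comment> \<open>\<open>K * t ^ 3\<close> bounds the piece beyond t / 64: 216 = 4 * 2 * 27, and
    2^30 = 2^18 * 64^2 is the decay constant evaluated at \<theta> = t / 64. \<open>t0\<close> makes
    this at most \<open>t * sqrt t / 32\<close>.\<close>
  define K :: real where "K = 216 * 2 ^ 90"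
  define t0 where "t0 = 1 / (32 * K)"
  show ?thesis
  proof (rule that[of t0])
    show "0 < t0" "t0 \<le> 1 / 32" by (simp_all add: t0_def K_def)
    fix t :: real and m :: nat
    assume t: "0 < t" "t \<le> t0" "1 \<le> t * real m"
    \<comment> \<open>24576 = 6 * 64^2 is what the proof of \<open>r \<le> T\<close> needs, as r^2
      <= 6 t^3 and T = t / 64.\<close>
    have "t0 \<le> 1 / 24576" by (simp add: t0_def K_def)
    then have t': "t \<le> 1 / 32" "t \<le> 1 / 2" "t \<le> 1 / 24576" "t \<le> 1" using t by auto
    note cov = covers_slots[OF t(3,1)]
    define V where "V = boltz_var t (slots m)"
    define \<mu> where "\<mu> = boltz_mean t (slots m)"
    define r where "r = sqrt (2 / V)"
    define T where "T = t / 64"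
    define g where "g \<theta> = Re (boltz_char t (slots m) \<theta> * cis (- (\<theta> * \<mu>)))" for \<theta>
    have V1: "1 / (3 * t ^ 3) \<le> V" unfolding V_def by (rule boltz_var_slots_ge[OF t(1) t'(2) t(3)])
    have V2: "V \<le> 16 / t ^ 3" unfolding V_def by (rule boltz_var_slots_le[OF t(1)])
    have "0 < 1 / (3 * t ^ 3)" using t by simp
    then have V: "0 < V" using V1 by linarith
    have r: "0 < r" "r\<^sup>2 = 2 / V" using V by (auto simp: r_def)
    have rV: "V * r\<^sup>2 = 2" using r V by simp
    have int: "g integrable_on {u..v}" for u v
      unfolding g_def using boltz_fourier_integrable[OF cov t(1)] .
    have g_low: "1 - \<theta>\<^sup>2 * V / 2 \<le> g \<theta>" for \<theta>
    proof -
      note mom = boltz_moments[OF finite_slots t(1) slots_pos, of m]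
      have "measure_pmf.expectation (boltz t (slots m)) (\<lambda>x. 1 - \<theta>\<^sup>2 / 2 * (real (wsum (slots m) x) - \<mu>)\<^sup>2) \<le>
        measure_pmf.expectation (boltz t (slots m)) (\<lambda>x. cos (\<theta> * (real (wsum (slots m) x) - \<mu>)))"
      proof (rule integral_mono)
        show "integrable (measure_pmf (boltz t (slots m))) (\<lambda>x. 1 - \<theta>\<^sup>2 / 2 * (real (wsum (slots m) x) - \<mu>)\<^sup>2)"
          using mom(3) unfolding \<mu>_def by (intro Bochner_Integration.integrable_diff integrable_mult_right) auto
        show "1 - \<theta>\<^sup>2 / 2 * (real (wsum (slots m) x) - \<mu>)\<^sup>2 \<le> cos (\<theta> * (real (wsum (slots m) x) - \<mu>))" for x
          using cos_lower[of "\<theta> * (real (wsum (slots m) x) - \<mu>)"] by (simp add: power_mult_distrib)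
      qed (rule integrable_cos_pmf)
      also have "\<dots> = g \<theta>" unfolding g_def by (rule expectation_cos_boltz[OF finite_slots t(1) slots_pos])
      also have "measure_pmf.expectation (boltz t (slots m)) (\<lambda>x. 1 - \<theta>\<^sup>2 / 2 * (real (wsum (slots m) x) - \<mu>)\<^sup>2) = 1 - \<theta>\<^sup>2 * V / 2"
        using mom(3,4) unfolding \<mu>_def V_def by (subst Bochner_Integration.integral_diff) auto
      finally show ?thesis .
    qed
    have g_abs: "- norm (boltz_char t (slots m) \<theta>) \<le> g \<theta>" for \<theta>
    proof -
      have "\<bar>g \<theta>\<bar> \<le> norm (boltz_char t (slots m) \<theta> * cis (- (\<theta> * \<mu>)))" unfolding g_def by (rule abs_Re_le_cmod)
      then show ?thesis by (simp add: norm_mult)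
    qed
    have rT: "r \<le> T"
    proof -
      have "r\<^sup>2 \<le> 2 / (1 / (3 * t ^ 3))" unfolding r(2) using V1 t V by (intro divide_left_mono) auto
      also have "\<dots> = t\<^sup>2 * (6 * t)" by (simp add: eval_nat_numeral)
      also have "\<dots> \<le> t\<^sup>2 * (1 / 4096)" using t' by (intro mult_left_mono) auto
      also have "\<dots> = T\<^sup>2" by (simp add: T_def power_divide)
      finally have "r\<^sup>2 \<le> T\<^sup>2" .
      then show ?thesis by (rule power2_le_imp_le) (use t in \<open>simp add: T_def\<close>)
    qed
    have rt: "t * sqrt t / 3 \<le> r"
    proof -
      have "(t * sqrt t / 3)\<^sup>2 = t ^ 3 / 9" using t by (simp add: power_divide power_mult_distrib eval_nat_numeral)
      also have "\<dots> \<le> 2 / (16 / t ^ 3)" using t by simp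
      also have "\<dots> \<le> r\<^sup>2" unfolding r(2) using V2 V t by (intro divide_left_mono) auto
      finally have "(t * sqrt t / 3)\<^sup>2 \<le> r\<^sup>2" .
      then show ?thesis by (rule power2_le_imp_le) (use r in simp)
    qed
    have Tpi: "T \<le> pi" using t' pi_ge_two unfolding T_def by simp
    have 1: "r - V * r ^ 3 / 6 \<le> integral {0..r} g"
    proof -
      have h: "((\<lambda>\<theta>. 1 - \<theta>\<^sup>2 * V / 2) has_integral ((r - V * r ^ 3 / 6) - (0 - V * 0 ^ 3 / 6))) {0..r}"
        using r by (intro fundamental_theorem_of_calculus)
          (auto simp flip: has_real_derivative_iff_has_vector_derivative intro!: derivative_eq_intros)
      have "integral {0..r} (\<lambda>\<theta>. 1 - \<theta>\<^sup>2 * V / 2) \<le> integral {0..r} g"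
        using h g_low int by (intro integral_le) auto
      then show ?thesis using integral_unique[OF h] by simp
    qed
    have 2: "- (1 / r * (exp (- (V / 3 * r\<^sup>2)) / (2 * (V / 3)))) \<le> integral {r..T} g"
    proof -
      have h: "((\<lambda>\<theta>. - (1 / r * (\<theta> * exp (- (V / 3 * \<theta>\<^sup>2))))) has_integral
        - (1 / r * ((exp (- (V / 3 * r\<^sup>2)) - exp (- (V / 3 * T\<^sup>2))) / (2 * (V / 3))))) {r..T}"
        using V rT by (intro has_integral_neg has_integral_mult_right has_integral_gauss_moment) auto
      have "integral {r..T} (\<lambda>\<theta>. - (1 / r * (\<theta> * exp (- (V / 3 * \<theta>\<^sup>2))))) \<le> integral {r..T} g"
      proof (rule integral_le)
        fix \<theta> assume \<theta>: "\<theta> \<in> {r..T}"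
        have "norm (boltz_char t (slots m) \<theta>) \<le> 1 * exp (- (V / 3 * \<theta>\<^sup>2))"
          using norm_boltz_char_gauss[OF t(1) t'(2) t(3), of \<theta>] \<theta> r by (simp add: V_def T_def)
        \<comment> \<open>The inserted factor is at least 1 on this range and makes the Gaussian
          tail explicitly integrable.\<close>
        also have "\<dots> \<le> (\<theta> / r) * exp (- (V / 3 * \<theta>\<^sup>2))" using \<theta> r by (intro mult_right_mono) auto
        finally show "- (1 / r * (\<theta> * exp (- (V / 3 * \<theta>\<^sup>2)))) \<le> g \<theta>"
          using g_abs[of \<theta>] by simp
      qed (use h int in auto)
      then have "- (1 / r * ((exp (- (V / 3 * r\<^sup>2)) - exp (- (V / 3 * T\<^sup>2))) / (2 * (V / 3)))) \<le> integral {r..T} g"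
        using integral_unique[OF h] by simp
      moreover have "1 / r * ((exp (- (V / 3 * r\<^sup>2)) - exp (- (V / 3 * T\<^sup>2))) / (2 * (V / 3))) \<le> 1 / r * (exp (- (V / 3 * r\<^sup>2)) / (2 * (V / 3)))"
        using r V by (intro mult_left_mono divide_right_mono) auto
      ultimately show ?thesis by linarith
    qed
    have 3: "- (K * t ^ 3) \<le> integral {T..pi} g"
    proof -
      let ?c = "1 / (2 ^ 30 * t)"
      have h: "((\<lambda>\<theta>. - (2 * exp (- ?c))) has_integral ((pi - T) * (- (2 * exp (- ?c))))) {T..pi}"
        using has_integral_const_real[of "- (2 * exp (- ?c))" T pi] Tpi by simp
      have "integral {T..pi} (\<lambda>\<theta>. - (2 * exp (- ?c))) \<le> integral {T..pi} g"
      proof (rule integral_le)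
        fix \<theta> assume \<theta>: "\<theta> \<in> {T..pi}"
        have \<theta>0: "0 < \<theta>" using \<theta> t by (auto simp: T_def)
        have "norm (boltz_char t (slots m) \<theta>) \<le> exp (- (\<theta>\<^sup>2 / (262144 * t ^ 3))) + exp (- (1 / (262144 * t)))"
          using \<theta> \<theta>0 by (intro boltz_char_decay[OF cov t(1) t'(1)]) auto
        also have "\<dots> \<le> exp (- ?c) + exp (- ?c)"
        proof (intro add_mono)
          have "T\<^sup>2 \<le> \<theta>\<^sup>2" using \<theta> t by (intro power_mono) (auto simp: T_def)
          then have "T\<^sup>2 / (262144 * t ^ 3) \<le> \<theta>\<^sup>2 / (262144 * t ^ 3)" using t by (intro divide_right_mono) auto
          moreover have "T\<^sup>2 / (262144 * t ^ 3) = ?c" using t by (simp add: T_def power_divide eval_nat_numeral)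
          ultimately show "exp (- (\<theta>\<^sup>2 / (262144 * t ^ 3))) \<le> exp (- ?c)" by simp
          have "?c \<le> 1 / (262144 * t)" using t by (intro divide_left_mono) auto
          then show "exp (- (1 / (262144 * t))) \<le> exp (- ?c)" by simp
        qed
        finally show "- (2 * exp (- ?c)) \<le> g \<theta>" using g_abs[of \<theta>] by simp
      qed (use h int in auto)
      then have "(pi - T) * (- (2 * exp (- ?c))) \<le> integral {T..pi} g" by (simp only: integral_unique[OF h])
      moreover have "(pi - T) * (2 * exp (- ?c)) \<le> 4 * (2 * (27 / ?c ^ 3))"
        using pi_less_4 Tpi t exp_neg_le_cube[of ?c] by (intro mult_mono mult_left_mono) (auto simp: T_def)
      moreover have "4 * (2 * (27 / ?c ^ 3)) = K * t ^ 3" by (simp add: K_def power_mult_distrib power_divide)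
      ultimately show ?thesis by simp
    qed
    have "integral {0..pi} g = integral {0..r} g + (integral {r..T} g + integral {T..pi} g)"
      using r rT Tpi int by (simp add: Henstock_Kurzweil_Integration.integral_combine)
    then have J: "boltz_fourier t (slots m) \<mu> = integral {0..r} g + (integral {r..T} g + integral {T..pi} g)"
      unfolding boltz_fourier_def g_def by simp
    have "V * r ^ 3 / 6 = (V * r\<^sup>2) * r / 6" by (simp add: eval_nat_numeral)
    then have a: "V * r ^ 3 / 6 = r / 3" unfolding rV by simp
    \<comment> \<open>As V r^2 = 2, the exponential is exp (- 2/3) <= 9/17, the second-order Taylor
      polynomial of exp at 2/3 being 17/9.\<close>
    have b: "1 / r * (exp (- (V / 3 * r\<^sup>2)) / (2 * (V / 3))) \<le> r * (27 / 68)"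
    proof -
      have "1 / (r * V) = r / 2" using rV r V by (simp add: field_simps power2_eq_square)
      moreover have "1 / r * (y / (2 * (V / 3))) = 3 / 2 * y * (1 / (r * V))" for y by simp
      ultimately have "1 / r * (exp (- (V / 3 * r\<^sup>2)) / (2 * (V / 3))) = 3 / 2 * exp (- (V / 3 * r\<^sup>2)) * (r / 2)"
        by presburger
      moreover have "exp (- (V / 3 * r\<^sup>2)) \<le> 9 / 17"
      proof -
        have "1 + 2 / 3 + (2 / 3)\<^sup>2 / 2 \<le> exp (2 / 3 :: real)" by (intro exp_lower_Taylor_quadratic) auto
        then have "17 / 9 \<le> exp (2 / 3 :: real)" by (simp add: power_divide)
        then have "exp (- (2 / 3)) \<le> (9 / 17 :: real)" by (simp add: exp_minus field_simps)
        moreover have "V / 3 * r\<^sup>2 = 2 / 3" using rV by simp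
        ultimately show ?thesis by (simp only:)
      qed
      then have "3 / 2 * exp (- (V / 3 * r\<^sup>2)) * (r / 2) \<le> 3 / 2 * (9 / 17) * (r / 2)"
        using r by (intro mult_right_mono mult_left_mono) auto
      ultimately show ?thesis by linarith
    qed
    have c: "K * t ^ 3 \<le> t * sqrt t / 32"
    proof -
      have "t * sqrt t \<le> t * 1" using t t' by (intro mult_left_mono) auto
      then have "t * sqrt t \<le> t0" using t by linarith
      then have "K * (t * sqrt t) \<le> K * t0" by (intro mult_left_mono) (auto simp: K_def)
      also have "\<dots> = 1 / 32" by (simp add: t0_def K_def)
      finally have "K * (t * sqrt t) * (t * sqrt t) \<le> 1 / 32 * (t * sqrt t)" using t by (intro mult_right_mono) auto
      moreover have "K * (t * sqrt t) * (t * sqrt t) = K * t ^ 3" using t by (simp add: eval_nat_numeral)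
      ultimately show ?thesis by simp
    qed
    have "0 \<le> t * sqrt t" using t by simp
    \<comment> \<open>The central piece is 2 r / 3, and 2/3 - 27/68 > 1/4. With r >= t sqrt t / 3
      this exceeds twice the claimed bound, which leaves room for the remainder
      \<open>K * t ^ 3\<close>.\<close>
    then have "t * sqrt t / 32 \<le> r / 4 - K * t ^ 3" using rt c by linarith
    also have "\<dots> \<le> boltz_fourier t (slots m) \<mu>" using J 1 2 3 a b r by linarith
    finally show "t * sqrt t / 32 \<le> boltz_fourier t (slots m) (boltz_mean t (slots m))" unfolding \<mu>_def .
  qed
qed

text \<open>The bound at the mean is moved to an integer target by the Lipschitz estimate. It is
  useful as long as the target is within o(t^(-3/2)) of the mean. Dividing by pi < 4 turns 32 into
  128.\<close>

lemma boltz_prob_ge: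
  obtains M t0 where "0 < M" "0 < t0" and
    "\<And>t m w. 0 < t \<Longrightarrow> t \<le> t0 \<Longrightarrow> 1 \<le> t * real m \<Longrightarrow>
       t * sqrt t / 128 - M * t ^ 3 * \<bar>of_int w - boltz_mean t (slots m)\<bar> \<le> boltz_prob t (slots m) w"
proof -
  obtain M where M: "0 < M" and
    le: "\<And>t I \<mu> \<nu>. covers t I \<Longrightarrow> 0 < t \<Longrightarrow> t \<le> 1 / 32 \<Longrightarrow>
       \<bar>boltz_fourier t I \<mu> - boltz_fourier t I \<nu>\<bar> \<le> M * t ^ 3 * \<bar>\<mu> - \<nu>\<bar>"
    using boltz_fourier_lipschitz by blast
  obtain t0 where t0: "0 < t0" "t0 \<le> 1 / 32" and
    ge: "\<And>t m. 0 < t \<Longrightarrow> t \<le> t0 \<Longrightarrow> 1 \<le> t * real m \<Longrightarrow>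
       t * sqrt t / 32 \<le> boltz_fourier t (slots m) (boltz_mean t (slots m))"
    using boltz_fourier_mean_ge by blast
  show ?thesis
  proof (rule that[of "M / 4" t0])
    fix t :: real and m :: nat and w :: int
    assume t: "0 < t" "t \<le> t0" "1 \<le> t * real m"
    define b where "b = t * sqrt t / 32 - M * t ^ 3 * \<bar>of_int w - boltz_mean t (slots m)\<bar>"
    have "b \<le> boltz_fourier t (slots m) (of_int w)"
      using ge[OF t] le[OF covers_slots[OF t(3,1)] t(1), of "of_int w" "boltz_mean t (slots m)"] t(2) t0
      unfolding b_def by linarith
    also have "\<dots> = pi * boltz_prob t (slots m) w"
      using boltz_prob_fourier[OF covers_slots[OF t(3,1)] t(1)] by simp
    also have "\<dots> \<le> 4 * boltz_prob t (slots m) w"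
      using pi_less_4 by (intro mult_right_mono) (auto simp: boltz_prob_def)
    finally show "t * sqrt t / 128 - M / 4 * t ^ 3 * \<bar>of_int w - boltz_mean t (slots m)\<bar> \<le> boltz_prob t (slots m) w"
      unfolding b_def by simp
  qed (use M t0 in auto)
qed

section \<open>The mean size\<close>

text \<open>In exp y + exp (- y) the odd Taylor terms cancel, and the two fourth-order remainders
  are at most 3 y^4 / 24 each, as e <= 3.\<close>

lemma cosh_upper:
  fixes y :: real assumes "0 < y" "y \<le> 1"
  shows "exp y + exp (- y) - 2 \<le> y\<^sup>2 * (1 + y\<^sup>2 / 4)"
proof -
  have E: "exp s \<le> 3" if "\<bar>s\<bar> \<le> \<bar>y\<bar>" for s
  proof -
    have "exp s \<le> exp 1" using that assms by auto
    then show ?thesis using exp_le by linarith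
  qed
  obtain s where s: "\<bar>s\<bar> \<le> \<bar>y\<bar>" "exp y = (\<Sum>m<4. y ^ m / fact m) + exp s / fact 4 * y ^ 4"
    using Maclaurin_exp_le[of y 4] by blast
  obtain s' where s': "\<bar>s'\<bar> \<le> \<bar>- y\<bar>" "exp (- y) = (\<Sum>m<4. (- y) ^ m / fact m) + exp s' / fact 4 * (- y) ^ 4"
    using Maclaurin_exp_le[of "- y" 4] by blast
  have f4: "fact 4 = (24 :: real)" by (simp add: fact_numeral)
  have 1: "(\<Sum>m<4. y ^ m / fact m) + (\<Sum>m<4. (- y) ^ m / fact m) = 2 + y\<^sup>2"
    by (simp add: eval_nat_numeral fact_numeral)
  have "exp s / 24 * y ^ 4 \<le> 3 / 24 * y ^ 4" "exp s' / 24 * y ^ 4 \<le> 3 / 24 * y ^ 4"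
    using E[OF s(1)] E[of s'] s'(1) by (intro mult_right_mono divide_right_mono; simp)+
  moreover have "exp y + exp (- y) - 2 = y\<^sup>2 + exp s / 24 * y ^ 4 + exp s' / 24 * y ^ 4"
  proof -
    have e: "(- y) ^ 4 = y ^ 4" by simp
    show ?thesis using s(2) s'(2) 1 unfolding f4 e by linarith
  qed
  ultimately have "exp y + exp (- y) - 2 \<le> y\<^sup>2 + y ^ 4 / 4" by simp
  also have "\<dots> = y\<^sup>2 * (1 + y\<^sup>2 / 4)" by (simp add: eval_nat_numeral algebra_simps)
  finally show ?thesis .
qed

text \<open>The quotient equals 1 / (exp y + exp (- y) - 2). The error against 1 / y^2 is bounded
  uniformly, so summing over about 1 / t terms loses only O(1 / t).\<close>

lemma exp_over_square_ge_minus: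
  fixes y :: real assumes "0 < y" "y \<le> 1"
  shows "1 / y\<^sup>2 - 1 / 4 \<le> exp (- y) / (1 - exp (- y))\<^sup>2"
proof -
  have e: "exp (- y) / (1 - exp (- y))\<^sup>2 = 1 / (exp y + exp (- y) - 2)"
  proof -
    have "exp y * (1 - exp (- y))\<^sup>2 = exp y + exp (- y) - 2"
      by (simp add: power2_diff exp_minus field_simps power2_eq_square)
    then have "1 / (exp y + exp (- y) - 2) = 1 / (exp y * (1 - exp (- y))\<^sup>2)" by simp
    then show ?thesis by (simp add: exp_minus field_simps)
  qed
  have pos: "0 < exp y + exp (- y) - 2"
  proof -
    have "0 < exp y * (1 - exp (- y))\<^sup>2" using assms by simp
    also have "\<dots> = exp y + exp (- y) - 2" by (simp add: power2_diff exp_minus field_simps power2_eq_square)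
    finally show ?thesis .
  qed
  have "1 / y\<^sup>2 - 1 / 4 = (1 - y\<^sup>2 / 4) / y\<^sup>2" using assms by (simp add: diff_divide_distrib)
  also have "\<dots> \<le> (1 / (1 + y\<^sup>2 / 4)) / y\<^sup>2"
  proof (rule divide_right_mono)
    have "(1 - y\<^sup>2 / 4) * (1 + y\<^sup>2 / 4) \<le> 1" by (simp add: algebra_simps)
    then show "1 - y\<^sup>2 / 4 \<le> 1 / (1 + y\<^sup>2 / 4)" by (subst pos_le_divide_eq) (auto intro: add_pos_nonneg)
  qed simp
  also have "\<dots> = 1 / (y\<^sup>2 * (1 + y\<^sup>2 / 4))" by simp
  also have "\<dots> \<le> 1 / (exp y + exp (- y) - 2)"
    using cosh_upper[OF assms] pos by (intro divide_left_mono) (auto intro!: mult_pos_pos add_pos_nonneg)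
  finally show ?thesis unfolding e .
qed

text \<open>The tail of the Basel series is dominated by the telescoping series with terms 1 / (N (N
  + 1)).\<close>

lemma inverse_squares_partial:
  assumes "0 < J"
  shows "pi\<^sup>2 / 6 - 1 / real J \<le> (\<Sum>j<J. 1 / (real (Suc j))\<^sup>2)"
proof -
  have "(\<Sum>j<J + d. 1 / (real (Suc j))\<^sup>2) \<le> (\<Sum>j<J. 1 / (real (Suc j))\<^sup>2) + 1 / real J - 1 / real (J + d)" for d
  proof (induction d)
    case (Suc d)
    have "1 / (real (Suc (J + d)))\<^sup>2 \<le> 1 / (real (J + d) * real (Suc (J + d)))"
      using assms unfolding power2_eq_square by (intro divide_left_mono mult_right_mono mult_pos_pos) auto
    also have "\<dots> = 1 / real (J + d) - 1 / real (J + Suc d)"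
      using assms by (simp add: divide_simps)
    finally show ?case using Suc by simp
  qed simp
  then have le: "(\<Sum>j<J + d. 1 / (real (Suc j))\<^sup>2) \<le> (\<Sum>j<J. 1 / (real (Suc j))\<^sup>2) + 1 / real J" for d
    by (smt (verit) divide_nonneg_nonneg of_nat_0_le_iff zero_le_one)
  have "(\<lambda>n. \<Sum>j<n. 1 / (real (Suc j))\<^sup>2) \<longlonglongrightarrow> pi\<^sup>2 / 6"
    using inverse_squares_sums by (simp add: sums_def add.commute)
  then have "(\<lambda>d. \<Sum>j<d + J. 1 / (real (Suc j))\<^sup>2) \<longlonglongrightarrow> pi\<^sup>2 / 6" by (rule LIMSEQ_ignore_initial_segment)
  then have "pi\<^sup>2 / 6 \<le> (\<Sum>j<J. 1 / (real (Suc j))\<^sup>2) + 1 / real J"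
    by (rule LIMSEQ_le_const2) (use le in \<open>auto simp: add.commute\<close>)
  then show ?thesis by simp
qed

lemma boltz_mean_slots:
  "boltz_mean t (slots m) =
     2 * (\<Sum>k = 1..m. real k * (exp (- (t * real k)) / (1 - exp (- (t * real k)))))"
  unfolding boltz_mean_def
  using sum_slots[of "\<lambda>k. real k * (exp (- (t * real k)) / (1 - exp (- (t * real k))))"] .

text \<open>With \<open>x = exp (- t)\<close>, interchanging the sums turns \<open>\<Sum>k. k x\<^sup>k / (1 - x\<^sup>k)\<close> into \<open>\<Sum>j. x\<^sup>j / (1 - x\<^sup>j)\<^sup>2\<close>, whose terms
  are close to \<open>1 / (t j)\<^sup>2\<close>; the main term \<open>\<pi>\<^sup>2 / (3 t\<^sup>2)\<close> is then the Basel sum.\<close>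

lemma boltz_mean_series:
  assumes "0 < t"
  shows "(\<lambda>j. \<Sum>k = 1..m. real k * exp (- (t * real (Suc j))) ^ k) sums
    (\<Sum>k = 1..m. real k * (exp (- (t * real k)) / (1 - exp (- (t * real k)))))"
proof (rule sums_sum)
  fix k assume k: "k \<in> {1..m}"
  have "(\<lambda>j. real k * (exp (- (t * real k)) * exp (- (t * real k)) ^ j)) sums
    (real k * (exp (- (t * real k)) * (1 / (1 - exp (- (t * real k))))))"
    using k assms by (intro sums_mult geometric_sums) auto
  moreover have "exp (- (t * real k)) * exp (- (t * real k)) ^ j = exp (- (t * real (Suc j))) ^ k" for j
    by (simp add: exp_of_nat_mult[symmetric] mult_exp_exp algebra_simps)
  ultimately show "(\<lambda>j. real k * exp (- (t * real (Suc j))) ^ k) sums (real k * (exp (- (t * real k)) / (1 - exp (- (t * real k)))))"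
    by simp
qed

text \<open>In the interchanged double series, each inner sum over k is extended to infinity and
  bounded by 1 / (t j)^2.\<close>

lemma boltz_mean_slots_le:
  assumes "0 < t"
  shows "boltz_mean t (slots m) \<le> pi\<^sup>2 / (3 * t\<^sup>2)"
proof -
  have sq: "(\<lambda>j. 1 / t\<^sup>2 * (1 / (real (Suc j))\<^sup>2)) sums (1 / t\<^sup>2 * (pi\<^sup>2 / 6))"
    using inverse_squares_sums by (intro sums_mult) (simp add: add.commute)
  have le: "(\<Sum>k = 1..m. real k * exp (- (t * real (Suc j))) ^ k) \<le> 1 / t\<^sup>2 * (1 / (real (Suc j))\<^sup>2)" for j
  proof -
    let ?x = "exp (- (t * real (Suc j)))"
    have "(\<lambda>k. ?x ^ k * real k) sums (?x / (1 - ?x)\<^sup>2)"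
      using geometric_sums_times_n[of ?x] assms by simp
    then have "(\<Sum>k = 1..m. ?x ^ k * real k) \<le> ?x / (1 - ?x)\<^sup>2"
      using sum_le_suminf[of "\<lambda>k. ?x ^ k * real k" "{1..m}"] by (auto simp: sums_iff)
    also have "\<dots> \<le> 1 / (t * real (Suc j))\<^sup>2" using assms by (intro exp_over_square_le1) auto
    finally show ?thesis by (simp add: power_mult_distrib mult.commute)
  qed
  have "(\<Sum>k = 1..m. real k * (exp (- (t * real k)) / (1 - exp (- (t * real k))))) \<le> 1 / t\<^sup>2 * (pi\<^sup>2 / 6)"
    by (rule sums_le[OF le boltz_mean_series[OF assms] sq])
  then show ?thesis unfolding boltz_mean_slots by simp
qed

text \<open>The rate 3/4 comes from the denominator estimate 1 - exp (- x) >= (x / 2) exp (- x / 4),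
  which gives up a quarter of the decay.\<close>

lemma boltz_mean_tail:
  assumes "0 < t" "m \<le> m'"
  shows "(\<Sum>k = 1..m'. real k * (exp (- (t * real k)) / (1 - exp (- (t * real k))))) \<le>
    (\<Sum>k = 1..m. real k * (exp (- (t * real k)) / (1 - exp (- (t * real k))))) + 3 / t\<^sup>2 * exp (- (3 / 4 * (t * real m)))"
proof -
  let ?f = "\<lambda>k. real k * (exp (- (t * real k)) / (1 - exp (- (t * real k))))"
  have f: "?f k \<le> 2 / t * exp (- (3 / 4 * t * real k))" if k: "0 < k" for k
  proof -
    define x where "x = t * real k"
    have x: "0 < x" using k assms by (simp add: x_def)
    have "(x / 2) * exp (- x / 4) \<le> 1 - exp (- x / 2)"
      using one_minus_exp_ge[of "x / 2"] x by simp
    also have "\<dots> \<le> 1 - exp (- x)" using x by simp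
    finally have "(x / 2) * exp (- x / 4) \<le> 1 - exp (- x)" .
    then have "exp (- x) / (1 - exp (- x)) \<le> exp (- x) / ((x / 2) * exp (- x / 4))"
      using x by (intro divide_left_mono) auto
    also have "\<dots> = 2 / x * exp (- (3 / 4 * x))"
      using x by (simp add: exp_minus field_simps mult_exp_exp)
    finally have "real k * (exp (- x) / (1 - exp (- x))) \<le> real k * (2 / x * exp (- (3 / 4 * x)))"
      by (intro mult_left_mono) auto
    then show ?thesis using k by (simp add: x_def mult.assoc)
  qed
  have "(\<Sum>k = 1..m'. ?f k) = (\<Sum>k = 1..m. ?f k) + (\<Sum>k = m + 1..m'. ?f k)"
    using assms sum.ub_add_nat[of 1 m ?f "m' - m"] by simp
  also have "(\<Sum>k = m + 1..m'. ?f k) \<le> (\<Sum>k = m + 1..m'. 2 / t * exp (- (3 / 4 * t * real k)))"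
    using f by (intro sum_mono) auto
  also have "\<dots> = 2 / t * (\<Sum>k = m + 1..m'. exp (- (3 / 4 * t * real k)))"
    by (rule sum_distrib_left[symmetric])
  also have "(\<Sum>k = m + 1..m'. exp (- (3 / 4 * t * real k))) = (\<Sum>k = 1..m' - m. exp (- (3 / 4 * t * real m)) * exp (- (3 / 4 * t * real k)))"
    by (rule sum.reindex_bij_witness[of _ "\<lambda>k. k + m" "\<lambda>k. k - m"])
       (auto simp: mult_exp_exp algebra_simps of_nat_diff)
  also have "\<dots> = exp (- (3 / 4 * t * real m)) * (\<Sum>k = 1..m' - m. exp (- (3 / 4 * t * real k)))"
    by (rule sum_distrib_left[symmetric])
  also have "2 / t * \<dots> \<le> 2 / t * (exp (- (3 / 4 * t * real m)) * (1 / (3 / 4 * t)))"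
    using assms by (intro mult_left_mono sum_exp_neg_le) auto
  also have "\<dots> \<le> 3 / t\<^sup>2 * exp (- (3 / 4 * (t * real m)))"
    using assms by (simp add: power2_eq_square field_simps)
  finally show ?thesis by simp
qed

text \<open>Only the terms with t j <= 1 of the double series are kept. Counting both sides, the
  tail of the Basel sum costs 4 / t, the errors 1/4 cost 1 / (2 t), and the missing parts k > m cost
  the exponential term.\<close>

lemma boltz_mean_slots_ge:
  assumes t: "0 < t" "t \<le> 1 / 2"
  shows "pi\<^sup>2 / (3 * t\<^sup>2) - 5 / t - 6 / t\<^sup>2 * exp (- (3 / 4 * (t * real m))) \<le> boltz_mean t (slots m)"
proof -
  define J where "J = nat \<lfloor>1 / t\<rfloor>"
  have J: "real J \<le> 1 / t" "1 / t < real J + 1" using t unfolding J_def by (auto simp: of_nat_nat)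
  have "2 \<le> 1 / t" using t by (simp add: field_simps)
  then have J2: "1 / t * (1 / 2) \<le> real J"
  proof -
    have "a * (1 / 2) \<le> b" if "2 \<le> a" "a < b + 1" for a b :: real using that by simp
    then show ?thesis using J \<open>2 \<le> 1 / t\<close> by blast
  qed
  then have J0: "0 < J" using t by (cases J) auto
  let ?f = "\<lambda>k. real k * (exp (- (t * real k)) / (1 - exp (- (t * real k))))"
  let ?x = "\<lambda>j. exp (- (t * real (Suc j)))"
  let ?R = "(\<Sum>k = 1..m. ?f k) + 3 / t\<^sup>2 * exp (- (3 / 4 * (t * real m)))"
  \<comment> \<open>A common cut-off N is sent to infinity because the closed form belongs to the
    full sum over k, while the comparison with the parts up to \<open>m\<close> is made for finite
    sums.\<close>
  have "(\<lambda>N. \<Sum>k = 1..N. ?x j ^ k * real k) \<longlonglongrightarrow> ?x j / (1 - ?x j)\<^sup>2" for j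
  proof -
    have "(\<lambda>k. ?x j ^ k * real k) sums (?x j / (1 - ?x j)\<^sup>2)"
      using geometric_sums_times_n[of "?x j"] t by simp
    then have "(\<lambda>N. \<Sum>k\<le>N. ?x j ^ k * real k) \<longlonglongrightarrow> ?x j / (1 - ?x j)\<^sup>2" by (simp add: sums_def_le)
    moreover have "(\<Sum>k\<le>N. ?x j ^ k * real k) = (\<Sum>k = 1..N. ?x j ^ k * real k)" for N
      by (rule sum.mono_neutral_right) auto
    ultimately show ?thesis by simp
  qed
  then have lim: "(\<lambda>N. \<Sum>j<J. \<Sum>k = 1..N. ?x j ^ k * real k) \<longlonglongrightarrow> (\<Sum>j<J. ?x j / (1 - ?x j)\<^sup>2)"
    by (intro tendsto_sum)
  have "(\<Sum>j<J. \<Sum>k = 1..N. ?x j ^ k * real k) \<le> ?R" if "m \<le> N" for N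
  proof -
    have "(\<Sum>j<J. \<Sum>k = 1..N. ?x j ^ k * real k) \<le> (\<Sum>k = 1..N. ?f k)"
      using boltz_mean_series[OF t(1), of N]
        sum_le_suminf[of "\<lambda>j. \<Sum>k = 1..N. real k * ?x j ^ k" "{..<J}"]
      by (auto simp: sums_iff mult.commute sum_nonneg)
    also have "\<dots> \<le> ?R" by (rule boltz_mean_tail[OF t(1) that])
    finally show ?thesis .
  qed
  then have "(\<Sum>j<J. ?x j / (1 - ?x j)\<^sup>2) \<le> ?R"
    by (intro LIMSEQ_le_const2[OF lim]) auto
  moreover have "(\<Sum>j<J. 1 / t\<^sup>2 * (1 / (real (Suc j))\<^sup>2) - 1 / 4) \<le> (\<Sum>j<J. ?x j / (1 - ?x j)\<^sup>2)"
  proof (rule sum_mono)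
    fix j assume "j \<in> {..<J}"
    then have "real (Suc j) \<le> 1 / t" using J by auto
    then have "t * real (Suc j) \<le> 1" using t by (simp add: field_simps)
    then have "1 / (t * real (Suc j))\<^sup>2 - 1 / 4 \<le> ?x j / (1 - ?x j)\<^sup>2"
      using t by (intro exp_over_square_ge_minus) auto
    then show "1 / t\<^sup>2 * (1 / (real (Suc j))\<^sup>2) - 1 / 4 \<le> ?x j / (1 - ?x j)\<^sup>2"
      by (simp only: power_mult_distrib) simp
  qed
  moreover have "(\<Sum>j<J. 1 / t\<^sup>2 * (1 / (real (Suc j))\<^sup>2) - 1 / 4) = 1 / t\<^sup>2 * (\<Sum>j<J. 1 / (real (Suc j))\<^sup>2) - real J / 4"
    by (simp add: sum_subtractf sum_distrib_left)
  moreover have "1 / t\<^sup>2 * (pi\<^sup>2 / 6 - 1 / real J) \<le> 1 / t\<^sup>2 * (\<Sum>j<J. 1 / (real (Suc j))\<^sup>2)"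
    by (intro mult_left_mono inverse_squares_partial J0) auto
  moreover have "1 / t\<^sup>2 * (1 / real J) \<le> 2 / t"
  proof -
    have "1 / real J \<le> 1 / (1 / t * (1 / 2))" using J2 t J0 by (intro divide_left_mono) auto
    then have "1 / t\<^sup>2 * (1 / real J) \<le> 1 / t\<^sup>2 * (2 * t)" by (intro mult_left_mono) auto
    then show ?thesis using t by (simp add: power2_eq_square)
  qed
  moreover have "1 / t\<^sup>2 * (pi\<^sup>2 / 6 - 1 / real J) = pi\<^sup>2 / (3 * t\<^sup>2) / 2 - 1 / t\<^sup>2 * (1 / real J)"
    by (simp add: right_diff_distrib)
  ultimately show ?thesis unfolding boltz_mean_slots using J(1) by simp
qed

section \<open>Unimodal sequences with a fixed peak\<close>

definition mults :: "unimodal_seq \<Rightarrow> nat \<times> side \<Rightarrow> nat" where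
  "mults l i = part_mult (snd i) (fst i) l"

text \<open>The size condition is stated over the integers, so the set is empty if \<open>m > n\<close>.\<close>

definition mult_funs :: "nat \<Rightarrow> nat \<Rightarrow> (nat \<times> side \<Rightarrow> nat) set" where
  "mult_funs n m = {x. (\<forall>i. i \<notin> slots m \<longrightarrow> x i = 0) \<and> int (wsum (slots m) x) = int n - int m}"

definition peak_seqs :: "nat \<Rightarrow> nat \<Rightarrow> unimodal_seq set" where
  "peak_seqs n m = {l \<in> unimodal_seqs n. peak l = m}"

lemma side_cases: "(\<forall>j. P j) \<longleftrightarrow> P Lft \<and> P Rgt"
  by (metis side.exhaust)

lemma peak_seqs_altdef:
  "peak_seqs n m = {l. peak l = m \<and> 0 < m \<and> sorted (left_parts l) \<and> sorted (rev (right_parts l)) \<and>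
     (\<forall>j. set (side_parts j l) \<subseteq> {1..m}) \<and>
     m + sum_list (left_parts l) + sum_list (right_parts l) = n}"
proof (intro set_eqI)
  fix l
  have "sorted_wrt (\<ge>) (right_parts l) \<longleftrightarrow> sorted (rev (right_parts l))"
    by (simp add: sorted_wrt_rev)
  then show "l \<in> peak_seqs n m \<longleftrightarrow> l \<in> {l. peak l = m \<and> 0 < m \<and> sorted (left_parts l) \<and> sorted (rev (right_parts l)) \<and>
     (\<forall>j. set (side_parts j l) \<subseteq> {1..m}) \<and>
     m + sum_list (left_parts l) + sum_list (right_parts l) = n}"
    unfolding peak_seqs_def unimodal_seqs_def is_unimodal_def unimodal_size_def side_cases
    by (auto simp: sorted_wrt_append subset_iff Suc_le_eq)
qed

lemma sum_list_eq_sum_count: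
  assumes "set xs \<subseteq> {1..m}"
  shows "sum_list xs = (\<Sum>k = 1..m. k * count_list xs k)"
  using sum_list_map_eq_sum_count2[of xs "{1..m}" "\<lambda>x. x"] assms by (simp add: mult.commute)

lemma wsum_slots: "wsum (slots m) x = (\<Sum>k = 1..m. k * x (k, Lft)) + (\<Sum>k = 1..m. k * x (k, Rgt))"
proof -
  have "wsum (slots m) x = (\<Sum>k = 1..m. \<Sum>j\<in>{Lft, Rgt}. k * x (k, j))"
    unfolding wsum_def slots_def by (subst sum.cartesian_product) (simp add: case_prod_unfold)
  then show ?thesis by (simp add: sum.distrib)
qed

text \<open>Each side is sorted, hence determined by its multiset of parts, and every choice of
  multiplicities of parts in 1..m can be realised by sorting.\<close>

lemma bij_betw_mults: "0 < m \<Longrightarrow> bij_betw mults (peak_seqs n m) (mult_funs n m)"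
proof (rule bij_betw_imageI)
  show "inj_on mults (peak_seqs n m)"
  proof (rule inj_onI)
    fix l l' assume l: "l \<in> peak_seqs n m" "l' \<in> peak_seqs n m" and eq: "mults l = mults l'"
    have c: "count_list (side_parts j l) k = count_list (side_parts j l') k" for j k
      using fun_cong[OF eq, of "(k, j)"] by (simp add: mults_def part_mult_def)
    have m: "mset (left_parts l) = mset (left_parts l')" "mset (right_parts l) = mset (right_parts l')"
      using c[of Lft] c[of Rgt] by (auto simp: multiset_eq_iff count_mset)
    have s: "sorted (left_parts l)" "sorted (left_parts l')" "sorted (rev (right_parts l))" "sorted (rev (right_parts l'))"
      using l by (simp_all add: peak_seqs_altdef)
    have "left_parts l = left_parts l'"
      using properties_for_sort[OF m(1) s(1)] s(2) by (simp add: sorted_sort_id)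
    moreover have "rev (right_parts l) = rev (right_parts l')"
      using properties_for_sort[of "rev (right_parts l)" "rev (right_parts l')"] m(2) s(3,4) by (simp add: sorted_sort_id)
    then have "right_parts l = right_parts l'" by simp
    moreover have "peak l = peak l'" using l by (auto simp: peak_seqs_def)
    ultimately show "l = l'" by (cases l; cases l') simp
  qed
  assume m: "0 < m"
  show "mults ` peak_seqs n m = mult_funs n m"
  proof (intro equalityI subsetI)
    fix x assume "x \<in> mults ` peak_seqs n m"
    then obtain l where l: "l \<in> peak_seqs n m" "x = mults l" by auto
    have s: "set (side_parts j l) \<subseteq> {1..m}" for j using l(1) unfolding peak_seqs_altdef by blast
    have "mults l i = 0" if "i \<notin> slots m" for i
    proof -
      obtain k j where i: "i = (k, j)" by (cases i)
      have "k \<notin> {1..m}" using that i by (cases j) (auto simp: slots_def)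
      then have "k \<notin> set (side_parts j l)" using s by blast
      then show ?thesis by (simp add: mults_def part_mult_def i)
    qed
    moreover have "wsum (slots m) (mults l) = sum_list (left_parts l) + sum_list (right_parts l)"
      using sum_list_eq_sum_count[OF s[of Lft]] sum_list_eq_sum_count[OF s[of Rgt]]
      by (simp add: wsum_slots mults_def part_mult_def)
    moreover have "m + sum_list (left_parts l) + sum_list (right_parts l) = n"
      using l(1) unfolding peak_seqs_altdef by blast
    ultimately show "x \<in> mult_funs n m" unfolding mult_funs_def l(2) by auto
  next
    fix x assume x: "x \<in> mult_funs n m"
    define M where "M j = Abs_multiset (\<lambda>k. x (k, j))" for j
    have fin1: "{k. 0 < x (k, j)} \<subseteq> {1..m}" for j
    proof
      fix k assume "k \<in> {k. 0 < x (k, j)}"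
      then have "x (k, j) \<noteq> 0" by simp
      moreover have "\<forall>i. i \<notin> slots m \<longrightarrow> x i = 0" 
        using x[unfolded mult_funs_def mem_Collect_eq] by (rule conjunct1)
      ultimately have "(k, j) \<in> slots m" by meson
      then show "k \<in> {1..m}" by (auto simp: slots_def)
    qed
    have fin2: "finite {k. 0 < x (k, j)}" for j by (rule finite_subset[OF fin1]) simp
    have cM: "count (M j) k = x (k, j)" for j k unfolding M_def by (simp add: count_Abs_multiset[OF fin2])
    have sM: "set_mset (M j) \<subseteq> {1..m}" for j
    proof
      fix k assume "k \<in># M j"
      then have "0 < x (k, j)" using cM[of j k] by (metis count_greater_zero_iff)
      then show "k \<in> {1..m}" using fin1 by blast
    qed
    define l where "l = Unimodal_Seq (sorted_list_of_multiset (M Lft)) m (rev (sorted_list_of_multiset (M Rgt)))"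
    have set: "set (side_parts j l) \<subseteq> {1..m}" for j using sM by (cases j) (auto simp: l_def)
    have cl: "count_list (side_parts j l) k = x (k, j)" for j k
      by (cases j) (simp_all add: l_def cM count_mset[symmetric])
    have mx: "mults l = x" by (rule ext) (simp add: mults_def part_mult_def cl)
    have "wsum (slots m) x = sum_list (left_parts l) + sum_list (right_parts l)"
      using sum_list_eq_sum_count[OF set[of Lft]] sum_list_eq_sum_count[OF set[of Rgt]] cl[of Lft] cl[of Rgt]
      by (simp add: wsum_slots)
    moreover have "int (wsum (slots m) x) = int n - int m" using x by (simp add: mult_funs_def)
    ultimately have "m + sum_list (left_parts l) + sum_list (right_parts l) = n" by linarith
    then have "l \<in> peak_seqs n m" unfolding peak_seqs_altdef using m set by (simp add: l_def)
    then show "x \<in> mults ` peak_seqs n m" using mx by blast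
  qed
qed

lemma finite_mult_funs: "finite (mult_funs n m)"
proof (rule finite_subset)
  show "mult_funs n m \<subseteq> PiE_dflt (slots m) 0 (\<lambda>_. {..n})"
  proof
    fix x assume x: "x \<in> mult_funs n m"
    have "x i \<le> n" if i: "i \<in> slots m" for i
    proof -
      have "x i \<le> fst i * x i" using slots_pos[OF i] by simp
      also have "\<dots> \<le> wsum (slots m) x" unfolding wsum_def using i
        by (intro member_le_sum[where f = "\<lambda>i. fst i * x i"]) auto
      also have "\<dots> \<le> n" using x by (simp add: mult_funs_def)
      finally show ?thesis .
    qed
    then show "x \<in> PiE_dflt (slots m) 0 (\<lambda>_. {..n})" using x by (auto simp: mult_funs_def PiE_dflt_def)
  qed
qed (rule finite_PiE_dflt; simp)

lemma finite_peak_seqs: "0 < m \<Longrightarrow> finite (peak_seqs n m)"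
  using bij_betw_finite[OF bij_betw_mults] finite_mult_funs by blast

lemma unimodal_seqs_UN: "unimodal_seqs n = (\<Union>m\<in>{1..n}. peak_seqs n m)"
proof (intro equalityI subsetI)
  fix l assume l: "l \<in> unimodal_seqs n"
  then have "l \<in> peak_seqs n (peak l)" by (simp add: peak_seqs_def)
  moreover from this have "peak l \<in> {1..n}" unfolding peak_seqs_altdef by auto
  ultimately show "l \<in> (\<Union>m\<in>{1..n}. peak_seqs n m)" by blast
qed (auto simp: peak_seqs_def)

lemma finite_unimodal_seqs: "finite (unimodal_seqs n)"
  unfolding unimodal_seqs_UN by (auto intro!: finite_peak_seqs)

lemma card_unimodal_seqs:
  "card {l \<in> unimodal_seqs n. P l} = (\<Sum>m = 1..n. card {l \<in> peak_seqs n m. P l})"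
proof -
  have "{l \<in> unimodal_seqs n. P l} = (\<Union>m\<in>{1..n}. {l \<in> peak_seqs n m. P l})"
    unfolding unimodal_seqs_UN by auto
  also have "card \<dots> = (\<Sum>m = 1..n. card {l \<in> peak_seqs n m. P l})"
    by (intro card_UN_disjoint) (auto simp: peak_seqs_def intro: finite_subset[OF _ finite_unimodal_seqs])
  finally show ?thesis .
qed

section \<open>Weights of the peaks\<close>

text \<open>Generating function, at exp (- t), of pairs of partitions into parts of size at most
  \<open>m\<close>; its inverse is the normalising constant in \<open>pmf_boltz\<close>.\<close>

definition peak_vol :: "real \<Rightarrow> nat \<Rightarrow> real" where
  "peak_vol t m = 1 / (\<Prod>i\<in>slots m. 1 - exp (- (t * real (fst i))))"

definition peak_weight :: "real \<Rightarrow> nat \<Rightarrow> real" where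
  "peak_weight t m = exp (- (t * real m)) * peak_vol t m"

lemma prod_slots_pos: "0 < t \<Longrightarrow> 0 < (\<Prod>i\<in>slots m. 1 - exp (- (t * real (fst i))))"
proof (rule prod_pos)
  fix i assume "0 < t" "i \<in> slots m"
  then show "0 < 1 - exp (- (t * real (fst i)))" using slots_pos[of i m] by simp
qed

text \<open>Every admissible multiplicity function has the same mass exp (- t (n - m)) /
  \<open>peak_vol t m\<close>, so a probability is a count times this mass.\<close>

lemma card_peak_seqs:
  assumes "0 < t" "0 < m"
  shows "exp (- (t * real n)) * real (card {l \<in> peak_seqs n m. P (mults l)}) =
    peak_weight t m * measure_pmf.prob (boltz t (slots m)) {x. int (wsum (slots m) x) = int n - int m \<and> P x}"
proof -
  let ?Z = "\<Prod>i\<in>slots m. 1 - exp (- (t * real (fst i)))"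
  have Z: "0 < ?Z" by (rule prod_slots_pos[OF assms(1)])
  let ?S = "{x \<in> mult_funs n m. P x}"
  have "bij_betw mults {l \<in> peak_seqs n m. P (mults l)} ?S"
    using bij_betw_mults[OF assms(2), of n] unfolding bij_betw_def inj_on_def by auto
  then have card: "card {l \<in> peak_seqs n m. P (mults l)} = card ?S" by (rule bij_betw_same_card)
  have set: "set_pmf (boltz t (slots m)) \<subseteq> {x. \<forall>i. i \<notin> slots m \<longrightarrow> x i = 0}"
    unfolding boltz_def by (rule set_Pi_pmf_subset) simp
  have "measure_pmf.prob (boltz t (slots m)) {x. int (wsum (slots m) x) = int n - int m \<and> P x} =
    measure_pmf.prob (boltz t (slots m)) ?S"
    using set by (intro measure_pmf.finite_measure_eq_AE AE_pmfI) (auto simp: mult_funs_def)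
  also have "\<dots> = (\<Sum>x\<in>?S. pmf (boltz t (slots m)) x)"
    by (rule measure_measure_pmf_finite) (simp add: finite_mult_funs)
  also have "\<dots> = (\<Sum>x\<in>?S. exp (- (t * (real n - real m))) * ?Z)"
  proof (rule sum.cong[OF refl])
    fix x assume x: "x \<in> ?S"
    have w: "real (wsum (slots m) x) = real n - real m"
    proof -
      have "real_of_int (int (wsum (slots m) x)) = real_of_int (int n - int m)" using x by (simp add: mult_funs_def)
      then show ?thesis by simp
    qed
    show "pmf (boltz t (slots m)) x = exp (- (t * (real n - real m))) * ?Z"
    proof -
      have "x i = 0" if "i \<notin> slots m" for i using x that unfolding mult_funs_def by blast
      then show ?thesis unfolding w[symmetric]
        by (intro pmf_boltz finite_slots assms(1) slots_pos)
    qed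
  qed
  also have "\<dots> = real (card ?S) * (exp (- (t * (real n - real m))) * ?Z)" by simp
  finally have pr: "measure_pmf.prob (boltz t (slots m)) {x. int (wsum (slots m) x) = int n - int m \<and> P x} =
      real (card ?S) * (exp (- (t * (real n - real m))) * ?Z)" .
  have "peak_weight t m * measure_pmf.prob (boltz t (slots m)) {x. int (wsum (slots m) x) = int n - int m \<and> P x}
    = (exp (- (t * real m)) * exp (- (t * (real n - real m)))) * real (card ?S)"
  proof -
    have "exp (- (t * real m)) * (1 / z) * (c * (e * z)) = exp (- (t * real m)) * e * c"
      if "0 < z" for z c e :: real using that by simp
    then show ?thesis unfolding peak_weight_def peak_vol_def pr using Z by presburger
  qed
  also have "exp (- (t * real m)) * exp (- (t * (real n - real m))) = exp (- (t * real n))"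
    by (simp add: mult_exp_exp algebra_simps)
  finally show ?thesis unfolding card by simp
qed

lemma peak_vol_eq: "peak_vol t m = 1 / (\<Prod>k = 1..m. 1 - exp (- (t * real k)))\<^sup>2"
  unfolding peak_vol_def using prod_slots[of "\<lambda>k. 1 - exp (- (t * real k))" m] by simp

lemma peak_vol_pos: "0 < t \<Longrightarrow> 0 < peak_vol t m"
  unfolding peak_vol_def using prod_slots_pos by simp

lemma peak_weight_pos: "0 < t \<Longrightarrow> 0 < peak_weight t m"
  unfolding peak_weight_def using peak_vol_pos by simp

lemma peak_vol_Suc: "peak_vol t (Suc m) = peak_vol t m / (1 - exp (- (t * real (Suc m))))\<^sup>2"
  unfolding peak_vol_eq by (simp add: power_mult_distrib)

text \<open>The weights of the peaks thus telescope up to a factor of \<open>2\<close>.\<close>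

lemma peak_weight_bounds:
  assumes "0 < t"
  shows "peak_weight t (Suc m) \<le> peak_vol t (Suc m) - peak_vol t m"
    and "peak_vol t (Suc m) - peak_vol t m \<le> 2 * peak_weight t (Suc m)"
proof -
  define q where "q = exp (- (t * real (Suc m)))"
  have q: "0 < q" "q < 1" using assms by (auto simp: q_def)
  have "peak_vol t m = peak_vol t (Suc m) * (1 - q)\<^sup>2"
    unfolding peak_vol_Suc q_def[symmetric] using q by simp
  then have d: "peak_vol t (Suc m) - peak_vol t m = peak_vol t (Suc m) * (2 * q - q\<^sup>2)"
    by (simp add: power2_eq_square algebra_simps)
  have w: "peak_weight t (Suc m) = peak_vol t (Suc m) * q" by (simp add: peak_weight_def q_def)
  \<comment> \<open>The increment carries the factor 2 q - q^2 and the weight the factor q, and q <=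
    2 q - q^2 <= 2 q.\<close>
  have "q\<^sup>2 \<le> q" using q by (simp add: power2_eq_square mult_left_le)
  then show "peak_weight t (Suc m) \<le> peak_vol t (Suc m) - peak_vol t m"
    unfolding d w using peak_vol_pos[OF assms, of "Suc m"] by (intro mult_left_mono) auto
  show "peak_vol t (Suc m) - peak_vol t m \<le> 2 * peak_weight t (Suc m)"
    unfolding d w using peak_vol_pos[OF assms, of "Suc m"] q by (simp add: algebra_simps)
qed

lemma sum_peak_weight_bounds:
  assumes "0 < t" "a \<le> b"
  shows "(\<Sum>m\<in>{a<..b}. peak_weight t m) \<le> peak_vol t b - peak_vol t a"
    and "peak_vol t b - peak_vol t a \<le> 2 * (\<Sum>m\<in>{a<..b}. peak_weight t m)"
proof -
  have "(\<Sum>m\<in>{a<..b}. peak_weight t m) \<le> peak_vol t b - peak_vol t a \<and>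
    peak_vol t b - peak_vol t a \<le> 2 * (\<Sum>m\<in>{a<..b}. peak_weight t m)"
    using assms(2)
  proof (induction b rule: dec_induct)
    case (step b)
    have "{a<..Suc b} = insert (Suc b) {a<..b}" using step by auto
    then show ?case using step peak_weight_bounds[OF assms(1), of b] by simp
  qed simp
  then show "(\<Sum>m\<in>{a<..b}. peak_weight t m) \<le> peak_vol t b - peak_vol t a"
    "peak_vol t b - peak_vol t a \<le> 2 * (\<Sum>m\<in>{a<..b}. peak_weight t m)" by auto
qed

lemma peak_vol_ratio:
  assumes "0 < t" "a \<le> b"
  shows "peak_vol t a = peak_vol t b * (\<Prod>k\<in>{a<..b}. 1 - exp (- (t * real k)))\<^sup>2"
  using assms(2)
proof (induction b rule: dec_induct)
  case (step b)
  have "{a<..Suc b} = insert (Suc b) {a<..b}" using step by auto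
  moreover have "1 - exp (- (t * real (Suc b))) \<noteq> 0" using assms by (simp add: add_eq_0_iff)
  ultimately show ?case using step by (simp add: peak_vol_Suc power_mult_distrib)
qed simp

text \<open>By 1 - y <= exp (- y) in each factor; used to show that small peaks carry little
  weight.\<close>

lemma peak_vol_le_exp:
  assumes "0 < t" "a \<le> b"
  shows "peak_vol t a \<le> peak_vol t b * exp (- (2 * (\<Sum>k\<in>{a<..b}. exp (- (t * real k)))))"
proof -
  have "(\<Prod>k\<in>{a<..b}. 1 - exp (- (t * real k))) \<le> (\<Prod>k\<in>{a<..b}. exp (- exp (- (t * real k))))"
  proof (rule prod_mono)
    fix k assume "k \<in> {a<..b}"
    show "0 \<le> 1 - exp (- (t * real k)) \<and> 1 - exp (- (t * real k)) \<le> exp (- exp (- (t * real k)))"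
      using exp_ge_add_one_self[of "- exp (- (t * real k))"] assms by simp
  qed
  also have "\<dots> = exp (- (\<Sum>k\<in>{a<..b}. exp (- (t * real k))))" by (simp add: exp_sum[symmetric] sum_negf)
  finally have "(\<Prod>k\<in>{a<..b}. 1 - exp (- (t * real k)))\<^sup>2 \<le> (exp (- (\<Sum>k\<in>{a<..b}. exp (- (t * real k)))))\<^sup>2"
    using assms by (intro power_mono prod_nonneg) auto
  also have "\<dots> = exp (- (2 * (\<Sum>k\<in>{a<..b}. exp (- (t * real k)))))" by (simp add: exp_double[symmetric])
  finally show ?thesis unfolding peak_vol_ratio[OF assms] using peak_vol_pos[OF assms(1), of b]
    by (intro mult_left_mono) auto
qed

text \<open>The converse direction: once exp (- t a) <= t / 2, the remaining exponentials sum to at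
  most 1/2, so the Weierstrass product inequality keeps the product above 1/2 and its square above
  1/4.\<close>

lemma peak_vol_le_4:
  assumes "0 < t" "a \<le> b" "exp (- (t * real a)) \<le> t / 2"
  shows "peak_vol t b \<le> 4 * peak_vol t a"
proof -
  have "(\<Sum>k\<in>{a<..b}. exp (- (t * real k))) = (\<Sum>k = 1..b - a. exp (- (t * real a)) * exp (- (t * real k)))"
    by (rule sum.reindex_bij_witness[of _ "\<lambda>k. k + a" "\<lambda>k. k - a"])
       (auto simp: mult_exp_exp algebra_simps of_nat_diff)
  also have "\<dots> \<le> exp (- (t * real a)) * (1 / t)"
    unfolding sum_distrib_left[symmetric] using assms by (intro mult_left_mono sum_exp_neg_le) auto
  also have "\<dots> \<le> t / 2 * (1 / t)" using assms by (intro mult_right_mono) auto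
  finally have s: "(\<Sum>k\<in>{a<..b}. exp (- (t * real k))) \<le> 1 / 2" using assms by simp
  have "1 - (\<Sum>k\<in>{a<..b}. exp (- (t * real k))) \<le> (\<Prod>k\<in>{a<..b}. 1 - exp (- (t * real k)))"
    using assms by (intro Weierstrass_prod_ineq) auto
  with s have "1 / 2 \<le> (\<Prod>k\<in>{a<..b}. 1 - exp (- (t * real k)))" by linarith
  then have "(1 / 2)\<^sup>2 \<le> (\<Prod>k\<in>{a<..b}. 1 - exp (- (t * real k)))\<^sup>2" by (intro power_mono) auto
  then have "peak_vol t b * (1 / 2)\<^sup>2 \<le> peak_vol t a"
    unfolding peak_vol_ratio[OF assms(1,2)] using peak_vol_pos[OF assms(1), of b] by (intro mult_left_mono) auto
  then show ?thesis by (simp add: power_divide)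
qed

section \<open>Small parts are almost independent of the size\<close>

lemma prob_pair_pmf:
  "measure_pmf.prob (pair_pmf p q) E = measure_pmf.expectation p (\<lambda>x. measure_pmf.prob q {y. (x, y) \<in> E})"
proof -
  have "emeasure (measure_pmf (pair_pmf p q)) E = (\<integral>\<^sup>+x. \<integral>\<^sup>+y. indicator E (x, y) \<partial>q \<partial>p)"
    by (subst nn_integral_pair_pmf'[symmetric]) simp
  also have "\<dots> = (\<integral>\<^sup>+x. ennreal (measure_pmf.prob q {y. (x, y) \<in> E}) \<partial>p)"
  proof (rule nn_integral_cong)
    fix x
    have "(\<integral>\<^sup>+y. indicator E (x, y) \<partial>q) = (\<integral>\<^sup>+y. indicator {y. (x, y) \<in> E} y \<partial>q)"
      by (rule nn_integral_cong) (simp add: indicator_def)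
    then show "(\<integral>\<^sup>+y. indicator E (x, y) \<partial>q) = ennreal (measure_pmf.prob q {y. (x, y) \<in> E})"
      by (simp add: measure_pmf.emeasure_eq_measure)
  qed
  also have "\<dots> = ennreal (measure_pmf.expectation p (\<lambda>x. measure_pmf.prob q {y. (x, y) \<in> E}))"
    by (rule nn_integral_eq_integral) (auto intro!: measure_pmf.integrable_const_bound[where B = 1])
  finally show ?thesis
    by (simp add: measure_pmf.emeasure_eq_measure integral_nonneg)
qed

definition slab :: "nat set \<Rightarrow> (nat \<times> side) set" where
  "slab S = S \<times> {Lft, Rgt}"

text \<open>A slot of part size k has mean k / (exp (t k) - 1) <= 1 / t, whatever k is.\<close>

lemma boltz_mean_slab_le:
  assumes "0 < t" "finite S" "\<And>k. k \<in> S \<Longrightarrow> 0 < k"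
  shows "boltz_mean t (slab S) \<le> 2 * real (card S) / t"
proof -
  have "boltz_mean t (slab S) \<le> (\<Sum>i\<in>slab S. 1 / t)"
    unfolding boltz_mean_def
  proof (rule sum_mono)
    fix i assume "i \<in> slab S"
    then have k: "0 < fst i" using assms(3) by (auto simp: slab_def)
    define x where "x = t * real (fst i)"
    have x: "0 < x" using k assms by (simp add: x_def)
    have "exp (- x) / (1 - exp (- x)) \<le> 1 / x"
    proof -
      have "x \<le> exp x - 1" using exp_ge_add_one_self[of x] by linarith
      then have "x * exp (- x) \<le> (exp x - 1) * exp (- x)" by (intro mult_right_mono) auto
      also have "\<dots> = 1 - exp (- x)" by (simp add: left_diff_distrib mult_exp_exp)
      finally show ?thesis using x by (simp add: field_simps)
    qed
    then have "real (fst i) * (exp (- x) / (1 - exp (- x))) \<le> real (fst i) * (1 / x)"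
      by (intro mult_left_mono) auto
    also have "\<dots> = 1 / t" using k by (simp add: x_def)
    finally show "real (fst i) * (exp (- (t * real (fst i))) / (1 - exp (- (t * real (fst i))))) \<le> 1 / t"
      unfolding x_def .
  qed
  also have "\<dots> = 2 * real (card S) / t" by (simp add: slab_def card_cartesian_product)
  finally show ?thesis .
qed

text \<open>One implication suffices, since \<open>x\<close> and \<open>y\<close> may be
  exchanged.\<close>

definition depends_on :: "('a \<Rightarrow> 'b) set \<Rightarrow> 'a set \<Rightarrow> bool" where
  "depends_on A I \<longleftrightarrow> (\<forall>x y. (\<forall>i\<in>I. x i = y i) \<longrightarrow> x \<in> A \<longrightarrow> y \<in> A)"

text \<open>The slots in the slab and the remaining slots are independent. Given the former, the
  event is decided and the latter must supply the rest of the size.\<close>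

lemma boltz_split:
  assumes "finite S" "slab S \<subseteq> slots m" "depends_on A (slab S)"
  shows "measure_pmf.prob (boltz t (slots m)) {x. int (wsum (slots m) x) = w \<and> x \<in> A} =
    measure_pmf.expectation (boltz t (slab S)) (\<lambda>f. indicator A f * boltz_prob t (slots m - slab S) (w - int (wsum (slab S) f)))"
proof -
  let ?J = "slots m - slab S"
  let ?h = "\<lambda>(f, g) i. if i \<in> slab S then f i else g i"
  have fin: "finite (slab S)" using assms(1) by (simp add: slab_def)
  have un: "slab S \<union> ?J = slots m" using assms(2) by auto
  have b: "boltz t (slots m) = map_pmf ?h (pair_pmf (boltz t (slab S)) (boltz t ?J))"
    using Pi_pmf_union[of "slab S" ?J 0 "\<lambda>i. geometric_pmf (1 - exp (- (t * real (fst i))))"] fin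
    unfolding boltz_def un by simp
  have ws: "wsum (slots m) (?h (f, g)) = wsum (slab S) f + wsum ?J g" for f g
  proof -
    have "wsum (slots m) (?h (f, g)) = wsum (slab S) (?h (f, g)) + wsum ?J (?h (f, g))"
      using wsum_Un[of "slab S" ?J "?h (f, g)"] fin un by simp
    also have "wsum (slab S) (?h (f, g)) = wsum (slab S) f" by (simp add: wsum_def)
    also have "wsum ?J (?h (f, g)) = wsum ?J g" unfolding wsum_def by (intro sum.cong) auto
    finally show ?thesis .
  qed
  have A: "?h (f, g) \<in> A \<longleftrightarrow> f \<in> A" for f g
    using assms(3) unfolding depends_on_def
    by (metis (mono_tags, lifting) case_prod_conv)
  have "measure_pmf.prob (boltz t (slots m)) {x. int (wsum (slots m) x) = w \<and> x \<in> A} =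
    measure_pmf.prob (pair_pmf (boltz t (slab S)) (boltz t ?J)) {p. int (wsum (slots m) (?h p)) = w \<and> ?h p \<in> A}"
    unfolding b by (simp add: vimage_def)
  also have "\<dots> = measure_pmf.expectation (boltz t (slab S)) (\<lambda>f. measure_pmf.prob (boltz t ?J) {g. int (wsum (slots m) (?h (f, g))) = w \<and> ?h (f, g) \<in> A})"
    by (subst prob_pair_pmf) simp
  also have "\<dots> = measure_pmf.expectation (boltz t (slab S)) (\<lambda>f. indicator A f * boltz_prob t ?J (w - int (wsum (slab S) f)))"
  proof (rule Bochner_Integration.integral_cong[OF refl])
    fix f
    have "{g. int (wsum (slots m) (?h (f, g))) = w \<and> ?h (f, g) \<in> A} =
      (if f \<in> A then {g. int (wsum ?J g) = w - int (wsum (slab S) f)} else {})"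
      unfolding ws A by auto
    then show "measure_pmf.prob (boltz t ?J) {g. int (wsum (slots m) (?h (f, g))) = w \<and> ?h (f, g) \<in> A} =
      indicator A f * boltz_prob t ?J (w - int (wsum (slab S) f))"
      by (simp add: boltz_prob_def)
  qed
  finally show ?thesis .
qed

text \<open>Replacing the random target w - Y by w costs at most M t^3 E Y <= 2 M t^2 |S|. The bound
  1/16 on the parts of \<open>S\<close> keeps the Lipschitz estimate valid after their
  removal.\<close>

lemma boltz_almost_indep:
  obtains M where "0 < M" and
    "\<And>t S m A w. 0 < t \<Longrightarrow> t \<le> 1 / 32 \<Longrightarrow> finite S \<Longrightarrow> (\<And>k. k \<in> S \<Longrightarrow> 0 < k \<and> t * real k \<le> 1 / 16) \<Longrightarrow>
       1 \<le> t * real m \<Longrightarrow> depends_on A (slab S) \<Longrightarrow>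
       \<bar>measure_pmf.prob (boltz t (slots m)) {x. int (wsum (slots m) x) = w \<and> x \<in> A} -
         measure_pmf.prob (boltz t (slab S)) A * boltz_prob t (slots m) w\<bar> \<le> M * t\<^sup>2 * real (card S)"
proof -
  obtain M where M: "0 < M" and
    lip: "\<And>t I v w. covers t I \<Longrightarrow> 0 < t \<Longrightarrow> t \<le> 1 / 32 \<Longrightarrow>
       \<bar>boltz_prob t I v - boltz_prob t I w\<bar> \<le> M * t ^ 3 * of_int \<bar>v - w\<bar>"
    using boltz_prob_lipschitz by blast
  show ?thesis
  proof (rule that[of "4 * M"])
    fix t :: real and S :: "nat set" and m :: nat and A :: "(nat \<times> side \<Rightarrow> nat) set" and w :: int
    assume t: "0 < t" "t \<le> 1 / 32" and fin: "finite S"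
      and S: "\<And>k. k \<in> S \<Longrightarrow> 0 < k \<and> t * real k \<le> 1 / 16" and m: "1 \<le> t * real m"
      and A: "depends_on A (slab S)"
    let ?J = "slots m - slab S" and ?P = "boltz t (slab S)"
    have sub: "slab S \<subseteq> slots m"
    proof
      fix i assume i: "i \<in> slab S"
      then have k: "0 < fst i" "t * real (fst i) \<le> 1 / 16" using S by (auto simp: slab_def)
      then have "t * real (fst i) \<le> t * real m" using m by linarith
      then show "i \<in> slots m" using k i t by (auto simp: slots_def slab_def)
    qed
    have cov: "covers t ?J" unfolding slab_def using covers_slots_Diff[OF m t(1)] S by blast
    have finS: "finite (slab S)" using fin by (simp add: slab_def)
    have pos: "0 < fst i" if "i \<in> slab S" for i using that S by (auto simp: slab_def)
    note mom = boltz_moments(1,2)[OF finS t(1) pos]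
    have key: "\<bar>measure_pmf.prob (boltz t (slots m)) {x. int (wsum (slots m) x) = w \<and> x \<in> B} -
         measure_pmf.prob ?P B * boltz_prob t ?J w\<bar> \<le> 2 * M * t\<^sup>2 * real (card S)"
      if B: "depends_on B (slab S)" for B
    proof -
      let ?b = "\<lambda>f. indicator B f * boltz_prob t ?J (w - int (wsum (slab S) f))"
      have i1: "integrable (measure_pmf ?P) ?b"
        by (rule measure_pmf.integrable_const_bound[where B = 1])
           (auto simp: boltz_prob_def indicator_def)
      have i2: "integrable (measure_pmf ?P) (\<lambda>f. indicator B f * boltz_prob t ?J w)"
        by (rule measure_pmf.integrable_const_bound[where B = 1])
           (auto simp: boltz_prob_def indicator_def)
      have "measure_pmf.prob (boltz t (slots m)) {x. int (wsum (slots m) x) = w \<and> x \<in> B} -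
         measure_pmf.prob ?P B * boltz_prob t ?J w =
        measure_pmf.expectation ?P (\<lambda>f. ?b f - indicator B f * boltz_prob t ?J w)"
        unfolding boltz_split[OF fin sub B] Bochner_Integration.integral_diff[OF i1 i2] by simp
      also have "\<bar>\<dots>\<bar> \<le> measure_pmf.expectation ?P (\<lambda>f. \<bar>?b f - indicator B f * boltz_prob t ?J w\<bar>)"
        by (rule integral_abs_bound)
      also have "\<dots> \<le> measure_pmf.expectation ?P (\<lambda>f. M * t ^ 3 * real (wsum (slab S) f))"
      proof (rule integral_mono)
        show "integrable (measure_pmf ?P) (\<lambda>f. \<bar>?b f - indicator B f * boltz_prob t ?J w\<bar>)"
          using i1 i2 by (intro integrable_abs Bochner_Integration.integrable_diff)
        show "integrable (measure_pmf ?P) (\<lambda>f. M * t ^ 3 * real (wsum (slab S) f))"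
          using mom(1) by simp
        fix f
        have "\<bar>?b f - indicator B f * boltz_prob t ?J w\<bar> \<le> \<bar>boltz_prob t ?J (w - int (wsum (slab S) f)) - boltz_prob t ?J w\<bar>"
          by (simp add: indicator_def)
        also have "\<dots> \<le> M * t ^ 3 * of_int \<bar>(w - int (wsum (slab S) f)) - w\<bar>" by (rule lip[OF cov t])
        finally show "\<bar>?b f - indicator B f * boltz_prob t ?J w\<bar> \<le> M * t ^ 3 * real (wsum (slab S) f)" by simp
      qed
      also have "\<dots> = M * t ^ 3 * boltz_mean t (slab S)" using mom by simp
      also have "\<dots> \<le> M * t ^ 3 * (2 * real (card S) / t)"
        using boltz_mean_slab_le[OF t(1) fin] S M t by (intro mult_left_mono) auto
      also have "\<dots> = 2 * M * t\<^sup>2 * real (card S)" using t by (simp add: power3_eq_cube power2_eq_square)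
      finally show ?thesis .
    qed
    \<comment> \<open>\<open>key\<close> compares with the law of the remaining slots only; the
      trivial event converts this to the law of all slots at the price of a second error of the same
      size.\<close>
    have "depends_on UNIV (slab S)" by (simp add: depends_on_def)
    from key[OF this] have U: "\<bar>boltz_prob t (slots m) w - boltz_prob t ?J w\<bar> \<le> 2 * M * t\<^sup>2 * real (card S)"
      by (simp add: boltz_prob_def)
    let ?a = "measure_pmf.prob ?P A"
    have "\<bar>?a * boltz_prob t ?J w - ?a * boltz_prob t (slots m) w\<bar> = ?a * \<bar>boltz_prob t (slots m) w - boltz_prob t ?J w\<bar>"
      by (simp add: abs_mult abs_minus_commute flip: right_diff_distrib)
    also have "\<dots> \<le> 1 * \<bar>boltz_prob t (slots m) w - boltz_prob t ?J w\<bar>" by (intro mult_right_mono) auto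
    finally have d: "\<bar>?a * boltz_prob t ?J w - ?a * boltz_prob t (slots m) w\<bar> \<le>
      1 * \<bar>boltz_prob t (slots m) w - boltz_prob t ?J w\<bar>" .
    show "\<bar>measure_pmf.prob (boltz t (slots m)) {x. int (wsum (slots m) x) = w \<and> x \<in> A} -
         ?a * boltz_prob t (slots m) w\<bar> \<le> 4 * M * t\<^sup>2 * real (card S)"
    proof -
      have "\<bar>a - c\<bar> \<le> 4 * d" if "\<bar>a - b\<bar> \<le> 2 * d" "\<bar>b - c\<bar> \<le> 1 * e" "e \<le> 2 * d" for a b c d e :: real
        using that by linarith
      from this[of _ _ "M * t\<^sup>2 * real (card S)", unfolded mult.assoc[symmetric], OF key[OF A] d U]
      show ?thesis .
    qed
  qed (use M in simp)
qed

section \<open>Summation over the peak\<close>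

text \<open>The factor exp (- t n) cancels in every ratio; it turns the count into a sum of peak
  weights times probabilities.\<close>

definition boltz_total :: "real \<Rightarrow> nat \<Rightarrow> (nat \<times> side \<Rightarrow> nat) set \<Rightarrow> real" where
  "boltz_total t n A = exp (- (t * real n)) * real (card {l \<in> unimodal_seqs n. mults l \<in> A})"

lemma boltz_total_eq:
  assumes "0 < t"
  shows "boltz_total t n A = (\<Sum>m = 1..n. peak_weight t m *
    measure_pmf.prob (boltz t (slots m)) {x. int (wsum (slots m) x) = int n - int m \<and> x \<in> A})"
proof -
  have "boltz_total t n A = (\<Sum>m = 1..n. exp (- (t * real n)) * real (card {l \<in> peak_seqs n m. mults l \<in> A}))"
    unfolding boltz_total_def card_unimodal_seqs by (simp add: sum_distrib_left)
  also have "\<dots> = (\<Sum>m = 1..n. peak_weight t m *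
    measure_pmf.prob (boltz t (slots m)) {x. int (wsum (slots m) x) = int n - int m \<and> x \<in> A})"
    using assms by (intro sum.cong refl card_peak_seqs[where P = "\<lambda>x. x \<in> A"]) auto
  finally show ?thesis .
qed

lemma boltz_total_UNIV:
  assumes "0 < t"
  shows "boltz_total t n UNIV = (\<Sum>m = 1..n. peak_weight t m * boltz_prob t (slots m) (int n - int m))"
  unfolding boltz_total_eq[OF assms] boltz_prob_def by simp

text \<open>Above 1 / t the local estimate applies to each peak. Below it the difference is bounded
  trivially by 1, and the total weight of these peaks by \<open>peak_vol\<close> at 1 / t.\<close>

lemma boltz_total_almost_indep:
  obtains M where "0 < M" and
    "\<And>t S n A. 0 < t \<Longrightarrow> t \<le> 1 / 32 \<Longrightarrow> finite S \<Longrightarrow> (\<And>k. k \<in> S \<Longrightarrow> 0 < k \<and> t * real k \<le> 1 / 16) \<Longrightarrow>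
       depends_on A (slab S) \<Longrightarrow>
       \<bar>boltz_total t n A - measure_pmf.prob (boltz t (slab S)) A * boltz_total t n UNIV\<bar> \<le>
         M * t\<^sup>2 * real (card S) * peak_vol t n + peak_vol t (nat \<lfloor>1 / t\<rfloor>)"
proof -
  obtain M where M: "0 < M" and
    ind: "\<And>t S m A w. 0 < t \<Longrightarrow> t \<le> 1 / 32 \<Longrightarrow> finite S \<Longrightarrow> (\<And>k. k \<in> S \<Longrightarrow> 0 < k \<and> t * real k \<le> 1 / 16) \<Longrightarrow>
       1 \<le> t * real m \<Longrightarrow> depends_on A (slab S) \<Longrightarrow>
       \<bar>measure_pmf.prob (boltz t (slots m)) {x. int (wsum (slots m) x) = w \<and> x \<in> A} -
         measure_pmf.prob (boltz t (slab S)) A * boltz_prob t (slots m) w\<bar> \<le> M * t\<^sup>2 * real (card S)"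
    using boltz_almost_indep by blast
  show ?thesis
  proof (rule that[OF M])
    fix t :: real and S :: "nat set" and n :: nat and A :: "(nat \<times> side \<Rightarrow> nat) set"
    assume t: "0 < t" "t \<le> 1 / 32" and fin: "finite S"
      and S: "\<And>k. k \<in> S \<Longrightarrow> 0 < k \<and> t * real k \<le> 1 / 16" and A: "depends_on A (slab S)"
    define \<epsilon> where "\<epsilon> = M * t\<^sup>2 * real (card S)"
    define a where "a = nat \<lfloor>1 / t\<rfloor>"
    define d where "d m = \<bar>measure_pmf.prob (boltz t (slots m)) {x. int (wsum (slots m) x) = int n - int m \<and> x \<in> A} -
         measure_pmf.prob (boltz t (slab S)) A * boltz_prob t (slots m) (int n - int m)\<bar>" for m
    have \<epsilon>: "0 \<le> \<epsilon>" using M by (simp add: \<epsilon>_def)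
    have W: "0 \<le> peak_weight t m" for m using peak_weight_pos[OF t(1), of m] by simp
    have d: "d m \<le> \<epsilon> + (if m \<le> a then 1 else 0)" for m
    proof (cases "m \<le> a")
      case True
      have "\<bar>x - y * z\<bar> \<le> 1" if "0 \<le> x" "x \<le> 1" "0 \<le> y" "y \<le> 1" "0 \<le> z" "z \<le> 1" for x y z :: real
      proof -
        have "0 \<le> y * z" "y * z \<le> 1" using that by (auto simp: mult_le_one)
        then show ?thesis using that by linarith
      qed
      then have "d m \<le> 1" unfolding d_def boltz_prob_def by simp
      then show ?thesis using True \<epsilon> by simp
    next
      case False
      then have "1 / t < real m" unfolding a_def by linarith
      then have "1 \<le> t * real m" using t by (simp add: field_simps)
      then show ?thesis using ind[OF t fin S _ A, of m "int n - int m"] False by (simp add: d_def \<epsilon>_def)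
    qed
    have "boltz_total t n A - measure_pmf.prob (boltz t (slab S)) A * boltz_total t n UNIV =
      (\<Sum>m = 1..n. peak_weight t m * (measure_pmf.prob (boltz t (slots m)) {x. int (wsum (slots m) x) = int n - int m \<and> x \<in> A} -
         measure_pmf.prob (boltz t (slab S)) A * boltz_prob t (slots m) (int n - int m)))"
      unfolding boltz_total_eq[OF t(1), of n A] boltz_total_UNIV[OF t(1)]
      by (simp add: sum_distrib_left sum_subtractf right_diff_distrib mult_ac)
    also have "\<bar>\<dots>\<bar> \<le> (\<Sum>m = 1..n. peak_weight t m * d m)"
      unfolding d_def by (rule order_trans[OF sum_abs]) (simp add: abs_mult W)
    also have "\<dots> \<le> (\<Sum>m = 1..n. peak_weight t m * (\<epsilon> + (if m \<le> a then 1 else 0)))"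
      using d W by (intro sum_mono mult_left_mono) auto
    also have "\<dots> = \<epsilon> * (\<Sum>m = 1..n. peak_weight t m) + (\<Sum>m\<in>{m \<in> {1..n}. m \<le> a}. peak_weight t m)"
    proof -
      have "(\<Sum>m = 1..n. peak_weight t m * (\<epsilon> + (if m \<le> a then 1 else 0))) =
        (\<Sum>m = 1..n. \<epsilon> * peak_weight t m + (if m \<le> a then peak_weight t m else 0))"
        by (intro sum.cong) (auto simp: algebra_simps)
      then show ?thesis by (simp only: sum.distrib sum_distrib_left sum.inter_filter[OF finite_atLeastAtMost])
    qed
    also have "\<dots> \<le> \<epsilon> * peak_vol t n + peak_vol t a"
    proof (intro add_mono mult_left_mono \<epsilon>)
      have e: "{0<..n} = {1..n}" for n :: nat by auto
      show "(\<Sum>m = 1..n. peak_weight t m) \<le> peak_vol t n"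
        using sum_peak_weight_bounds(1)[OF t(1), of 0 n] peak_vol_pos[OF t(1), of 0] by (simp add: e)
      have "(\<Sum>m\<in>{m \<in> {1..n}. m \<le> a}. peak_weight t m) \<le> (\<Sum>m = 1..a. peak_weight t m)"
        using W by (intro sum_mono2) auto
      also have "\<dots> \<le> peak_vol t a"
        using sum_peak_weight_bounds(1)[OF t(1), of 0 a] peak_vol_pos[OF t(1), of 0] by (simp add: e)
      finally show "(\<Sum>m\<in>{m \<in> {1..n}. m \<le> a}. peak_weight t m) \<le> peak_vol t a" .
    qed
    finally show "\<bar>boltz_total t n A - measure_pmf.prob (boltz t (slab S)) A * boltz_total t n UNIV\<bar> \<le>
         M * t\<^sup>2 * real (card S) * peak_vol t n + peak_vol t (nat \<lfloor>1 / t\<rfloor>)"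
      unfolding \<epsilon>_def a_def .
  qed
qed

text \<open>Between 1 / t and 2 / t there are at least 1 / (2 t) parts with exp (- t k) >= exp (- 2)
  >= 1/9, and each part counts twice.\<close>

lemma peak_vol_small:
  assumes t: "0 < t" "t \<le> 1 / 2" and b: "2 * nat \<lfloor>1 / t\<rfloor> \<le> b"
  shows "peak_vol t (nat \<lfloor>1 / t\<rfloor>) \<le> peak_vol t b * exp (- (1 / (9 * t)))"
proof -
  define a where "a = nat \<lfloor>1 / t\<rfloor>"
  have a: "real a \<le> 1 / t" "1 / t < real a + 1" using t unfolding a_def by (auto simp: of_nat_nat)
  have "2 \<le> 1 / t" using t by (simp add: field_simps)
  with a have a2: "1 / (2 * t) \<le> real a"
    using t by (simp add: field_simps)
  have "1 / 9 \<le> exp (- 2 :: real)"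
  proof -
    have "exp 1 * exp 1 \<le> (3 * 3 :: real)" using exp_le by (intro mult_mono) auto
    then show ?thesis by (simp add: exp_minus field_simps mult_exp_exp)
  qed
  then have "1 / (2 * t) * (1 / 9) \<le> real a * exp (- 2)" using a2 t by (intro mult_mono) auto
  also have "\<dots> = (\<Sum>k\<in>{a<..2 * a}. exp (- 2))" by simp
  also have "\<dots> \<le> (\<Sum>k\<in>{a<..2 * a}. exp (- (t * real k)))"
  proof (rule sum_mono)
    fix k assume "k \<in> {a<..2 * a}"
    then have "real k \<le> 2 * (1 / t)" using a by (simp add: of_nat_le_iff[where 'a = real, symmetric] del: of_nat_le_iff)
    then have "t * real k \<le> t * (2 * (1 / t))" using t by (intro mult_left_mono) auto
    then show "exp (- 2) \<le> exp (- (t * real k))" using t by simp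
  qed
  also have "\<dots> \<le> (\<Sum>k\<in>{a<..b}. exp (- (t * real k)))" using b by (intro sum_mono2) (auto simp: a_def)
  finally have s: "1 / (9 * t) \<le> 2 * (\<Sum>k\<in>{a<..b}. exp (- (t * real k)))" by simp
  have "peak_vol t a \<le> peak_vol t b * exp (- (2 * (\<Sum>k\<in>{a<..b}. exp (- (t * real k)))))"
    using b by (intro peak_vol_le_exp t) (simp add: a_def)
  also have "\<dots> \<le> peak_vol t b * exp (- (1 / (9 * t)))"
    using s peak_vol_pos[OF t(1), of b] by (intro mult_left_mono) auto
  finally show ?thesis unfolding a_def .
qed

text \<open>Most of the weight is carried by the peaks between \<open>3/4 L / t\<close> and \<open>2 L / t\<close>, where \<open>L = ln (1 / t)\<close>; for these the mean
  size differs from \<open>n\<close> by much less than the standard deviation, which has order \<open>t\<close> to the power \<open>-3/2\<close>.\<close>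

lemma boltz_total_ge:
  obtains t1 where "0 < t1" and
    "\<And>t n. 0 < t \<Longrightarrow> t \<le> t1 \<Longrightarrow> real n = pi\<^sup>2 / (3 * t\<^sup>2) \<Longrightarrow>
       t * sqrt t / 4096 * peak_vol t n \<le> boltz_total t n UNIV"
proof -
  obtain M t0 where M: "0 < M" and t0: "0 < t0" and
    ge: "\<And>t m w. 0 < t \<Longrightarrow> t \<le> t0 \<Longrightarrow> 1 \<le> t * real m \<Longrightarrow>
       t * sqrt t / 128 - M * t ^ 3 * \<bar>of_int w - boltz_mean t (slots m)\<bar> \<le> boltz_prob t (slots m) w"
    using boltz_prob_ge by blast
  \<comment> \<open>The bracket bounds the distance of n - m from the mean size. Its largest term is
    t^(-2) t^(9/16) = t^(-23/16), still o(t^(-3/2)). Here 9/16 is the cut-off 3/4 times the rate in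
    \<open>boltz_mean_tail\<close>, and it has to exceed 1/2.\<close>
  have "((\<lambda>t. t ^ 3 * (2 * ln (1 / t) / t + 1 + 5 / t + 6 / t\<^sup>2 * exp (- (9 / 16 * ln (1 / t)))) / (t * sqrt t)) \<longlongrightarrow> 0) (at_right 0)"
    by real_asymp
  moreover have "0 < 1 / (256 * M)" using M by simp
  ultimately have 1: "\<forall>\<^sub>F t in at_right 0. t ^ 3 * (2 * ln (1 / t) / t + 1 + 5 / t + 6 / t\<^sup>2 * exp (- (9 / 16 * ln (1 / t)))) / (t * sqrt t) < 1 / (256 * M)"
    by (rule order_tendstoD)
  have 2: "\<forall>\<^sub>F t in at_right (0 :: real). 1 \<le> 3 / 4 * ln (1 / t)" by real_asymp
  have 3: "\<forall>\<^sub>F t in at_right (0 :: real). 2 * ln (1 / t) / t + 1 \<le> 3 / t\<^sup>2" by real_asymp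
  have 4: "\<forall>\<^sub>F t in at_right (0 :: real). 3 / 4 * ln (1 / t) / t + 1 + 1 / t \<le> 2 * ln (1 / t) / t" by real_asymp
  \<comment> \<open>About 1 / t parts just above the lower cut-off contribute exponentials of order
    t^(3/4), so their sum diverges; this needs the cut-off 3/4 to be less than 1.\<close>
  have 5: "\<forall>\<^sub>F t in at_right (0 :: real). 1 \<le> 1 / (2 * t) * exp (- (3 / 4 * ln (1 / t) + t + 1))" by real_asymp
  have "\<forall>\<^sub>F t in at_right (0 :: real). t < min t0 (1 / 2)"
    using t0 by (intro eventually_at_right_less[THEN eventually_mono] order_tendstoD[OF tendsto_ident_at]) auto
  with 1 2 3 4 5 have "\<forall>\<^sub>F t in at_right (0 :: real).
     t ^ 3 * (2 * ln (1 / t) / t + 1 + 5 / t + 6 / t\<^sup>2 * exp (- (9 / 16 * ln (1 / t)))) / (t * sqrt t) < 1 / (256 * M) \<and>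
     1 \<le> 3 / 4 * ln (1 / t) \<and> 2 * ln (1 / t) / t + 1 \<le> 3 / t\<^sup>2 \<and>
     3 / 4 * ln (1 / t) / t + 1 + 1 / t \<le> 2 * ln (1 / t) / t \<and>
     1 \<le> 1 / (2 * t) * exp (- (3 / 4 * ln (1 / t) + t + 1)) \<and> t < min t0 (1 / 2)"
    by eventually_elim blast
  then obtain t2 where t2: "0 < t2" and ev: "\<And>t. 0 < t \<Longrightarrow> t < t2 \<Longrightarrow>
     t ^ 3 * (2 * ln (1 / t) / t + 1 + 5 / t + 6 / t\<^sup>2 * exp (- (9 / 16 * ln (1 / t)))) / (t * sqrt t) < 1 / (256 * M) \<and>
     1 \<le> 3 / 4 * ln (1 / t) \<and> 2 * ln (1 / t) / t + 1 \<le> 3 / t\<^sup>2 \<and>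
     3 / 4 * ln (1 / t) / t + 1 + 1 / t \<le> 2 * ln (1 / t) / t \<and>
     1 \<le> 1 / (2 * t) * exp (- (3 / 4 * ln (1 / t) + t + 1)) \<and> t < min t0 (1 / 2)"
    unfolding eventually_at_right_field by auto
  show ?thesis
  proof (rule that[of "t2 / 2"])
    show "0 < t2 / 2" using t2 by simp
    fix t :: real and n :: nat
    assume t: "0 < t" "t \<le> t2 / 2" and n: "real n = pi\<^sup>2 / (3 * t\<^sup>2)"
    define L where "L = ln (1 / t)"
    have "t < t2" using t t2 by simp
    note E = ev[OF t(1) this, folded L_def]
    have t': "t \<le> t0" "t \<le> 1 / 2" using E by auto
    define m1 where "m1 = nat \<lceil>3 / 4 * L / t\<rceil>"
    define m2 where "m2 = nat \<lceil>2 * L / t\<rceil>"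
    define a where "a = nat \<lfloor>1 / t\<rfloor>"
    have L: "1 \<le> 3 / 4 * L" using E by blast
    have m1: "3 / 4 * L / t \<le> real m1" "real m1 \<le> 3 / 4 * L / t + 1"
      using L t unfolding m1_def by (auto simp: of_nat_nat)
    have m2: "2 * L / t \<le> real m2" "real m2 \<le> 2 * L / t + 1"
      using L t unfolding m2_def by (auto simp: of_nat_nat)
    have a: "real a \<le> 1 / t" "1 / t < real a + 1" using t unfolding a_def by (auto simp: of_nat_nat)
    have "2 \<le> 1 / t" using t t' by (simp add: field_simps)
    with a have a2: "1 / (2 * t) \<le> real a" using t by (simp add: field_simps)
    have am: "m1 + a \<le> m2"
    proof -
      have "real m1 + real a \<le> real m2" using m1(2) a(1) m2(1) E by linarith
      then show ?thesis by linarith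
    qed
    have m2n: "m2 \<le> n"
    proof -
      have "3 \<le> pi" using pi_gt3 by simp
      then have "3\<^sup>2 \<le> pi\<^sup>2" by (intro power_mono) auto
      then have "9 / (3 * t\<^sup>2) \<le> real n" unfolding n by (intro divide_right_mono) auto
      then have "real m2 \<le> real n" using m2(2) E by simp
      then show ?thesis by simp
    qed
    have expL: "exp (- L) = t" using t by (simp add: L_def ln_div exp_minus)
    \<comment> \<open>At the upper cut-off exp (- t m2) <= t^2 <= t / 2, so the volume has almost
      reached its final value.\<close>
    have v1: "peak_vol t n \<le> 4 * peak_vol t m2"
    proof (rule peak_vol_le_4[OF t(1) m2n])
      have "t * (2 * L / t) \<le> t * real m2" using m2(1) t by (intro mult_left_mono) auto
      then have "2 * L \<le> t * real m2" using t by simp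
      then have "exp (- (t * real m2)) \<le> exp (- L + - L)" by simp
      also have "\<dots> = t * t" unfolding exp_add expL ..
      also have "\<dots> \<le> t * (1 / 2)" using t t' by (intro mult_left_mono) auto
      finally show "exp (- (t * real m2)) \<le> t / 2" by simp
    qed
    have v2: "peak_vol t m1 \<le> peak_vol t m2 / 2"
    proof -
      have "1 \<le> 1 / (2 * t) * exp (- (3 / 4 * L + t + 1))" using E by blast
      also have "\<dots> \<le> real a * exp (- (3 / 4 * L + t + 1))" using a2 by (intro mult_right_mono) auto
      also have "\<dots> = (\<Sum>k\<in>{m1<..m1 + a}. exp (- (3 / 4 * L + t + 1)))" by simp
      also have "\<dots> \<le> (\<Sum>k\<in>{m1<..m1 + a}. exp (- (t * real k)))"
      proof (rule sum_mono)
        fix k assume "k \<in> {m1<..m1 + a}"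
        then have "real k \<le> real m1 + real a" by (simp flip: of_nat_add)
        then have "real k \<le> 3 / 4 * L / t + 1 + 1 / t" using m1 a by linarith
        then have "t * real k \<le> t * (3 / 4 * L / t + 1 + 1 / t)" using t by (intro mult_left_mono) auto
        also have "\<dots> = 3 / 4 * L + t + 1" using t by (simp add: distrib_left)
        finally show "exp (- (3 / 4 * L + t + 1)) \<le> exp (- (t * real k))" by simp
      qed
      also have "\<dots> \<le> (\<Sum>k\<in>{m1<..m2}. exp (- (t * real k)))" using am by (intro sum_mono2) auto
      finally have s: "1 \<le> (\<Sum>k\<in>{m1<..m2}. exp (- (t * real k)))" .
      have "peak_vol t m1 \<le> peak_vol t m2 * exp (- (2 * (\<Sum>k\<in>{m1<..m2}. exp (- (t * real k)))))"
        using am by (intro peak_vol_le_exp t) simp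
      also have "\<dots> \<le> peak_vol t m2 * exp (- 1)"
        using s peak_vol_pos[OF t(1), of m2] by (intro mult_left_mono) auto
      also have "\<dots> \<le> peak_vol t m2 * (1 / 2)"
      proof (intro mult_left_mono)
        have "2 \<le> exp (1 :: real)" using exp_ge_add_one_self[of 1] by simp
        then show "exp (- 1) \<le> (1 / 2 :: real)" by (simp add: exp_minus field_simps)
      qed (use peak_vol_pos[OF t(1), of m2] in simp)
      finally show ?thesis by simp
    qed
    have p: "t * sqrt t / 256 \<le> boltz_prob t (slots m) (int n - int m)" if m: "m \<in> {m1<..m2}" for m
    proof -
      define R where "R = 2 * L / t + 1 + 5 / t + 6 / t\<^sup>2 * exp (- (9 / 16 * L))"
      have tm: "3 / 4 * L \<le> t * real m"
      proof -
        have "t * (3 / 4 * L / t) \<le> t * real m" using m m1 t by (intro mult_left_mono) auto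
        then show ?thesis using t by simp
      qed
      have "\<bar>of_int (int n - int m) - boltz_mean t (slots m)\<bar> \<le> R"
      proof -
        have "6 / t\<^sup>2 * exp (- (3 / 4 * (t * real m))) \<le> 6 / t\<^sup>2 * exp (- (9 / 16 * L))"
          using tm by (intro mult_left_mono) auto
        moreover have "real m \<le> 2 * L / t + 1" using m m2 by auto
        moreover have "0 < 6 / t\<^sup>2 * exp (- (9 / 16 * L))" using t by simp
        moreover have "0 < 5 / t" using t by simp
        ultimately show ?thesis
          using boltz_mean_slots_le[OF t(1), of m] boltz_mean_slots_ge[OF t(1) t'(2), of m]
          unfolding R_def of_int_diff of_int_of_nat_eq n by linarith
      qed
      then have "M * t ^ 3 * \<bar>of_int (int n - int m) - boltz_mean t (slots m)\<bar> \<le> M * t ^ 3 * R"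
        using M t by (intro mult_left_mono) auto
      also have "\<dots> \<le> t * sqrt t / 256"
      proof -
        have "t ^ 3 * R / (t * sqrt t) \<le> 1 / (256 * M)" using E unfolding R_def by simp
        then show ?thesis using t M by (simp add: field_simps)
      qed
      finally show ?thesis using ge[OF t(1) t'(1), of m "int n - int m"] tm L by linarith
    qed
    \<comment> \<open>4096 = 256 * 4 * 4: a factor 4 from passing from \<open>n\<close> to
      \<open>m2\<close>, and a factor 1/4 from the volume increment between the cut-offs and the
      factor 2 in the telescoping of the weights.\<close>
    have "t * sqrt t / 4096 * peak_vol t n \<le> t * sqrt t / 4096 * (4 * peak_vol t m2)"
      using v1 t by (intro mult_left_mono) auto
    also have "\<dots> \<le> t * sqrt t / 256 * ((peak_vol t m2 - peak_vol t m1) / 2)"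
    proof -
      have "t * sqrt t * (peak_vol t m2 / 2) \<le> t * sqrt t * (peak_vol t m2 - peak_vol t m1)"
        using v2 t by (intro mult_left_mono) auto
      then show ?thesis by simp
    qed
    also have "\<dots> \<le> t * sqrt t / 256 * (\<Sum>m\<in>{m1<..m2}. peak_weight t m)"
      using sum_peak_weight_bounds(2)[OF t(1), of m1 m2] am t by (intro mult_left_mono) auto
    also have "\<dots> = (\<Sum>m\<in>{m1<..m2}. peak_weight t m * (t * sqrt t / 256))"
      by (simp add: sum_distrib_left mult_ac)
    also have "\<dots> \<le> (\<Sum>m\<in>{m1<..m2}. peak_weight t m * boltz_prob t (slots m) (int n - int m))"
      using p peak_weight_pos[OF t(1)] by (intro sum_mono mult_left_mono) (auto intro: less_imp_le)
    also have "\<dots> \<le> (\<Sum>m = 1..n. peak_weight t m * boltz_prob t (slots m) (int n - int m))"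
    proof (rule sum_mono2)
      show "{m1<..m2} \<subseteq> {1..n}" using m2n by auto
      show "0 \<le> peak_weight t m * boltz_prob t (slots m) (int n - int m)" for m
        using peak_weight_pos[OF t(1), of m] by (simp add: boltz_prob_def)
    qed simp
    also have "\<dots> = boltz_total t n UNIV" by (rule boltz_total_UNIV[OF t(1), symmetric])
    finally show "t * sqrt t / 4096 * peak_vol t n \<le> boltz_total t n UNIV" .
  qed
qed

section \<open>The limit laws\<close>

text \<open>With this choice the normalised multiplicity k X / (B sqrt n) is
  \<open>scale_t n\<close> times k X.\<close>

definition scale_t :: "nat \<Rightarrow> real" where
  "scale_t n = 1 / (scale_B * sqrt (real n))"

lemma scale_t_pos: "0 < n \<Longrightarrow> 0 < scale_t n"
  by (simp add: scale_t_def scale_B_def)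

lemma scale_t_size: "0 < n \<Longrightarrow> real n = pi\<^sup>2 / (3 * (scale_t n)\<^sup>2)"
  by (simp add: scale_t_def scale_B_def power_divide power_mult_distrib)

lemma scale_t_tendsto: "scale_t \<longlonglongrightarrow> 0"
  unfolding scale_t_def scale_B_def by real_asymp

text \<open>Dividing the absolute error of order t^2 |S| by the lower bound of order t^(3/2) for the
  total leaves t^(1/2) |S|; the common factor \<open>peak_vol t n\<close> cancels.\<close>

lemma unimodal_prob_close:
  obtains C n0 where "0 < C" and
    "\<And>S n A. n0 \<le> n \<Longrightarrow> finite S \<Longrightarrow> (\<And>k. k \<in> S \<Longrightarrow> 0 < k \<and> scale_t n * real k \<le> 1 / 16) \<Longrightarrow>
       depends_on A (slab S) \<Longrightarrow>
       \<bar>\<P>(l in unimodal_measure n. mults l \<in> A) - measure_pmf.prob (boltz (scale_t n) (slab S)) A\<bar> \<le>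
         C * sqrt (scale_t n) * (real (card S) + 1)"
proof -
  obtain M where M: "0 < M" and
    ind: "\<And>t S n A. 0 < t \<Longrightarrow> t \<le> 1 / 32 \<Longrightarrow> finite S \<Longrightarrow> (\<And>k. k \<in> S \<Longrightarrow> 0 < k \<and> t * real k \<le> 1 / 16) \<Longrightarrow>
       depends_on A (slab S) \<Longrightarrow>
       \<bar>boltz_total t n A - measure_pmf.prob (boltz t (slab S)) A * boltz_total t n UNIV\<bar> \<le>
         M * t\<^sup>2 * real (card S) * peak_vol t n + peak_vol t (nat \<lfloor>1 / t\<rfloor>)"
    using boltz_total_almost_indep by blast
  obtain t1 where t1: "0 < t1" and
    ge: "\<And>t n. 0 < t \<Longrightarrow> t \<le> t1 \<Longrightarrow> real n = pi\<^sup>2 / (3 * t\<^sup>2) \<Longrightarrow>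
       t * sqrt t / 4096 * peak_vol t n \<le> boltz_total t n UNIV"
    using boltz_total_ge by blast
  have "\<forall>\<^sub>F n in sequentially. scale_t n < min t1 (1 / 32)"
    using t1 by (intro order_tendstoD(2)[OF scale_t_tendsto]) auto
  then have "\<forall>\<^sub>F n in sequentially. scale_t n < min t1 (1 / 32) \<and> 0 < n"
    using eventually_gt_at_top[of "0 :: nat"] by eventually_elim blast
  then obtain n0 where n0: "\<And>n. n0 \<le> n \<Longrightarrow> scale_t n < min t1 (1 / 32) \<and> 0 < n"
    unfolding eventually_sequentially by blast
  show ?thesis
  \<comment> \<open>19683 = 27 * 9^3 comes from \<open>exp_neg_le_cube\<close> at 1 / (9 t), and
    4096 from the lower bound for the total.\<close>
  proof (rule that[of "4096 * (M + 19683)" n0])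
    fix S :: "nat set" and n :: nat and A :: "(nat \<times> side \<Rightarrow> nat) set"
    assume n: "n0 \<le> n" and fin: "finite S"
      and S: "\<And>k. k \<in> S \<Longrightarrow> 0 < k \<and> scale_t n * real k \<le> 1 / 16" and A: "depends_on A (slab S)"
    define t where "t = scale_t n"
    have n': "0 < n" using n0[OF n] by blast
    have t: "0 < t" "t \<le> t1" "t \<le> 1 / 32" using n0[OF n] scale_t_pos unfolding t_def by auto
    have nt: "real n = pi\<^sup>2 / (3 * t\<^sup>2)" unfolding t_def by (rule scale_t_size[OF n'])
    define U where "U = boltz_total t n UNIV"
    define V where "V = peak_vol t n"
    define \<pi> where "\<pi> = measure_pmf.prob (boltz t (slab S)) A"
    have V: "0 < V" unfolding V_def by (rule peak_vol_pos[OF t(1)])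
    have g: "0 < t * sqrt t / 4096" using t by simp
    have U: "t * sqrt t / 4096 * V \<le> U" unfolding U_def V_def by (rule ge[OF t(1,2) nt])
    then have U0: "0 < U" using mult_pos_pos[OF g V] by linarith
    have P: "\<P>(l in unimodal_measure n. mults l \<in> A) = boltz_total t n A / U"
    proof -
      have "\<P>(l in unimodal_measure n. mults l \<in> A) = real (card {l \<in> unimodal_seqs n. mults l \<in> A}) / real (card (unimodal_seqs n))"
        unfolding unimodal_measure_def space_uniform_count_measure
        by (rule measure_uniform_count_measure[OF finite_unimodal_seqs]) auto
      then show ?thesis unfolding U_def boltz_total_def by simp
    qed
    have "peak_vol t (nat \<lfloor>1 / t\<rfloor>) \<le> V * exp (- (1 / (9 * t)))"
      unfolding V_def
    proof (rule peak_vol_small)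
      have "3\<^sup>2 \<le> pi\<^sup>2" using pi_gt3 by (intro power_mono) auto
      then have "9 / (3 * t\<^sup>2) \<le> real n" unfolding nt by (intro divide_right_mono) auto
      moreover have "2 * (1 / t) \<le> 9 / (3 * t\<^sup>2)" using t by (simp add: field_simps power2_eq_square)
      moreover have "real (nat \<lfloor>1 / t\<rfloor>) \<le> 1 / t" using t by (simp add: of_nat_nat)
      ultimately have "real (2 * nat \<lfloor>1 / t\<rfloor>) \<le> real n" by simp
      then show "2 * nat \<lfloor>1 / t\<rfloor> \<le> n" by (simp only: of_nat_le_iff)
    qed (use t in auto)
    also have "\<dots> \<le> V * (19683 * t ^ 3)"
      using exp_neg_le_cube[of "1 / (9 * t)"] t V by (intro mult_left_mono) (auto simp: power_divide power_mult_distrib)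
    finally have Va: "peak_vol t (nat \<lfloor>1 / t\<rfloor>) \<le> V * (19683 * t ^ 3)" .
    have "\<bar>boltz_total t n A / U - \<pi>\<bar> = \<bar>boltz_total t n A - \<pi> * U\<bar> / U"
      using U0 by (simp add: field_simps)
    also have "\<dots> \<le> (M * t\<^sup>2 * real (card S) * V + V * (19683 * t ^ 3)) / U"
      using ind[OF t(1,3) fin _ A, of n] S Va U0 unfolding \<pi>_def U_def V_def t_def
      by (intro divide_right_mono) auto
    also have "\<dots> \<le> (M * t\<^sup>2 * real (card S) * V + V * (19683 * t ^ 3)) / (t * sqrt t / 4096 * V)"
      using U U0 g V t M by (intro divide_left_mono mult_pos_pos add_nonneg_nonneg mult_nonneg_nonneg) auto
    also have "\<dots> = 4096 * (M * real (card S) * (t\<^sup>2 / (t * sqrt t)) + 19683 * (t ^ 3 / (t * sqrt t)))"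
      using t V by (simp add: field_simps)
    also have "\<dots> = 4096 * (M * real (card S) * sqrt t + 19683 * (t * sqrt t))"
    proof -
      have "t\<^sup>2 = sqrt t * (t * sqrt t)" "t ^ 3 = (t * sqrt t) * (t * sqrt t)"
        using t by (simp_all add: power2_eq_square power3_eq_cube)
      then have "t\<^sup>2 / (t * sqrt t) = sqrt t" "t ^ 3 / (t * sqrt t) = t * sqrt t" using t by simp_all
      then show ?thesis by simp
    qed
    also have "\<dots> \<le> 4096 * ((M + 19683) * (real (card S) + 1) * sqrt t)"
    proof -
      have "t * sqrt t \<le> 1 * sqrt t" using t by (intro mult_right_mono) auto
      moreover have "0 \<le> real (card S) * sqrt t" "0 \<le> M * sqrt t" using t M by auto
      ultimately show ?thesis by (simp add: algebra_simps)
    qed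
    finally have "\<bar>boltz_total t n A / U - \<pi>\<bar> \<le> 4096 * (M + 19683) * sqrt t * (real (card S) + 1)"
      by (simp add: mult_ac)
    then show "\<bar>\<P>(l in unimodal_measure n. mults l \<in> A) - measure_pmf.prob (boltz (scale_t n) (slab S)) A\<bar> \<le>
         4096 * (M + 19683) * sqrt (scale_t n) * (real (card S) + 1)"
      unfolding P \<pi>_def t_def .
  qed (use M in simp)
qed

section \<open>From geometric to exponential laws\<close>

text \<open>The geometric distribution function is exactly 1 - exp (- s (c + 1)) with c the integer
  part of u / s, and s (c + 1) lies between u and u + s. The error is uniform in
  \<open>u\<close>.\<close>

lemma geometric_prob_close:
  assumes "0 < s" "0 \<le> u"
  shows "\<bar>measure_pmf.prob (geometric_pmf (1 - exp (- s))) {y. s * real y \<le> u} - (1 - exp (- u))\<bar> \<le> s"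
proof -
  define c where "c = nat \<lfloor>u / s\<rfloor>"
  have c: "real c \<le> u / s" "u / s < real c + 1" using assms unfolding c_def by (auto simp: of_nat_nat)
  have "{y. s * real y \<le> u} = {..c}"
  proof -
    have "s * real y \<le> u \<longleftrightarrow> y \<le> c" for y
    proof -
      have "s * real y \<le> u \<longleftrightarrow> real y \<le> u / s" using assms by (simp add: field_simps)
      also have "\<dots> \<longleftrightarrow> y \<le> c" using c by linarith
      finally show ?thesis .
    qed
    then show ?thesis by auto
  qed
  then have "measure_pmf.prob (geometric_pmf (1 - exp (- s))) {y. s * real y \<le> u} = (\<Sum>y\<le>c. exp (- s) ^ y * (1 - exp (- s)))"
    using assms by (simp add: measure_measure_pmf_finite)
  also have "\<dots> = 1 - exp (- s) ^ Suc c"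
    by (induction c) (simp_all add: algebra_simps)
  also have "exp (- s) ^ Suc c = exp (- (s * (real c + 1)))"
    by (simp add: exp_of_nat_mult[symmetric] mult_exp_exp algebra_simps)
  finally have p: "measure_pmf.prob (geometric_pmf (1 - exp (- s))) {y. s * real y \<le> u} = 1 - exp (- (s * (real c + 1)))" .
  have lo: "u \<le> s * (real c + 1)" using c assms by (simp add: field_simps)
  have hi: "s * (real c + 1) \<le> u + s" using c assms by (simp add: field_simps)
  have "exp (- u) - exp (- (s * (real c + 1))) \<le> exp (- u) - exp (- (u + s))" using hi by simp
  also have "\<dots> = exp (- u) * (1 - exp (- s))" by (simp add: right_diff_distrib mult_exp_exp)
  also have "\<dots> \<le> 1 * s" using exp_ge_add_one_self[of "- s"] assms by (intro mult_mono) auto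
  finally show ?thesis unfolding p using lo by simp
qed

text \<open>Products of numbers in [0, 1] differ by at most the sum of the differences of their
  factors.\<close>

lemma boltz_box_prob_close:
  assumes "0 < t" "finite S" "\<And>k. k \<in> S \<Longrightarrow> 0 < k" "\<And>i. i \<in> slab S \<Longrightarrow> 0 \<le> u i"
  shows "\<bar>measure_pmf.prob (boltz t (slab S)) {x. \<forall>i\<in>slab S. t * real (fst i) * real (x i) \<le> u i} -
    (\<Prod>i\<in>slab S. 1 - exp (- u i))\<bar> \<le> t * (\<Sum>i\<in>slab S. real (fst i))"
proof -
  have fin: "finite (slab S)" using assms by (simp add: slab_def)
  let ?p = "\<lambda>i. measure_pmf.prob (geometric_pmf (1 - exp (- (t * real (fst i))))) {y. t * real (fst i) * real y \<le> u i}"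
  have "{x. \<forall>i\<in>slab S. t * real (fst i) * real (x i) \<le> u i} = Pi (slab S) (\<lambda>i. {y. t * real (fst i) * real y \<le> u i})"
    by auto
  then have eq: "measure_pmf.prob (boltz t (slab S)) {x. \<forall>i\<in>slab S. t * real (fst i) * real (x i) \<le> u i} = (\<Prod>i\<in>slab S. ?p i)"
    unfolding boltz_def by (simp only: measure_Pi_pmf_Pi[OF fin])
  have "norm ((\<Prod>i\<in>slab S. ?p i) - (\<Prod>i\<in>slab S. 1 - exp (- u i))) \<le> (\<Sum>i\<in>slab S. norm (?p i - (1 - exp (- u i))))"
    using assms by (intro norm_prod_diff) auto
  also have "\<dots> \<le> (\<Sum>i\<in>slab S. t * real (fst i))"
  proof (rule sum_mono)
    fix i assume i: "i \<in> slab S"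
    then have "fst i \<in> S" unfolding slab_def by (cases i) simp
    then have "0 < fst i" by (rule assms(3))
    then have "0 < t * real (fst i)" using assms(1) by simp
    from geometric_prob_close[OF this assms(4)[OF i]]
    show "norm (?p i - (1 - exp (- u i))) \<le> t * real (fst i)" unfolding real_norm_def .
  qed
  finally show ?thesis unfolding real_norm_def sum_distrib_left eq .
qed

lemma unimodal_box_prob_close:
  obtains C n0 where "0 < C" and
    "\<And>S n u. n0 \<le> n \<Longrightarrow> finite S \<Longrightarrow> (\<And>k. k \<in> S \<Longrightarrow> 0 < k \<and> scale_t n * real k \<le> 1 / 16) \<Longrightarrow>
       (\<And>i. i \<in> slab S \<Longrightarrow> 0 \<le> u i) \<Longrightarrow>
       \<bar>\<P>(l in unimodal_measure n. \<forall>i\<in>slab S. scale_t n * real (fst i) * real (mults l i) \<le> u i) -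
          (\<Prod>i\<in>slab S. 1 - exp (- u i))\<bar> \<le>
         C * sqrt (scale_t n) * (real (card S) + 1) + scale_t n * (\<Sum>i\<in>slab S. real (fst i))"
proof -
  obtain C n0 where C: "0 < C" and
    close: "\<And>S n A. n0 \<le> n \<Longrightarrow> finite S \<Longrightarrow> (\<And>k. k \<in> S \<Longrightarrow> 0 < k \<and> scale_t n * real k \<le> 1 / 16) \<Longrightarrow>
       depends_on A (slab S) \<Longrightarrow>
       \<bar>\<P>(l in unimodal_measure n. mults l \<in> A) - measure_pmf.prob (boltz (scale_t n) (slab S)) A\<bar> \<le>
         C * sqrt (scale_t n) * (real (card S) + 1)"
    using unimodal_prob_close by blast
  show ?thesis
  \<comment> \<open>The successor excludes n = 0, so that \<open>scale_t n\<close> is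
    positive.\<close>
  proof (rule that[of C "Suc n0"])
    fix S :: "nat set" and n :: nat and u :: "nat \<times> side \<Rightarrow> real"
    assume n: "Suc n0 \<le> n" and fin: "finite S"
      and S: "\<And>k. k \<in> S \<Longrightarrow> 0 < k \<and> scale_t n * real k \<le> 1 / 16" and u: "\<And>i. i \<in> slab S \<Longrightarrow> 0 \<le> u i"
    let ?A = "{x. \<forall>i\<in>slab S. scale_t n * real (fst i) * real (x i) \<le> u i}"
    have n': "n0 \<le> n" "0 < n" using n by auto
    have dep: "depends_on ?A (slab S)" unfolding depends_on_def by simp
    have "\<bar>\<P>(l in unimodal_measure n. mults l \<in> ?A) - measure_pmf.prob (boltz (scale_t n) (slab S)) ?A\<bar> \<le>
         C * sqrt (scale_t n) * (real (card S) + 1)"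
      by (rule close[OF n'(1) fin S dep])
    moreover have "\<bar>measure_pmf.prob (boltz (scale_t n) (slab S)) ?A - (\<Prod>i\<in>slab S. 1 - exp (- u i))\<bar> \<le>
       scale_t n * (\<Sum>i\<in>slab S. real (fst i))"
      by (rule boltz_box_prob_close) (use scale_t_pos[OF n'(2)] fin S u in auto)
    ultimately show "\<bar>\<P>(l in unimodal_measure n. \<forall>i\<in>slab S. scale_t n * real (fst i) * real (mults l i) \<le> u i) -
          (\<Prod>i\<in>slab S. 1 - exp (- u i))\<bar> \<le>
         C * sqrt (scale_t n) * (real (card S) + 1) + scale_t n * (\<Sum>i\<in>slab S. real (fst i))"
      unfolding mem_Collect_eq by linarith
  qed (rule C)
qed

lemma integral_exp_neg: "0 \<le> v \<Longrightarrow> integral {0..v} (\<lambda>u. exp (- u)) = 1 - exp (- v)" for v :: real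
proof (rule integral_unique)
  assume "0 \<le> v"
  then have "((\<lambda>u. exp (- u)) has_integral (- exp (- v) - - exp (- 0))) {0..v}"
    by (intro fundamental_theorem_of_calculus)
       (auto simp flip: has_real_derivative_iff_has_vector_derivative intro!: derivative_eq_intros)
  then show "((\<lambda>u. exp (- u)) has_integral (1 - exp (- v))) {0..v}" by simp
qed

lemma tendsto_zero_of_bound:
  fixes f g :: "nat \<Rightarrow> real"
  assumes "\<forall>\<^sub>F n in sequentially. \<bar>f n\<bar> \<le> g n" "g \<longlonglongrightarrow> 0"
  shows "f \<longlonglongrightarrow> 0"
  by (rule Lim_null_comparison[OF _ assms(2)]) (use assms(1) in simp)

text \<open>Since \<open>scale_t n\<close> has order n^(-1/2), the two errors, of order sqrt t (K +
  1) and t K^2, vanish exactly when K is small against n^(1/4).\<close>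

lemma unimodal_joint_law:
  fixes K :: "nat \<Rightarrow> nat" and v :: "nat \<Rightarrow> nat \<Rightarrow> side \<Rightarrow> real"
  assumes K: "(\<lambda>n. real (K n)) \<in> o(\<lambda>n. real n powr (1/4))"
    and v: "\<And>n k j. k \<in> {1..K n} \<Longrightarrow> j \<in> {Lft, Rgt} \<Longrightarrow> 0 \<le> v n k j"
  shows "(\<lambda>n. \<P>(l in unimodal_measure n. \<forall>k\<in>{1..K n}. \<forall>j\<in>{Lft, Rgt}.
                real k * real (part_mult j k l) / (scale_B * sqrt (real n)) \<le> v n k j)
            - (\<Prod>(k, j)\<in>{1..K n} \<times> {Lft, Rgt}. integral {0..v n k j} (\<lambda>u. exp (- u))))
         \<longlonglongrightarrow> 0"
proof -
  obtain C n0 where C: "0 < C" and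
    close: "\<And>S n u. n0 \<le> n \<Longrightarrow> finite S \<Longrightarrow> (\<And>k. k \<in> S \<Longrightarrow> 0 < k \<and> scale_t n * real k \<le> 1 / 16) \<Longrightarrow>
       (\<And>i. i \<in> slab S \<Longrightarrow> 0 \<le> u i) \<Longrightarrow>
       \<bar>\<P>(l in unimodal_measure n. \<forall>i\<in>slab S. scale_t n * real (fst i) * real (mults l i) \<le> u i) -
          (\<Prod>i\<in>slab S. 1 - exp (- u i))\<bar> \<le>
         C * sqrt (scale_t n) * (real (card S) + 1) + scale_t n * (\<Sum>i\<in>slab S. real (fst i))"
    using unimodal_box_prob_close by blast
  let ?r = "\<lambda>n. real (K n) / real n powr (1/4)"
  have r: "?r \<longlonglongrightarrow> 0" by (rule smalloD_tendsto[OF K])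
  let ?g = "\<lambda>n. C * sqrt (scale_t n) * (real (K n) + 1) + scale_t n * (2 * (real (K n) * real (K n)))"
  have g: "?g \<longlonglongrightarrow> 0"
  proof -
    have a: "(\<lambda>n. sqrt (scale_t n) * real n powr (1/4)) \<longlonglongrightarrow> sqrt (1 / scale_B)"
    proof (rule tendsto_eventually)
      show "\<forall>\<^sub>F n in sequentially. sqrt (scale_t n) * real n powr (1/4) = sqrt (1 / scale_B)"
        using eventually_gt_at_top[of "0 :: nat"]
      proof eventually_elim
        case (elim n)
        have "sqrt (sqrt (real n)) = real n powr (1/4)"
          using elim by (simp add: powr_half_sqrt[symmetric] powr_powr)
        then show ?case using elim by (simp add: scale_t_def real_sqrt_divide real_sqrt_mult)
      qed
    qed
    have b: "(\<lambda>n. scale_t n * (real n powr (1/4))\<^sup>2) \<longlonglongrightarrow> (sqrt (1 / scale_B))\<^sup>2"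
    proof (rule Lim_transform_eventually[OF tendsto_power[OF a, of 2]])
      show "\<forall>\<^sub>F n in sequentially. (sqrt (scale_t n) * real n powr (1/4))\<^sup>2 = scale_t n * (real n powr (1/4))\<^sup>2"
        using eventually_gt_at_top[of "0 :: nat"]
        by eventually_elim (simp add: power_mult_distrib less_imp_le[OF scale_t_pos])
    qed
    have st: "(\<lambda>n. sqrt (scale_t n)) \<longlonglongrightarrow> 0" using tendsto_real_sqrt[OF scale_t_tendsto] by simp
    have "(\<lambda>n. C * ((sqrt (scale_t n) * real n powr (1/4)) * ?r n + sqrt (scale_t n)) +
        2 * ((scale_t n * (real n powr (1/4))\<^sup>2) * (?r n * ?r n))) \<longlonglongrightarrow>
        C * (sqrt (1 / scale_B) * 0 + 0) + 2 * ((sqrt (1 / scale_B))\<^sup>2 * (0 * 0))"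
      by (intro tendsto_intros a b r st)
    moreover have "\<forall>\<^sub>F n in sequentially. C * ((sqrt (scale_t n) * real n powr (1/4)) * ?r n + sqrt (scale_t n)) +
        2 * ((scale_t n * (real n powr (1/4))\<^sup>2) * (?r n * ?r n)) = ?g n"
      using eventually_gt_at_top[of "0 :: nat"]
      by eventually_elim (simp add: power2_eq_square distrib_left)
    ultimately show ?thesis by (simp add: Lim_transform_eventually)
  qed
  have small: "\<forall>\<^sub>F n in sequentially. scale_t n * real (K n) \<le> 1 / 16"
  proof -
    have "\<forall>\<^sub>F n in sequentially. ?g n < 1 / 16" by (rule order_tendstoD(2)[OF g]) simp
    then show ?thesis using eventually_gt_at_top[of "0 :: nat"]
    proof eventually_elim
      case (elim n)
      \<comment> \<open>The smallness of t K is read off from the term t K^2 of the error bound, as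
        K is a natural number.\<close>
      have "real (K n) \<le> real (K n) * real (K n)" by (cases "K n") auto
      then have "scale_t n * real (K n) \<le> scale_t n * (2 * (real (K n) * real (K n)))"
        using scale_t_pos[OF elim(2)] by (intro mult_left_mono) auto
      also have "\<dots> \<le> ?g n" using C scale_t_pos[OF elim(2)] by simp
      finally show ?case using elim by simp
    qed
  qed
  show ?thesis
  proof (rule tendsto_zero_of_bound[OF _ g])
    show "\<forall>\<^sub>F n in sequentially. \<bar>\<P>(l in unimodal_measure n. \<forall>k\<in>{1..K n}. \<forall>j\<in>{Lft, Rgt}.
                real k * real (part_mult j k l) / (scale_B * sqrt (real n)) \<le> v n k j)
            - (\<Prod>(k, j)\<in>{1..K n} \<times> {Lft, Rgt}. integral {0..v n k j} (\<lambda>u. exp (- u)))\<bar> \<le> ?g n"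
      using small eventually_ge_at_top[of "Suc n0"]
    proof eventually_elim
      case (elim n)
      let ?S = "{1..K n}"
      have t: "0 < scale_t n" using elim by (intro scale_t_pos) simp
      have S: "0 < k \<and> scale_t n * real k \<le> 1 / 16" if "k \<in> ?S" for k
      proof -
        have "scale_t n * real k \<le> scale_t n * real (K n)" using that t by (intro mult_left_mono) auto
        then show ?thesis using that elim by auto
      qed
      have u: "0 \<le> (\<lambda>(k, j). v n k j) i" if "i \<in> slab ?S" for i
        using that v by (auto simp: slab_def)
      have ev: "(\<forall>k\<in>?S. \<forall>j\<in>{Lft, Rgt}. real k * real (part_mult j k l) / (scale_B * sqrt (real n)) \<le> v n k j) \<longleftrightarrow>
        (\<forall>i\<in>slab ?S. scale_t n * real (fst i) * real (mults l i) \<le> (\<lambda>(k, j). v n k j) i)" for l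
        unfolding slab_def mults_def scale_t_def by auto
      have pr: "(\<Prod>(k, j)\<in>?S \<times> {Lft, Rgt}. integral {0..v n k j} (\<lambda>u. exp (- u))) =
        (\<Prod>i\<in>slab ?S. 1 - exp (- (\<lambda>(k, j). v n k j) i))"
        unfolding slab_def using v by (intro prod.cong refl) (auto simp: integral_exp_neg)
      have "(\<Sum>i\<in>slab ?S. real (fst i)) \<le> (\<Sum>i\<in>slab ?S. real (K n))"
        by (intro sum_mono) (auto simp: slab_def)
      also have "\<dots> = 2 * (real (K n) * real (K n))" by (simp add: slab_def card_cartesian_product)
      finally have "scale_t n * (\<Sum>i\<in>slab ?S. real (fst i)) \<le> scale_t n * (2 * (real (K n) * real (K n)))"
        using t by (intro mult_left_mono) auto
      then show ?case
        using close[of n ?S "\<lambda>(k, j). v n k j", OF _ _ S u] elim unfolding ev pr by simp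
    qed
  qed
qed

text \<open>With the single part size \<open>k n\<close> in the slab the error has order sqrt t + t
  k, so t k -> 0 is enough.\<close>

lemma unimodal_single_law:
  fixes k :: "nat \<Rightarrow> nat"
  assumes pos: "\<And>n. 0 < k n" and k: "(\<lambda>n. real (k n)) \<in> o(\<lambda>n. real n powr (1/2))"
    and v: "0 \<le> vL" "0 \<le> vR"
  shows "(\<lambda>n. \<P>(l in unimodal_measure n.
                real (k n) * real (part_mult Lft (k n) l) / (scale_B * sqrt (real n)) \<le> vL \<and>
                real (k n) * real (part_mult Rgt (k n) l) / (scale_B * sqrt (real n)) \<le> vR))
         \<longlonglongrightarrow> (1 - exp (- vL)) * (1 - exp (- vR))"
proof -
  obtain C n0 where C: "0 < C" and
    close: "\<And>S n u. n0 \<le> n \<Longrightarrow> finite S \<Longrightarrow> (\<And>k. k \<in> S \<Longrightarrow> 0 < k \<and> scale_t n * real k \<le> 1 / 16) \<Longrightarrow>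
       (\<And>i. i \<in> slab S \<Longrightarrow> 0 \<le> u i) \<Longrightarrow>
       \<bar>\<P>(l in unimodal_measure n. \<forall>i\<in>slab S. scale_t n * real (fst i) * real (mults l i) \<le> u i) -
          (\<Prod>i\<in>slab S. 1 - exp (- u i))\<bar> \<le>
         C * sqrt (scale_t n) * (real (card S) + 1) + scale_t n * (\<Sum>i\<in>slab S. real (fst i))"
    using unimodal_box_prob_close by blast
  have r: "(\<lambda>n. real (k n) / real n powr (1/2)) \<longlonglongrightarrow> 0" by (rule smalloD_tendsto[OF k])
  have tk: "(\<lambda>n. scale_t n * real (k n)) \<longlonglongrightarrow> 0"
  proof -
    have "(\<lambda>n. 1 / scale_B * (real (k n) / real n powr (1/2))) \<longlonglongrightarrow> 1 / scale_B * 0"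
      by (intro tendsto_intros r)
    then show ?thesis by (simp add: scale_t_def powr_half_sqrt)
  qed
  have st: "(\<lambda>n. sqrt (scale_t n)) \<longlonglongrightarrow> 0" using tendsto_real_sqrt[OF scale_t_tendsto] by simp
  let ?g = "\<lambda>n. C * sqrt (scale_t n) * 2 + 2 * (scale_t n * real (k n))"
  have "?g \<longlonglongrightarrow> C * 0 * 2 + 2 * 0" by (intro tendsto_intros st tk)
  then have g: "?g \<longlonglongrightarrow> 0" by simp
  have small: "\<forall>\<^sub>F n in sequentially. scale_t n * real (k n) < 1 / 16"
    by (rule order_tendstoD(2)[OF tk]) simp
  have "(\<lambda>n. \<P>(l in unimodal_measure n.
                real (k n) * real (part_mult Lft (k n) l) / (scale_B * sqrt (real n)) \<le> vL \<and>
                real (k n) * real (part_mult Rgt (k n) l) / (scale_B * sqrt (real n)) \<le> vR) -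
           (1 - exp (- vL)) * (1 - exp (- vR))) \<longlonglongrightarrow> 0"
  proof (rule tendsto_zero_of_bound[OF _ g])
    show "\<forall>\<^sub>F n in sequentially. \<bar>\<P>(l in unimodal_measure n.
                real (k n) * real (part_mult Lft (k n) l) / (scale_B * sqrt (real n)) \<le> vL \<and>
                real (k n) * real (part_mult Rgt (k n) l) / (scale_B * sqrt (real n)) \<le> vR) -
           (1 - exp (- vL)) * (1 - exp (- vR))\<bar> \<le> ?g n"
      using small eventually_ge_at_top[of "Suc n0"]
    proof eventually_elim
      case (elim n)
      let ?u = "\<lambda>i. if snd i = Lft then vL else vR"
      have S: "0 < i \<and> scale_t n * real i \<le> 1 / 16" if "i \<in> {k n}" for i
        using that elim pos[of n] by auto
      have sl: "slab {k n} = {(k n, Lft), (k n, Rgt)}" by (auto simp: slab_def)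
      have u: "0 \<le> ?u i" for i using v by simp
      have ev: "(real (k n) * real (part_mult Lft (k n) l) / (scale_B * sqrt (real n)) \<le> vL \<and>
                real (k n) * real (part_mult Rgt (k n) l) / (scale_B * sqrt (real n)) \<le> vR) \<longleftrightarrow>
        (\<forall>i\<in>slab {k n}. scale_t n * real (fst i) * real (mults l i) \<le> ?u i)" for l
        unfolding sl by (simp add: mults_def scale_t_def)
      have pr: "(1 - exp (- vL)) * (1 - exp (- vR)) = (\<Prod>i\<in>slab {k n}. 1 - exp (- ?u i))"
        unfolding sl by simp
      have sm: "scale_t n * (\<Sum>i\<in>slab {k n}. real (fst i)) = 2 * (scale_t n * real (k n))"
        unfolding sl by simp
      show ?case
        using close[of n "{k n}" ?u, OF _ _ S u] elim unfolding ev pr sm by simp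
    qed
  qed
  then show ?thesis by (rule LIM_zero_cancel)
qed

theorem theorem1p5:
  shows
    "(\<forall>(K :: nat \<Rightarrow> nat) (v :: nat \<Rightarrow> nat \<Rightarrow> side \<Rightarrow> real).
       (\<forall>n. 0 < K n) \<longrightarrow>
       (\<lambda>n. real (K n)) \<in> o(\<lambda>n. real n powr (1/4)) \<longrightarrow>
       (\<forall>n. \<forall>k\<in>{1..K n}. \<forall>j\<in>{Lft, Rgt}. 0 \<le> v n k j) \<longrightarrow>
       (\<lambda>n. \<P>(l in unimodal_measure n. \<forall>k\<in>{1..K n}. \<forall>j\<in>{Lft, Rgt}.
                real k * real (part_mult j k l) / (scale_B * sqrt (real n)) \<le> v n k j)
            - (\<Prod>(k, j)\<in>{1..K n} \<times> {Lft, Rgt}. integral {0..v n k j} (\<lambda>u. exp (- u))))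
         \<longlonglongrightarrow> 0)
    \<and>
    (\<forall>(k :: nat \<Rightarrow> nat) (vL :: real) (vR :: real).
       (\<forall>n. 0 < k n) \<longrightarrow>
       (\<lambda>n. real (k n)) \<in> o(\<lambda>n. real n powr (1/2)) \<longrightarrow>
       0 \<le> vL \<longrightarrow> 0 \<le> vR \<longrightarrow>
       (\<lambda>n. \<P>(l in unimodal_measure n.
                real (k n) * real (part_mult Lft (k n) l) / (scale_B * sqrt (real n)) \<le> vL \<and>
                real (k n) * real (part_mult Rgt (k n) l) / (scale_B * sqrt (real n)) \<le> vR))
         \<longlonglongrightarrow> (1 - exp (- vL)) * (1 - exp (- vR)))"
proof (intro conjI allI impI)
  fix K :: "nat \<Rightarrow> nat" and v :: "nat \<Rightarrow> nat \<Rightarrow> side \<Rightarrow> real"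
  assume "(\<lambda>n. real (K n)) \<in> o(\<lambda>n. real n powr (1/4))"
    and "\<forall>n. \<forall>k\<in>{1..K n}. \<forall>j\<in>{Lft, Rgt}. 0 \<le> v n k j"
  then show "(\<lambda>n. \<P>(l in unimodal_measure n. \<forall>k\<in>{1..K n}. \<forall>j\<in>{Lft, Rgt}.
                real k * real (part_mult j k l) / (scale_B * sqrt (real n)) \<le> v n k j)
            - (\<Prod>(k, j)\<in>{1..K n} \<times> {Lft, Rgt}. integral {0..v n k j} (\<lambda>u. exp (- u))))
         \<longlonglongrightarrow> 0"
    by (intro unimodal_joint_law) blast+
next
  fix k :: "nat \<Rightarrow> nat" and vL vR :: real
  assume "\<forall>n. 0 < k n" "(\<lambda>n. real (k n)) \<in> o(\<lambda>n. real n powr (1/2))" "0 \<le> vL" "0 \<le> vR"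
  then show "(\<lambda>n. \<P>(l in unimodal_measure n.
                real (k n) * real (part_mult Lft (k n) l) / (scale_B * sqrt (real n)) \<le> vL \<and>
                real (k n) * real (part_mult Rgt (k n) l) / (scale_B * sqrt (real n)) \<le> vR))
         \<longlonglongrightarrow> (1 - exp (- vL)) * (1 - exp (- vR))"
    by (intro unimodal_single_law) blast+
qed

end
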